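(* Let $N\ge 3$ and consider the following two random quantum circuit ensembles on $N$ qubits (local dimension $2$). The ensemble $C$ is the random unitary $U_5U_4U_3U_2U_1$, where the $U_i$ are independent and each $U_i$ is a Haar-random unitary on its support (tensored with the identity elsewhere), with supports: $U_1$ acts on qubits $\{2,3,\dots,N\}$, $U_2$ acts on qubits $\{1,2\}$, $U_3$ acts on qubits $\{1,3,4,\dots,N\}$, $U_4$ acts on qubits $\{1,2\}$, and $U_5$ acts on qubits $\{2,3,\dots,N\}$. The ensemble $C'$ is obtained by deleting $U_2$ and $U_4$, i.e. it is the random unitary $U_5U_3U_1$ with the same supports for $U_1,U_3,U_5$. For a positive integer $d$, $C^d$ (resp. $C'^d$) denotes the product of $d$ independent copies of a unitary drawn from $C$ (resp. $C'$). Then for all sufficiently large $N$ there exist $\epsilon>0$ and a positive integer $d$ such that $C'^d$ is an $\epsilon$-approximate $2$-design but $C^d$ is not. This holds both when "$\epsilon$-approximate $2$-design" is understood in the additive-error sense and when it is understood in the multiplicative-error sense.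
   Context: For a probability distribution $\nu$ on unitaries acting on $\mathcal{H}=(\mathbb{C}^2)^{\otimes N}$, its $t$-th moment operator is the channel $\Phi_\nu(X)=\mathbb{E}_{U\sim\nu}\left[U^{\otimes t}X(U^\dagger)^{\otimes t}\right]$ on operators on $\mathcal{H}^{\otimes t}$; $\Phi_{\mathrm{Haar}}$ denotes the moment operator of the Haar measure on the full unitary group of $\mathcal{H}$. The ensemble $\nu$ is an $\epsilon$-approximate $t$-design with additive error if $\|\Phi_\nu-\Phi_{\mathrm{Haar}}\|_\diamond\le\epsilon$ (diamond norm). It is an $\epsilon$-approximate $t$-design with multiplicative error if both $\epsilon\Phi_{\mathrm{Haar}}+(\Phi_\nu-\Phi_{\mathrm{Haar}})$ and $\epsilon\Phi_{\mathrm{Haar}}-(\Phi_\nu-\Phi_{\mathrm{Haar}})$ are completely positive. Here $t=2$. *)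

theory Defs
  imports "HOL-Probability.Probability"
begin

text \<open>Matrices are represented as functions nat => nat => complex, together with an
explicit dimension n; only the entries with indices below n are meaningful.
Basis states of N qubits are the numbers 0..<2^N; qubit q (q = 1..N) is bit q-1.\<close>

type_synonym cmat = "nat \<Rightarrow> nat \<Rightarrow> complex"

definition idm :: "nat \<Rightarrow> cmat" where
  "idm n = (\<lambda>i j. if i = j \<and> i < n then 1 else 0)"

definition mmul :: "nat \<Rightarrow> cmat \<Rightarrow> cmat \<Rightarrow> cmat" where
  "mmul n A B = (\<lambda>i j. if i < n \<and> j < n then (\<Sum>k<n. A i k * B k j) else 0)"

definition adj :: "cmat \<Rightarrow> cmat" where
  "adj A = (\<lambda>i j. cnj (A j i))"

definition supported :: "nat \<Rightarrow> cmat \<Rightarrow> bool" where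
  "supported n A \<longleftrightarrow> (\<forall>i j. \<not> (i < n \<and> j < n) \<longrightarrow> A i j = 0)"

definition unitaries :: "nat \<Rightarrow> cmat set" where
  "unitaries n = {U. supported n U \<and> mmul n (adj U) U = idm n}"

definition mtrace :: "nat \<Rightarrow> cmat \<Rightarrow> complex" where
  "mtrace n A = (\<Sum>i<n. A i i)"

definition psd :: "nat \<Rightarrow> cmat \<Rightarrow> bool" where
  "psd n M \<longleftrightarrow> supported n M \<and> (\<forall>i j. M i j = cnj (M j i)) \<and>
     (\<forall>x. 0 \<le> Re (\<Sum>i<n. \<Sum>j<n. cnj (x i) * M i j * x j))"

definition psd_sqrt :: "nat \<Rightarrow> cmat \<Rightarrow> cmat" where
  "psd_sqrt n M = (THE R. psd n R \<and> mmul n R R = M)"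

definition trace_norm :: "nat \<Rightarrow> cmat \<Rightarrow> real" where
  "trace_norm n A = Re (mtrace n (psd_sqrt n (mmul n (adj A) A)))"

text \<open>Kronecker product of an m x m and an n x n matrix (index (i,a) ~ i*n+a).\<close>
definition kron :: "nat \<Rightarrow> nat \<Rightarrow> cmat \<Rightarrow> cmat \<Rightarrow> cmat" where
  "kron m n A B = (\<lambda>p q. if p < m * n \<and> q < m * n
      then A (p div n) (q div n) * B (p mod n) (q mod n) else 0)"

definition tensor_id :: "nat \<Rightarrow> nat \<Rightarrow> (cmat \<Rightarrow> cmat) \<Rightarrow> cmat \<Rightarrow> cmat" where
  "tensor_id m k \<Phi> Y = (\<lambda>p q. if p < m * k \<and> q < m * k then
      \<Phi> (\<lambda>i j. if i < m \<and> j < m then Y (i * k + p mod k) (j * k + q mod k) else 0)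
        (p div k) (q div k) else 0)"

definition diamond_norm :: "nat \<Rightarrow> (cmat \<Rightarrow> cmat) \<Rightarrow> real" where
  "diamond_norm m \<Phi> = Sup {trace_norm (m * m) (tensor_id m m \<Phi> Y) | Y. trace_norm (m * m) Y \<le> 1}"

definition completely_positive :: "nat \<Rightarrow> (cmat \<Rightarrow> cmat) \<Rightarrow> bool" where
  "completely_positive m \<Phi> \<longleftrightarrow> (\<forall>k Y. psd (m * k) Y \<longrightarrow> psd (m * k) (tensor_id m k \<Phi> Y))"

definition haar :: "nat \<Rightarrow> cmat measure" where
  "haar n = (SOME \<mu>. sets \<mu> = sets borel \<and> prob_space \<mu> \<and> emeasure \<mu> (unitaries n) = 1 \<and>
      (\<forall>V \<in> unitaries n. distr \<mu> borel (\<lambda>U. mmul n V U) = \<mu>))"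

definition moment2 :: "nat \<Rightarrow> cmat measure \<Rightarrow> cmat \<Rightarrow> cmat" where
  "moment2 D \<nu> X = (\<lambda>i j. LINT U|\<nu>.
      mmul (D * D) (mmul (D * D) (kron D D U U) X) (adj (kron D D U U)) i j)"

definition additive_2design :: "nat \<Rightarrow> cmat measure \<Rightarrow> real \<Rightarrow> bool" where
  "additive_2design D \<nu> \<epsilon> \<longleftrightarrow>
     diamond_norm (D * D) (\<lambda>X i j. moment2 D \<nu> X i j - moment2 D (haar D) X i j) \<le> \<epsilon>"

definition multiplicative_2design :: "nat \<Rightarrow> cmat measure \<Rightarrow> real \<Rightarrow> bool" where
  "multiplicative_2design D \<nu> \<epsilon> \<longleftrightarrow>
     completely_positive (D * D) (\<lambda>X i j. of_real \<epsilon> * moment2 D (haar D) X i j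
         + (moment2 D \<nu> X i j - moment2 D (haar D) X i j)) \<and>
     completely_positive (D * D) (\<lambda>X i j. of_real \<epsilon> * moment2 D (haar D) X i j
         - (moment2 D \<nu> X i j - moment2 D (haar D) X i j))"

definition bitof :: "nat \<Rightarrow> nat \<Rightarrow> nat" where
  "bitof x q = x div 2 ^ q mod 2"

definition sub_index :: "nat list \<Rightarrow> nat \<Rightarrow> nat" where
  "sub_index S x = (\<Sum>k<length S. bitof x (S ! k - 1) * 2 ^ k)"

definition embed :: "nat \<Rightarrow> nat list \<Rightarrow> cmat \<Rightarrow> cmat" where
  "embed N S U = (\<lambda>x y. if x < 2 ^ N \<and> y < 2 ^ N \<and>
       (\<forall>q \<in> {1..N} - set S. bitof x (q - 1) = bitof y (q - 1))
     then U (sub_index S x) (sub_index S y) else 0)"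

definition gate :: "nat \<Rightarrow> nat list \<Rightarrow> cmat measure" where
  "gate N S = distr (haar (2 ^ length S)) borel (embed N S)"

definition ens_prod :: "nat \<Rightarrow> cmat measure \<Rightarrow> cmat measure \<Rightarrow> cmat measure" where
  "ens_prod D \<mu> \<nu> = distr (\<mu> \<Otimes>\<^sub>M \<nu>) borel (\<lambda>(A, B). mmul D A B)"

fun ens_pow :: "nat \<Rightarrow> cmat measure \<Rightarrow> nat \<Rightarrow> cmat measure" where
  "ens_pow D \<mu> 0 = return borel (idm D)"
| "ens_pow D \<mu> (Suc d) = ens_prod D \<mu> (ens_pow D \<mu> d)"

definition circC :: "nat \<Rightarrow> cmat measure" where
  "circC N = ens_prod (2 ^ N) (gate N [2..<N+1])
      (ens_prod (2 ^ N) (gate N [1, 2])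
        (ens_prod (2 ^ N) (gate N (1 # [3..<N+1]))
          (ens_prod (2 ^ N) (gate N [1, 2]) (gate N [2..<N+1]))))"

definition circC' :: "nat \<Rightarrow> cmat measure" where
  "circC' N = ens_prod (2 ^ N) (gate N [2..<N+1])
      (ens_prod (2 ^ N) (gate N (1 # [3..<N+1])) (gate N [2..<N+1]))"

end

theory Submission
  imports Defs
begin

text \<open>
  The second moment operator of a Haar-random gate on a subset of the qubits is the orthogonal projection onto its
  commutant, spanned on the support by the identity \<open>I\<close> and the swap \<open>F\<close>. Write \<open>A\<close>, \<open>B\<close> for the first two qubits,
  \<open>R\<close> for the remaining ones, and let \<open>r = 2 ^ (N - 2)\<close>. Both circuits preserve the span of the four operators
  \<open>I\<close>, \<open>F\<close>, \<open>I\<^sub>A F\<^sub>B\<^sub>R\<close>, \<open>F\<^sub>A I\<^sub>B\<^sub>R\<close>, fix the first two, and act on the quotient by a scalar. A gate on a qubit and \<open>R\<close>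
  maps \<open>I F\<^sub>R\<close> to \<open>\<alpha> I + \<beta> F\<close> and \<open>F I\<^sub>R\<close> to \<open>\<beta> I + \<alpha> F\<close> with \<open>\<alpha> = 3 r / (4 r\<^sup>2 - 1)\<close> and
  \<open>\<beta> = (2 r\<^sup>2 - 2) / (4 r\<^sup>2 - 1)\<close>. The scalar is \<open>\<alpha>\<^sup>2\<close>, exponentially small in \<open>N\<close>, for \<open>C'\<close>; but it is
  \<open>(2 \<beta> / 5)\<^sup>2\<close>, close to \<open>1 / 25\<close>, for \<open>C\<close>. For \<open>N \<ge> 5\<close> the powers of \<open>C'\<close> therefore converge
  to the Haar moment operator at a strictly faster rate than those of \<open>C\<close>, and a large \<open>d\<close> separates the errors.
\<close>

section \<open>Moment operators of unitary ensembles\<close>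

text \<open>Why the extra gates slow the circuit down: track a label \<open>I\<close> or
  \<open>F\<close> on each of A, B, R, starting from \<open>I\<close> on A and \<open>F\<close> on B
  and R. A gate on a qubit and R makes the qubit follow R with weight \<beta>, close to 1/2, and R
  follow the qubit only with the tiny weight \<alpha>. Without gates on AB, the start can be left
  and recovered only if R twice follows a single qubit, whence the square of \<alpha>. A gate on AB
  meets a tie between two qubits and gives each outcome the weight 2/5; its outcome \<open>I\<close>
  on both is led back to the start by two steps in which a qubit follows R, so no small factor
  appears. The numbers 2 \<beta> / 5 and \<alpha> coincide exactly at r = 4, that is N = 4, which is
  where the threshold 5 comes from. Only rates matter, so all norm estimates may be crude. The
  formal obstacle lies in the definitions: Haar measure is a choice, the square root in the trace
  norm a definite description, the diamond norm a supremum, so existence, uniqueness and boundedness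
  come before any computation.\<close>

lemma measurable_cmatI:
  fixes f :: "'a \<Rightarrow> cmat"
  assumes "\<And>i j. (\<lambda>x. f x i j) \<in> borel_measurable M"
  shows "f \<in> borel_measurable M"
  by (rule measurable_coordinatewise_then_product, rule measurable_coordinatewise_then_product, rule assms)

lemma borel_UNIV_in_sets: "UNIV \<in> sets borel"
  using sets.top[of borel] by simp

lemma measurable_cmat_entry [measurable]:
  "(\<lambda>A::cmat. A i j) \<in> borel_measurable borel"
  by (rule borel_measurable_continuous_onI, rule continuous_on_product_then_coordinatewise,
      rule continuous_on_product_coordinates)

lemma measurable_cnj: "f \<in> borel_measurable M \<Longrightarrow> (\<lambda>x. cnj (f x)) \<in> borel_measurable M"
  by (rule measurable_compose[of f M borel cnj])
     (auto intro: borel_measurable_continuous_onI[OF continuous_on_cnj[OF continuous_on_id]])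

lemma measurable_mmul [measurable (raw)]:
  assumes f: "f \<in> borel_measurable M" and g: "g \<in> borel_measurable M"
  shows "(\<lambda>x. mmul n (f x) (g x)) \<in> borel_measurable M"
proof (rule measurable_cmatI)
  fix i j
  show "(\<lambda>x. mmul n (f x) (g x) i j) \<in> borel_measurable M"
    using measurable_compose[OF f measurable_cmat_entry] measurable_compose[OF g measurable_cmat_entry]
    by (cases "i < n \<and> j < n") (simp_all add: mmul_def)
qed

text \<open>Unitarity is a countable family of conditions on single entries, each vacuous or the
  preimage of a point under a Borel function. Measurability is needed to speak of almost sure
  unitarity of image measures.\<close>

lemma measurable_unitaries [measurable]: "unitaries n \<in> sets borel"
proof -
  have adj: "adj \<in> borel_measurable borel"
    unfolding adj_def[abs_def] by (intro measurable_cmatI measurable_cnj measurable_cmat_entry)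
  have "(\<lambda>U. mmul n (adj U) U i j) \<in> borel_measurable borel" for i j
    by (rule measurable_compose[OF measurable_mmul measurable_cmat_entry]) (auto intro: adj)
  then have 1: "{U::cmat. mmul n (adj U) U i j = idm n i j} \<in> sets borel" for i j
    using measurable_sets_borel[of "\<lambda>U. mmul n (adj U) U i j" borel "{idm n i j}"] by (simp add: vimage_def)
  have 2: "{U::cmat. U i j = 0} \<in> sets borel" for i j
    using measurable_sets_borel[OF measurable_cmat_entry[of i j], of "{0}"] by (simp add: vimage_def)
  have INT: "(\<Inter>i. \<Inter>j. F i j) \<in> sets borel" if "\<And>i j. F i j \<in> sets borel" for F :: "nat \<Rightarrow> nat \<Rightarrow> cmat set"
    by (rule sets.countable_INT''[OF borel_UNIV_in_sets countableI_type], rule sets.countable_INT''[OF borel_UNIV_in_sets countableI_type], rule that)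
  have 3: "{U::cmat. \<not> (i < n \<and> j < n) \<longrightarrow> U i j = 0} \<in> sets borel" for i j
    using 2[of i j] borel_UNIV_in_sets by (cases "i < n \<and> j < n") simp_all
  have "unitaries n = (\<Inter>i. \<Inter>j. {U. mmul n (adj U) U i j = idm n i j}) \<inter>
      (\<Inter>i. \<Inter>j. {U. \<not> (i < n \<and> j < n) \<longrightarrow> U i j = 0})"
    by (simp only: unitaries_def supported_def fun_eq_iff INT_iff UNIV_I mem_Collect_eq Collect_conj_eq
        set_eq_iff Int_iff Ball_def simp_thms) blast
  then show ?thesis using sets.Int[OF INT[OF 1] INT[OF 3]] by (simp only:)
qed

lemma mmul_assoc: "mmul n (mmul n A B) C = mmul n A (mmul n B C)"
proof (intro ext)
  fix i j
  show "mmul n (mmul n A B) C i j = mmul n A (mmul n B C) i j"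
  proof (cases "i < n \<and> j < n")
    case True
    have "(\<Sum>k<n. (\<Sum>l<n. A i l * B l k) * C k j) = (\<Sum>k<n. \<Sum>l<n. A i l * (B l k * C k j))"
      by (simp add: sum_distrib_right mult.assoc)
    also have "\<dots> = (\<Sum>l<n. A i l * (\<Sum>k<n. B l k * C k j))"
      by (subst sum.swap) (simp add: sum_distrib_left)
    finally show ?thesis using True by (simp add: mmul_def)
  qed (auto simp: mmul_def)
qed

lemma adj_mmul: "adj (mmul n A B) = mmul n (adj B) (adj A)"
  by (auto simp: adj_def mmul_def fun_eq_iff mult.commute)

lemma mmul_idm_left: "supported n A \<Longrightarrow> mmul n (idm n) A = A"
proof (intro ext)
  fix i j assume A: "supported n A"
  show "mmul n (idm n) A i j = A i j"
  proof (cases "i < n \<and> j < n")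
    case True
    have "(\<Sum>k<n. idm n i k * A k j) = (\<Sum>k<n. if k = i then A i j else 0)"
      using True by (intro sum.cong) (auto simp: idm_def)
    then show ?thesis using True by (simp add: mmul_def)
  qed (use A in \<open>auto simp: mmul_def supported_def\<close>)
qed

lemma supported_mmul [simp]: "supported n (mmul n A B)"
  by (auto simp: supported_def mmul_def)

lemma mmul_unitaries: "U \<in> unitaries n \<Longrightarrow> V \<in> unitaries n \<Longrightarrow> mmul n U V \<in> unitaries n"
proof -
  assume U: "U \<in> unitaries n" and V: "V \<in> unitaries n"
  have "mmul n (adj (mmul n U V)) (mmul n U V) = mmul n (adj V) (mmul n (mmul n (adj U) U) V)"
    by (simp add: adj_mmul mmul_assoc)
  also have "\<dots> = idm n"
    using U V by (simp add: unitaries_def mmul_idm_left)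
  finally show ?thesis by (simp add: unitaries_def)
qed

lemma idm_unitaries: "idm n \<in> unitaries n"
proof -
  have "supported n (idm n)" by (auto simp: supported_def idm_def)
  moreover have "adj (idm n) = idm n" by (auto simp: adj_def idm_def fun_eq_iff)
  ultimately show ?thesis by (simp add: unitaries_def mmul_idm_left)
qed

lemma unitaries_orthonormal:
  assumes "U \<in> unitaries n" "k < n" "l < n"
  shows "(\<Sum>i<n. U i k * cnj (U i l)) = of_bool (k = l)"
proof -
  have "mmul n (adj U) U l k = idm n l k" using assms by (simp add: unitaries_def)
  then show ?thesis using assms by (auto simp: mmul_def adj_def idm_def mult.commute)
qed

lemma unitaries_supported: "U \<in> unitaries n \<Longrightarrow> \<not> (i < n \<and> j < n) \<Longrightarrow> U i j = 0"
  by (auto simp: unitaries_def supported_def)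

text \<open>Each column is a unit vector. This uniform bound is what makes every integral of a
  polynomial in the entries exist.\<close>

lemma unitaries_norm_le_1:
  assumes U: "U \<in> unitaries n"
  shows "cmod (U i j) \<le> 1"
proof (cases "i < n \<and> j < n")
  case True
  have "complex_of_real (\<Sum>i<n. (cmod (U i j))\<^sup>2) = 1"
    using unitaries_orthonormal[OF U, of j j] True
    by (simp only: complex_norm_square of_real_sum) simp
  then have "(\<Sum>i<n. (cmod (U i j))\<^sup>2) = 1"
    using of_real_eq_1_iff by blast
  moreover have "(cmod (U i j))\<^sup>2 \<le> (\<Sum>i<n. (cmod (U i j))\<^sup>2)"
    using True by (intro member_le_sum) auto
  ultimately have "(cmod (U i j))\<^sup>2 \<le> 1" by simp
  then show ?thesis using power2_le_imp_le[of "cmod (U i j)" 1] by simp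
qed (use U in \<open>auto simp: unitaries_supported\<close>)

text \<open>Unitarity is only required almost surely: the ambient type \<open>cmat\<close> contains
  all functions on index pairs, and images under products and embeddings are measures on all of
  it.\<close>

definition unitary_ensemble :: "nat \<Rightarrow> cmat measure \<Rightarrow> bool" where
  "unitary_ensemble D \<nu> \<longleftrightarrow> prob_space \<nu> \<and> sets \<nu> = sets borel \<and> (AE U in \<nu>. U \<in> unitaries D)"

lemma mult_add_less:
  assumes "x < m" "y < (n::nat)"
  shows "x * n + y < m * n"
proof -
  have "x * n + y < Suc x * n" using assms by simp
  also have "\<dots> \<le> m * n" using assms by (intro mult_le_mono1) simp
  finally show ?thesis .
qed

lemma sum_prod_index:
  fixes f :: "nat \<Rightarrow> 'a :: comm_monoid_add"
  shows "(\<Sum>p<m * n. f p) = (\<Sum>x<m. \<Sum>y<n. f (x * n + y))"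
proof (cases "n = 0")
  case False
  have "(\<Sum>p<m * n. f p) = (\<Sum>(x, y)\<in>{..<m} \<times> {..<n}. f (x * n + y))"
    by (rule sum.reindex_bij_witness[where i="\<lambda>(x, y). x * n + y" and j="\<lambda>p. (p div n, p mod n)"])
       (use False in \<open>auto simp: less_mult_imp_div_less intro: mult_add_less\<close>)
  then show ?thesis by (simp add: sum.cartesian_product)
qed simp

lemma mmul_kron: "mmul (m * n) (kron m n A B) (kron m n A' B') = kron m n (mmul m A A') (mmul n B B')"
proof (intro ext)
  fix p q
  show "mmul (m * n) (kron m n A B) (kron m n A' B') p q = kron m n (mmul m A A') (mmul n B B') p q"
  proof (cases "p < m * n \<and> q < m * n")
    case True
    then have n: "0 < n" by (auto intro: gr0I)
    have lt: "x * n + y < m * n" if "x < m" "y < n" for x y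
      using that by (intro mult_add_less)
    have "(\<Sum>k<m * n. kron m n A B p k * kron m n A' B' k q) =
       (\<Sum>x<m. \<Sum>y<n. A (p div n) x * B (p mod n) y * (A' x (q div n) * B' y (q mod n)))"
      unfolding sum_prod_index using True lt by (intro sum.cong) (auto simp: kron_def)
    also have "\<dots> = (\<Sum>x<m. A (p div n) x * A' x (q div n)) * (\<Sum>y<n. B (p mod n) y * B' y (q mod n))"
      by (simp add: sum_product mult_ac)
    finally show ?thesis
      using True n by (simp add: mmul_def kron_def less_mult_imp_div_less)
  qed (auto simp: mmul_def kron_def)
qed

definition conj2 :: "nat \<Rightarrow> cmat \<Rightarrow> cmat \<Rightarrow> cmat" where
  "conj2 D U X = mmul (D * D) (mmul (D * D) (kron D D U U) X) (adj (kron D D U U))"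

text \<open>The kernel of conjugation by the tensor square of \<open>U\<close>; each index encodes a
  pair of basis states by quotient and remainder modulo \<open>D\<close>. The moment operator is
  thus determined by integrals of monomials of degree 2 in \<open>U\<close> and 2 in its
  conjugate.\<close>

definition quad :: "nat \<Rightarrow> cmat \<Rightarrow> nat \<Rightarrow> nat \<Rightarrow> nat \<Rightarrow> nat \<Rightarrow> complex" where
  "quad D U p q p' q' = U (p div D) (p' div D) * U (p mod D) (p' mod D) *
     (cnj (U (q div D) (q' div D)) * cnj (U (q mod D) (q' mod D)))"

lemma conj2_eq:
  "conj2 D U X p q = (if p < D * D \<and> q < D * D
     then \<Sum>p'<D * D. \<Sum>q'<D * D. quad D U p q p' q' * X p' q' else 0)"
proof (cases "p < D * D \<and> q < D * D")
  case True
  have "conj2 D U X p q = (\<Sum>q'<D * D. (\<Sum>p'<D * D. kron D D U U p p' * X p' q') * cnj (kron D D U U q q'))"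
    using True by (simp add: conj2_def mmul_def adj_def)
  also have "\<dots> = (\<Sum>p'<D * D. \<Sum>q'<D * D. kron D D U U p p' * X p' q' * cnj (kron D D U U q q'))"
    by (subst sum.swap) (simp add: sum_distrib_right)
  also have "\<dots> = (\<Sum>p'<D * D. \<Sum>q'<D * D. quad D U p q p' q' * X p' q')"
    using True by (intro sum.cong) (auto simp: kron_def quad_def)
  finally show ?thesis using True by simp
qed (auto simp: conj2_def mmul_def)

lemma conj2_mmul: "conj2 D (mmul D A B) X = conj2 D A (conj2 D B X)"
  by (simp add: conj2_def mmul_kron[symmetric] adj_mmul mmul_assoc)

lemma measurable_quad0:
  "(\<lambda>U. quad D U p q p' q') \<in> borel_measurable borel"
  unfolding quad_def by (intro borel_measurable_times measurable_cnj measurable_cmat_entry)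

lemma measurable_quad [measurable (raw)]:
  "f \<in> borel_measurable M \<Longrightarrow> (\<lambda>x. quad D (f x) p q p' q') \<in> borel_measurable M"
  by (rule measurable_compose[OF _ measurable_quad0])

lemma quad_bound: "U \<in> unitaries D \<Longrightarrow> cmod (quad D U p q p' q') \<le> 1"
  unfolding quad_def norm_mult complex_mod_cnj
  by (intro mult_le_one mult_nonneg_nonneg norm_ge_zero unitaries_norm_le_1)

lemma integrable_quad:
  assumes "unitary_ensemble D \<nu>"
  shows "integrable \<nu> (\<lambda>U. quad D U p q p' q')"
proof -
  interpret prob_space \<nu> using assms by (simp add: unitary_ensemble_def)
  have [measurable_cong]: "sets \<nu> = sets borel" using assms by (simp add: unitary_ensemble_def)
  have "AE U in \<nu>. U \<in> unitaries D" using assms by (simp add: unitary_ensemble_def)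
  then show ?thesis
    by (intro integrable_const_bound[where B=1]) (auto simp: quad_bound)
qed

definition quad_int :: "nat \<Rightarrow> cmat measure \<Rightarrow> nat \<Rightarrow> nat \<Rightarrow> nat \<Rightarrow> nat \<Rightarrow> complex" where
  "quad_int D \<nu> p q p' q' = (LINT U|\<nu>. quad D U p q p' q')"

lemma moment2_eq:
  assumes "unitary_ensemble D \<nu>"
  shows "moment2 D \<nu> X p q = (if p < D * D \<and> q < D * D
     then \<Sum>p'<D * D. \<Sum>q'<D * D. quad_int D \<nu> p q p' q' * X p' q' else 0)"
proof (cases "p < D * D \<and> q < D * D")
  case True
  note [simp] = integrable_quad[OF assms]
  show ?thesis
    unfolding moment2_def conj2_def[symmetric] conj2_eq quad_int_def using True by simp
qed (auto simp: moment2_def mmul_def)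

lemma moment2_linear:
  assumes "unitary_ensemble D \<nu>"
  shows "moment2 D \<nu> (\<lambda>p q. c * X p q + d * Y p q) = (\<lambda>p q. c * moment2 D \<nu> X p q + d * moment2 D \<nu> Y p q)"
  unfolding moment2_eq[OF assms]
  by (intro ext) (simp add: sum_distrib_left sum.distrib[symmetric] distrib_left mult.left_commute)

lemma moment2_cong:
  assumes "\<And>p q. p < D * D \<Longrightarrow> q < D * D \<Longrightarrow> X p q = Y p q" "unitary_ensemble D \<nu>"
  shows "moment2 D \<nu> X = moment2 D \<nu> Y"
  unfolding moment2_eq[OF assms(2)] using assms(1) by (intro ext if_cong refl sum.cong) simp_all

lemma quad_int_bound:
  assumes "unitary_ensemble D \<nu>"
  shows "cmod (quad_int D \<nu> p q p' q') \<le> 1"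
proof -
  interpret prob_space \<nu> using assms by (simp add: unitary_ensemble_def)
  have "AE U in \<nu>. U \<in> unitaries D" using assms by (simp add: unitary_ensemble_def)
  then have "(LINT U|\<nu>. cmod (quad D U p q p' q')) \<le> (LINT U|\<nu>. 1)"
    using integrable_quad[OF assms] by (intro integral_mono_AE) (auto simp: quad_bound)
  then show ?thesis
    unfolding quad_int_def
    using order_trans[OF integral_norm_bound[of \<nu> "\<lambda>U. quad D U p q p' q'"], of 1] by (simp add: prob_space)
qed

text \<open>Every kernel entry has modulus at most 1, and the double sum has
  \<open>(D * D) * (D * D)\<close> terms. The dimension factor is harmless, since only the
  exponential dependence on the number of circuit copies is compared later.\<close>

lemma moment2_bound:
  assumes "unitary_ensemble D \<nu>" "\<And>p q. p < D * D \<Longrightarrow> q < D * D \<Longrightarrow> cmod (X p q) \<le> B" "0 \<le> B"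
  shows "cmod (moment2 D \<nu> X p q) \<le> real (D * D) * real (D * D) * B"
proof -
  have *: "cmod (quad_int D \<nu> p q p' q' * X p' q') \<le> B" if "p' < D * D" "q' < D * D" for p' q'
    using mult_mono[OF quad_int_bound[OF assms(1), of p q p' q'] assms(2)[OF that]] assms(3)
    by (simp add: norm_mult)
  have "cmod (\<Sum>p'<D * D. \<Sum>q'<D * D. quad_int D \<nu> p q p' q' * X p' q') \<le>
      (\<Sum>p'<D * D. \<Sum>q'<D * D. cmod (quad_int D \<nu> p q p' q' * X p' q'))"
    by (rule order_trans[OF norm_sum sum_mono[OF norm_sum]])
  also have "\<dots> \<le> (\<Sum>p'<D * D. \<Sum>q'<D * D. B)"
    using * by (intro sum_mono) auto
  finally show ?thesis using assms(3) by (simp add: moment2_eq[OF assms(1)] mult.assoc)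
qed

text \<open>Independence turns the product of unitaries into composition of channels: conjugation is
  multiplicative, and Fubini lets the inner average act on \<open>X\<close> before the outer
  conjugation. The left factor is the one applied last.\<close>

lemma unitary_ensemble_prod:
  assumes \<mu>: "unitary_ensemble D \<mu>" and \<nu>: "unitary_ensemble D \<nu>"
  shows "unitary_ensemble D (ens_prod D \<mu> \<nu>)"
    and "moment2 D (ens_prod D \<mu> \<nu>) X = moment2 D \<mu> (moment2 D \<nu> X)"
proof -
  interpret \<mu>: prob_space \<mu> using assms by (simp add: unitary_ensemble_def)
  interpret \<nu>: prob_space \<nu> using assms by (simp add: unitary_ensemble_def)
  interpret pair_prob_space \<mu> \<nu> ..
  have [measurable_cong]: "sets \<mu> = sets borel" "sets \<nu> = sets borel"
    using assms by (simp_all add: unitary_ensemble_def)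
  have AE: "AE U in \<mu>. U \<in> unitaries D" "AE U in \<nu>. U \<in> unitaries D"
    using assms by (simp_all add: unitary_ensemble_def)
  have AEp: "AE x in \<mu> \<Otimes>\<^sub>M \<nu>. mmul D (fst x) (snd x) \<in> unitaries D"
  proof (rule AE_pair_measure)
    show "{x \<in> space (\<mu> \<Otimes>\<^sub>M \<nu>). mmul D (fst x) (snd x) \<in> unitaries D} \<in> sets (\<mu> \<Otimes>\<^sub>M \<nu>)"
      by measurable
    show "AE x in \<mu>. AE y in \<nu>. mmul D (fst (x, y)) (snd (x, y)) \<in> unitaries D"
      using AE by (auto simp: mmul_unitaries)
  qed
  have m: "(\<lambda>(A, B). mmul D A B) \<in> \<mu> \<Otimes>\<^sub>M \<nu> \<rightarrow>\<^sub>M borel"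
    unfolding case_prod_beta by measurable
  show ens: "unitary_ensemble D (ens_prod D \<mu> \<nu>)"
    unfolding unitary_ensemble_def ens_prod_def
    using m AEp by (auto intro: prob_space_distr simp: AE_distr_iff case_prod_beta)
  show "moment2 D (ens_prod D \<mu> \<nu>) X = moment2 D \<mu> (moment2 D \<nu> X)"
  proof (intro ext)
    fix p q
    have mq: "(\<lambda>U. conj2 D U X p q) \<in> borel_measurable borel" for X
      unfolding conj2_eq by (cases "p < D * D \<and> q < D * D") auto
    \<comment> \<open>Integrability on the product space comes from the bound 1, valid on the almost
      sure event that the product is unitary.\<close>
    have int: "integrable (\<mu> \<Otimes>\<^sub>M \<nu>) (\<lambda>x. conj2 D (mmul D (fst x) (snd x)) X p q)"
    proof (cases "p < D * D \<and> q < D * D")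
      case True
      have "integrable (\<mu> \<Otimes>\<^sub>M \<nu>) (\<lambda>x. quad D (mmul D (fst x) (snd x)) p q p' q')" for p' q'
        using AEp by (intro P.integrable_const_bound[where B=1]) (auto simp: quad_bound)
      then show ?thesis by (simp add: conj2_eq True)
    qed (auto simp: conj2_eq)
    have "moment2 D (ens_prod D \<mu> \<nu>) X p q = (LINT x|(\<mu> \<Otimes>\<^sub>M \<nu>). conj2 D (mmul D (fst x) (snd x)) X p q)"
      unfolding moment2_def conj2_def[symmetric] ens_prod_def
      by (subst integral_distr[OF m mq]) (simp add: case_prod_beta)
    also have "\<dots> = (LINT A|\<mu>. (LINT B|\<nu>. conj2 D (mmul D A B) X p q))"
      using int by (subst integral_fst'[symmetric]) auto
    also have "\<dots> = (LINT A|\<mu>. conj2 D A (moment2 D \<nu> X) p q)"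
    proof (rule Bochner_Integration.integral_cong[OF refl])
      fix A
      have "integrable \<nu> (\<lambda>B. conj2 D B X p' q')" for p' q'
        unfolding conj2_eq using integrable_quad[OF \<nu>] by (cases "p' < D * D \<and> q' < D * D") auto
      then show "(LINT B|\<nu>. conj2 D (mmul D A B) X p q) = conj2 D A (moment2 D \<nu> X) p q"
        unfolding conj2_mmul by (subst (1 2) conj2_eq) (auto simp: moment2_def conj2_def[symmetric])
    qed
    finally show "moment2 D (ens_prod D \<mu> \<nu>) X p q = moment2 D \<mu> (moment2 D \<nu> X) p q"
      by (simp add: moment2_def conj2_def)
  qed
qed

lemma unitary_ensemble_return: "unitary_ensemble D (return borel (idm D))"
  unfolding unitary_ensemble_def
  by (auto simp: prob_space_return AE_return idm_unitaries)

lemma moment2_return: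
  assumes "p < D * D" "q < D * D"
  shows "moment2 D (return borel (idm D)) X p q = X p q"
proof -
  have "(\<lambda>U. conj2 D U X p q) \<in> borel_measurable borel"
    unfolding conj2_eq using assms by auto
  then have "moment2 D (return borel (idm D)) X p q = conj2 D (idm D) X p q"
    unfolding moment2_def conj2_def[symmetric] by (subst integral_return) auto
  also have "\<dots> = (\<Sum>p'<D * D. \<Sum>q'<D * D. if q' = q then (if p' = p then X p q else 0) else 0)"
  proof -
    have "quad D (idm D) p q p' q' * X p' q' = (if q' = q then (if p' = p then X p q else 0) else 0)" if "p' < D * D" "q' < D * D" for p' q'
    proof -
      have *: "idm D (x div D) (y div D) * idm D (x mod D) (y mod D) = of_bool (y = x)" if "x < D * D" for x y
      proof -
        have "0 < D" using that by (auto intro: gr0I)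
        then have "x div D < D" "x mod D < D" using that by (simp_all add: less_mult_imp_div_less)
        moreover have "y = x" if "x div D = y div D" "x mod D = y mod D"
          using that by (metis div_mult_mod_eq)
        ultimately show ?thesis unfolding idm_def by (cases "y = x") auto
      qed
      show ?thesis
        unfolding quad_def complex_cnj_mult[symmetric] *[OF assms(1)] *[OF assms(2)] by simp
    qed
    then show ?thesis using assms unfolding conj2_eq by simp
  qed
  also have "\<dots> = X p q" using assms by simp
  finally show ?thesis .
qed

lemma unitary_ensemble_pow:
  assumes "unitary_ensemble D \<mu>"
  shows "unitary_ensemble D (ens_pow D \<mu> d)"
  by (induction d) (simp_all add: unitary_ensemble_return unitary_ensemble_prod assms)

text \<open>Stated from one copy on: with zero copies the moment operator still cuts
  \<open>X\<close> down to the valid indices, whereas the zeroth iterate returns \<open>X\<close>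
  unchanged.\<close>

lemma moment2_pow_Suc:
  assumes "unitary_ensemble D \<mu>"
  shows "moment2 D (ens_pow D \<mu> (Suc d)) X = (moment2 D \<mu> ^^ Suc d) X"
proof (induction d)
  case 0
  show ?case using assms
    by (auto simp: unitary_ensemble_prod unitary_ensemble_return moment2_return intro!: moment2_cong)
next
  case (Suc d)
  have "moment2 D (ens_pow D \<mu> (Suc (Suc d))) X = moment2 D \<mu> (moment2 D (ens_pow D \<mu> (Suc d)) X)"
    using assms unitary_ensemble_pow[OF assms, of "Suc d"]
    by (subst ens_pow.simps, subst unitary_ensemble_prod) auto
  then show ?case unfolding Suc.IH by simp
qed

section \<open>Second moments of a left-invariant measure\<close>

lemma unitaries_I:
  assumes "supported n V"
    and "\<And>i j. i < n \<Longrightarrow> j < n \<Longrightarrow> (\<Sum>k<n. cnj (V k i) * V k j) = of_bool (i = j)"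
  shows "V \<in> unitaries n"
  using assms by (auto simp: unitaries_def mmul_def adj_def idm_def fun_eq_iff)

section \<open>Test unitaries: phases, permutations and a two-row Hadamard rotation\<close>

definition phase_matrix :: "nat \<Rightarrow> (nat \<Rightarrow> complex) \<Rightarrow> cmat" where
  "phase_matrix n z = (\<lambda>i j. if i = j \<and> i < n then z i else 0)"

lemma phase_matrix_unitaries:
  assumes "\<And>i. cmod (z i) = 1"
  shows "phase_matrix n z \<in> unitaries n"
proof (rule unitaries_I)
  fix i j assume ij: "i < n" "j < n"
  have "(\<Sum>k<n. cnj (phase_matrix n z k i) * phase_matrix n z k j) =
      (\<Sum>k<n. if k = i then of_bool (i = j) else 0)"
    using assms complex_norm_square[of "z i"] by (intro sum.cong) (auto simp: phase_matrix_def mult.commute)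
  then show "(\<Sum>k<n. cnj (phase_matrix n z k i) * phase_matrix n z k j) = of_bool (i = j)"
    using ij by simp
qed (auto simp: supported_def phase_matrix_def)

lemma mmul_phase_matrix:
  assumes "i < n" "k < n"
  shows "mmul n (phase_matrix n z) U i k = z i * U i k"
proof -
  have "(\<Sum>l<n. phase_matrix n z i l * U l k) = (\<Sum>l<n. if l = i then z i * U i k else 0)"
    using assms by (intro sum.cong) (auto simp: phase_matrix_def)
  then show ?thesis using assms by (simp add: mmul_def)
qed

definition perm_matrix :: "nat \<Rightarrow> (nat \<Rightarrow> nat) \<Rightarrow> cmat" where
  "perm_matrix n \<pi> = (\<lambda>i j. if i < n \<and> j < n \<and> j = \<pi> i then 1 else 0)"

lemma perm_matrix_unitaries:
  assumes "bij_betw \<pi> {..<n} {..<n}"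
  shows "perm_matrix n \<pi> \<in> unitaries n"
proof (rule unitaries_I)
  fix i j assume ij: "i < n" "j < n"
  have "i \<in> \<pi> ` {..<n}" using assms ij by (simp add: bij_betw_def)
  then obtain k where k: "k < n" "\<pi> k = i" by auto
  have "cnj (perm_matrix n \<pi> l i) * perm_matrix n \<pi> l j = (if l = k then of_bool (i = j) else 0)" if "l < n" for l
  proof (cases "l = k")
    case True
    then show ?thesis using ij k(1) unfolding perm_matrix_def k(2)[symmetric] True by auto
  next
    case False
    then have "\<pi> l \<noteq> i" using that k assms by (metis bij_betw_def inj_on_def lessThan_iff)
    then show ?thesis using False unfolding perm_matrix_def by auto
  qed
  then have "(\<Sum>l<n. cnj (perm_matrix n \<pi> l i) * perm_matrix n \<pi> l j) =
      (\<Sum>l<n. if l = k then of_bool (i = j) else 0)"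
    by (intro sum.cong) simp_all
  then show "(\<Sum>k<n. cnj (perm_matrix n \<pi> k i) * perm_matrix n \<pi> k j) = of_bool (i = j)"
    using k by simp
qed (auto simp: supported_def perm_matrix_def)

lemma mmul_perm_matrix:
  assumes "i < n" "k < n" "\<pi> i < n"
  shows "mmul n (perm_matrix n \<pi>) U i k = U (\<pi> i) k"
proof -
  have "(\<Sum>l<n. perm_matrix n \<pi> i l * U l k) = (\<Sum>l<n. if l = \<pi> i then U (\<pi> i) k else 0)"
    using assms by (intro sum.cong) (auto simp: perm_matrix_def)
  then show ?thesis using assms by (simp add: mmul_def)
qed

text \<open>Phases and permutations of rows leave the moment with four equal rows unrelated to the
  others; mixing two rows ties it to them.\<close>

definition hadamard_matrix :: "nat \<Rightarrow> nat \<Rightarrow> nat \<Rightarrow> cmat" where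
  "hadamard_matrix n u v = (\<lambda>i j. if \<not> (i < n \<and> j < n) then 0
     else if i \<in> {u, v} \<and> j \<in> {u, v} then (if i = v \<and> j = v then - 1 else 1) / complex_of_real (sqrt 2)
     else of_bool (i = j))"

lemma sqrt2_complex: "complex_of_real (sqrt 2) * complex_of_real (sqrt 2) = 2"
  by (simp flip: of_real_mult)

lemma sum_split_two:
  fixes f :: "nat \<Rightarrow> complex"
  assumes "u < n" "v < n" "u \<noteq> v"
  shows "(\<Sum>k<n. f k) = f u + f v + (\<Sum>k\<in>{..<n} - {u, v}. f k)"
  using assms by (subst sum.subset_diff[of "{u, v}"]) auto

lemma hadamard_matrix_unitaries:
  assumes "u < n" "v < n" "u \<noteq> v"
  shows "hadamard_matrix n u v \<in> unitaries n"
proof (rule unitaries_I)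
  fix i j assume ij: "i < n" "j < n"
  have "(\<Sum>k\<in>{..<n} - {u, v}. cnj (hadamard_matrix n u v k i) * hadamard_matrix n u v k j)
     = (\<Sum>k\<in>{..<n} - {u, v}. if k = i then of_bool (i = j) else 0)"
    using ij by (intro sum.cong) (auto simp: hadamard_matrix_def)
  also have "\<dots> = of_bool (i = j \<and> i \<notin> {u, v})"
    using ij by (subst sum.delta) auto
  finally show "(\<Sum>k<n. cnj (hadamard_matrix n u v k i) * hadamard_matrix n u v k j) = of_bool (i = j)"
    unfolding sum_split_two[OF assms] using ij assms sqrt2_complex
    by (auto simp: hadamard_matrix_def)
qed (auto simp: supported_def hadamard_matrix_def)

lemma mmul_hadamard_matrix:
  assumes "u < n" "v < n" "u \<noteq> v" "k < n"
  shows "mmul n (hadamard_matrix n u v) U u k = (U u k + U v k) / complex_of_real (sqrt 2)"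
proof -
  have "(\<Sum>l\<in>{..<n} - {u, v}. hadamard_matrix n u v u l * U l k) = 0"
    using assms by (intro sum.neutral) (auto simp: hadamard_matrix_def)
  then have "(\<Sum>l<n. hadamard_matrix n u v u l * U l k) = (U u k + U v k) / complex_of_real (sqrt 2)"
    unfolding sum_split_two[OF assms(1-3)] using assms by (simp add: hadamard_matrix_def add_divide_distrib)
  then show ?thesis using assms by (simp add: mmul_def)
qed

definition left_invariant :: "nat \<Rightarrow> cmat measure \<Rightarrow> bool" where
  "left_invariant n \<mu> \<longleftrightarrow> unitary_ensemble n \<mu> \<and>
     (\<forall>V \<in> unitaries n. distr \<mu> borel (\<lambda>U. mmul n V U) = \<mu>)"

text \<open>The column indices \<open>k1\<close>, \<open>k2\<close>, \<open>l1\<close>,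
  \<open>l2\<close> come first and stay fixed, since left multiplication only mixes rows; the row
  indices are the variables of the symmetry argument.\<close>

definition moment4 :: "cmat measure \<Rightarrow> nat \<Rightarrow> nat \<Rightarrow> nat \<Rightarrow> nat \<Rightarrow> nat \<Rightarrow> nat \<Rightarrow> nat \<Rightarrow> nat \<Rightarrow> complex" where
  "moment4 \<mu> k1 k2 l1 l2 i1 i2 j1 j2 =
     (LINT U|\<mu>. U i1 k1 * U i2 k2 * (cnj (U j1 l1) * cnj (U j2 l2)))"

lemma measurable_monomial4:
  "(\<lambda>U::cmat. U i1 k1 * U i2 k2 * (cnj (U j1 l1) * cnj (U j2 l2))) \<in> borel_measurable borel"
  by (intro borel_measurable_times measurable_cnj measurable_cmat_entry)

lemma integrable_monomial4:
  assumes "unitary_ensemble n \<mu>"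
  shows "integrable \<mu> (\<lambda>U. U i1 k1 * U i2 k2 * (cnj (U j1 l1) * cnj (U j2 l2)))"
proof -
  interpret prob_space \<mu> using assms by (simp add: unitary_ensemble_def)
  have s: "sets \<mu> = sets borel" using assms by (simp add: unitary_ensemble_def)
  have "AE U in \<mu>. U \<in> unitaries n" using assms by (simp add: unitary_ensemble_def)
  then have "AE U in \<mu>. cmod (U i1 k1 * U i2 k2 * (cnj (U j1 l1) * cnj (U j2 l2))) \<le> 1"
    by eventually_elim (simp add: norm_mult mult_le_one unitaries_norm_le_1)
  then show ?thesis
    by (rule integrable_const_bound) (simp add: measurable_cong_sets[OF s refl] measurable_monomial4)
qed

section \<open>Fourth moments by symmetry and the Weingarten formula\<close>

locale left_invariant_measure =
  fixes n :: nat and \<mu> :: "cmat measure" and k1 k2 l1 l2 :: nat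
  assumes inv: "left_invariant n \<mu>" and kl: "k1 < n" "k2 < n" "l1 < n" "l2 < n" and n2: "2 \<le> n"
begin

abbreviation "M \<equiv> moment4 \<mu> k1 k2 l1 l2"

lemma ens: "unitary_ensemble n \<mu>" using inv by (simp add: left_invariant_def)

lemma moment4_translate:
  assumes "V \<in> unitaries n"
  shows "M i1 i2 j1 j2 = (LINT U|\<mu>. mmul n V U i1 k1 * mmul n V U i2 k2 * (cnj (mmul n V U j1 l1) * cnj (mmul n V U j2 l2)))"
proof -
  have s: "sets \<mu> = sets borel" using ens by (simp add: unitary_ensemble_def)
  have m: "(\<lambda>U. mmul n V U) \<in> \<mu> \<rightarrow>\<^sub>M borel"
    unfolding measurable_cong_sets[OF s refl] by (rule measurable_mmul) simp_all
  have "moment4 (distr \<mu> borel (\<lambda>U. mmul n V U)) k1 k2 l1 l2 i1 i2 j1 j2 = (LINT U|\<mu>. mmul n V U i1 k1 * mmul n V U i2 k2 * (cnj (mmul n V U j1 l1) * cnj (mmul n V U j2 l2)))"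
    unfolding moment4_def by (rule integral_distr[OF m measurable_monomial4])
  moreover have "distr \<mu> borel (\<lambda>U. mmul n V U) = \<mu>"
    using inv assms by (simp add: left_invariant_def)
  ultimately show ?thesis by (simp only:)
qed

lemma moment4_phase:
  assumes "\<And>i. cmod (z i) = 1" "i1 < n" "i2 < n" "j1 < n" "j2 < n"
  shows "M i1 i2 j1 j2 = z i1 * z i2 * (cnj (z j1) * cnj (z j2)) * M i1 i2 j1 j2"
proof -
  have "M i1 i2 j1 j2 = (LINT U|\<mu>. z i1 * z i2 * (cnj (z j1) * cnj (z j2)) * (U i1 k1 * U i2 k2 * (cnj (U j1 l1) * cnj (U j2 l2))))"
    by (rule trans[OF moment4_translate[OF phase_matrix_unitaries[of z, OF assms(1)]]],
        rule Bochner_Integration.integral_cong[OF refl])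
       (simp only: mmul_phase_matrix assms kl complex_cnj_mult mult_ac)
  also have "\<dots> = z i1 * z i2 * (cnj (z j1) * cnj (z j2)) * M i1 i2 j1 j2"
    unfolding moment4_def by (rule integral_mult_right_zero)
  finally show ?thesis .
qed

lemma moment4_perm:
  assumes "bij_betw \<pi> {..<n} {..<n}" "i1 < n" "i2 < n" "j1 < n" "j2 < n"
  shows "M i1 i2 j1 j2 = M (\<pi> i1) (\<pi> i2) (\<pi> j1) (\<pi> j2)"
proof -
  have "\<pi> i < n" if "i < n" for i using assms(1) that by (auto simp: bij_betw_def)
  then show ?thesis
    unfolding moment4_translate[OF perm_matrix_unitaries[OF assms(1)], of i1 i2 j1 j2]
    using assms kl by (simp add: mmul_perm_matrix moment4_def)
qed

text \<open>A phase on one row multiplies the moment by a factor that invariance forces to be 1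
  unless the moment vanishes. If the rows of \<open>U\<close> and of its conjugate do not match as
  multisets, some row yields a nontrivial factor.\<close>

lemma moment4_vanish:
  assumes "i1 < n" "i2 < n" "j1 < n" "j2 < n"
    and "\<not> (i1 = j1 \<and> i2 = j2)" "\<not> (i1 = j2 \<and> i2 = j1)"
  shows "M i1 i2 j1 j2 = 0"
proof -
  \<comment> \<open>A fourth root of unity instead of -1: when \<open>i1 = i2\<close> the phase may
    enter squared, and a sign would go unnoticed.\<close>
  define z where "z a i = (if i = a then \<i> else 1)" for a i :: nat
  have z: "cmod (z a i) = 1" for a i by (simp add: z_def)
  have "\<exists>a. z a i1 * z a i2 * (cnj (z a j1) * cnj (z a j2)) \<noteq> 1"
  proof (cases "i1 = j1 \<or> i1 = j2")
    case True
    then show ?thesis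
      by (intro exI[of _ i2]) (use assms(5,6) in \<open>auto simp: z_def complex_eq_iff\<close>)
  next
    case False
    then show ?thesis
      by (intro exI[of _ i1]) (auto simp: z_def complex_eq_iff)
  qed
  then obtain a where a: "z a i1 * z a i2 * (cnj (z a j1) * cnj (z a j2)) \<noteq> 1" by blast
  have "(1 - z a i1 * z a i2 * (cnj (z a j1) * cnj (z a j2))) * M i1 i2 j1 j2 = 0"
    using moment4_phase[of "z a" i1 i2 j1 j2] z assms by (simp add: algebra_simps)
  then show ?thesis using a by simp
qed

lemma bij_betw_to_01:
  assumes "i < n" "j < n" "i \<noteq> j"
  shows "\<exists>\<pi>. bij_betw \<pi> {..<n} {..<n} \<and> \<pi> i = 0 \<and> \<pi> j = 1"
proof -
  define t where "t a b = (\<lambda>x::nat. if x = a then b else if x = b then a else x)" for a b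
  have bij: "bij_betw (t a b) {..<n} {..<n}" if "a < n" "b < n" for a b
    by (rule bij_betw_byWitness[where f'="t a b"]) (use that in \<open>auto simp: t_def\<close>)
  define j' where "j' = t i 0 j"
  have j': "j' < n" "j' \<noteq> 0" using assms by (auto simp: j'_def t_def)
  have "bij_betw (t j' 1 \<circ> t i 0) {..<n} {..<n}"
    using bij_betw_trans[OF bij[of i 0] bij[of j' 1]] assms j' n2 by auto
  moreover have "(t j' 1 \<circ> t i 0) i = 0" using j' by (auto simp: t_def)
  moreover have "(t j' 1 \<circ> t i 0) j = 1" using j' by (simp add: j'_def[symmetric]) (simp add: t_def)
  ultimately show ?thesis by blast
qed

text \<open>Hadamard invariance on the rows \<open>i\<close> and \<open>v\<close>: of sixteen terms
  only six have matching rows, so 4 M = 2 M + 2 (B + C), where B and C are the two moments with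
  distinct rows. On the diagonal the contributions of identity and swap simply add.\<close>

lemma moment4_diag:
  assumes "i < n"
  shows "M i i i i = M 0 1 0 1 + M 0 1 1 0"
proof -
  obtain v where v: "v < n" "v \<noteq> i" using n2 by (metis One_nat_def less_2_cases_iff less_le_trans zero_neq_one)
  have eq: "M a b a b = M 0 1 0 1" "M a b b a = M 0 1 1 0" if "a < n" "b < n" "a \<noteq> b" for a b
    using bij_betw_to_01[OF that] moment4_perm that by metis+
  have vv: "M v v v v = M i i i i"
  proof -
    define t where "t = (\<lambda>x. if x = i then v else if x = v then i else x)"
    have "bij_betw t {..<n} {..<n}"
      by (rule bij_betw_byWitness[where f'=t]) (use v assms in \<open>auto simp: t_def\<close>)
    from moment4_perm[OF this v(1) v(1) v(1) v(1)] show ?thesis using v by (simp add: t_def)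
  qed
  note [simp] = integrable_monomial4[OF ens]
  let ?s = "complex_of_real (sqrt 2)"
  have s4: "?s * ?s * (?s * ?s) = 4" using sqrt2_complex by simp
  have "M i i i i = (LINT U|\<mu>. (1/4) * ((U i k1 + U v k1) * (U i k2 + U v k2) * (cnj (U i l1 + U v l1) * cnj (U i l2 + U v l2))))"
    unfolding moment4_translate[OF hadamard_matrix_unitaries[OF assms v(1) v(2)[symmetric]], of i i i i]
    using kl assms v s4 by (simp add: mmul_hadamard_matrix)
  also have "\<dots> = (1/4) * (LINT U|\<mu>. ((U i k1 + U v k1) * (U i k2 + U v k2) * (cnj (U i l1 + U v l1) * cnj (U i l2 + U v l2))))"
    by (rule integral_mult_right_zero)
  also have "(\<lambda>U::cmat. ((U i k1 + U v k1) * (U i k2 + U v k2) * (cnj (U i l1 + U v l1) * cnj (U i l2 + U v l2)))) =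
     (\<lambda>U. \<Sum>(a, b, c, d)\<in>{i,v} \<times> {i,v} \<times> {i,v} \<times> {i,v}. U a k1 * U b k2 * (cnj (U c l1) * cnj (U d l2)))"
    using v by (auto simp: sum.cartesian_product[symmetric] algebra_simps)
  also have "(LINT U|\<mu>. (\<Sum>(a, b, c, d)\<in>{i,v} \<times> {i,v} \<times> {i,v} \<times> {i,v}. U a k1 * U b k2 * (cnj (U c l1) * cnj (U d l2)))) =
     (\<Sum>(a, b, c, d)\<in>{i,v} \<times> {i,v} \<times> {i,v} \<times> {i,v}. M a b c d)"
    unfolding moment4_def case_prod_beta by (subst Bochner_Integration.integral_sum) simp_all
  also have "\<dots> = M i i i i + M v v v v + M i v i v + M v i v i + M i v v i + M v i i v"
    using v assms by (simp add: sum.cartesian_product[symmetric] moment4_vanish)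
  finally have "2 * M i i i i = 2 * (M 0 1 0 1 + M 0 1 1 0)"
    using eq[of i v] eq[of v i] vv v assms by (simp add: field_simps)
  then show ?thesis by (simp only: mult_cancel_left) simp
qed

lemma moment4_form:
  assumes "i1 < n" "i2 < n" "j1 < n" "j2 < n"
  shows "M i1 i2 j1 j2 = of_bool (i1 = j1 \<and> i2 = j2) * M 0 1 0 1 + of_bool (i1 = j2 \<and> i2 = j1) * M 0 1 1 0"
proof -
  have eq: "M a b a b = M 0 1 0 1" "M a b b a = M 0 1 1 0" if "a < n" "b < n" "a \<noteq> b" for a b
    using bij_betw_to_01[OF that] moment4_perm that by metis+
  show ?thesis
    using eq[of i1 i2] moment4_diag[of i1] moment4_vanish[of i1 i2 j1 j2] assms
    by (cases "i1 = j1 \<and> i2 = j2"; cases "i1 = j2 \<and> i2 = j1"; cases "i1 = i2") auto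
qed

text \<open>Contracting rows turns the products into inner products of columns, which are almost
  surely 0 or 1. These are the two equations that fix the remaining unknowns.\<close>

lemma moment4_sums:
  "(\<Sum>i1<n. \<Sum>i2<n. M i1 i2 i1 i2) = of_bool (k1 = l1 \<and> k2 = l2)"
  "(\<Sum>i1<n. \<Sum>i2<n. M i1 i2 i2 i1) = of_bool (k1 = l2 \<and> k2 = l1)"
proof -
  interpret prob_space \<mu> using ens by (simp add: unitary_ensemble_def)
  note [simp] = integrable_monomial4[OF ens]
  have AE: "AE U in \<mu>. U \<in> unitaries n" using ens by (simp add: unitary_ensemble_def)
  have s: "sets \<mu> = sets borel" using ens by (simp add: unitary_ensemble_def)
  have "(\<Sum>i1<n. \<Sum>i2<n. M i1 i2 i1 i2) =
      (LINT U|\<mu>. (\<Sum>i1<n. \<Sum>i2<n. U i1 k1 * U i2 k2 * (cnj (U i1 l1) * cnj (U i2 l2))))"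
    unfolding moment4_def by simp
  also have "\<dots> = (LINT U|\<mu>. of_bool (k1 = l1 \<and> k2 = l2))"
  proof (rule integral_cong_AE)
    show "AE U in \<mu>. (\<Sum>i1<n. \<Sum>i2<n. U i1 k1 * U i2 k2 * (cnj (U i1 l1) * cnj (U i2 l2))) = of_bool (k1 = l1 \<and> k2 = l2)"
      using AE
    proof eventually_elim
      fix U assume U: "U \<in> unitaries n"
      have "(\<Sum>i1<n. \<Sum>i2<n. U i1 k1 * U i2 k2 * (cnj (U i1 l1) * cnj (U i2 l2))) =
          (\<Sum>i1<n. U i1 k1 * cnj (U i1 l1)) * (\<Sum>i2<n. U i2 k2 * cnj (U i2 l2))"
        by (simp add: sum_product mult_ac)
      then show "(\<Sum>i1<n. \<Sum>i2<n. U i1 k1 * U i2 k2 * (cnj (U i1 l1) * cnj (U i2 l2))) = of_bool (k1 = l1 \<and> k2 = l2)"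
        using kl by (simp add: unitaries_orthonormal[OF U])
    qed
  qed (unfold measurable_cong_sets[OF s refl], intro borel_measurable_sum measurable_monomial4, simp)
  finally show "(\<Sum>i1<n. \<Sum>i2<n. M i1 i2 i1 i2) = of_bool (k1 = l1 \<and> k2 = l2)" by (simp add: prob_space)
  have "(\<Sum>i1<n. \<Sum>i2<n. M i1 i2 i2 i1) =
      (LINT U|\<mu>. (\<Sum>i1<n. \<Sum>i2<n. U i1 k1 * U i2 k2 * (cnj (U i2 l1) * cnj (U i1 l2))))"
    unfolding moment4_def by simp
  also have "\<dots> = (LINT U|\<mu>. of_bool (k1 = l2 \<and> k2 = l1))"
  proof (rule integral_cong_AE)
    show "AE U in \<mu>. (\<Sum>i1<n. \<Sum>i2<n. U i1 k1 * U i2 k2 * (cnj (U i2 l1) * cnj (U i1 l2))) = of_bool (k1 = l2 \<and> k2 = l1)"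
      using AE
    proof eventually_elim
      fix U assume U: "U \<in> unitaries n"
      have "(\<Sum>i1<n. \<Sum>i2<n. U i1 k1 * U i2 k2 * (cnj (U i2 l1) * cnj (U i1 l2))) =
          (\<Sum>i1<n. U i1 k1 * cnj (U i1 l2)) * (\<Sum>i2<n. U i2 k2 * cnj (U i2 l1))"
        by (simp add: sum_product mult_ac)
      then show "(\<Sum>i1<n. \<Sum>i2<n. U i1 k1 * U i2 k2 * (cnj (U i2 l1) * cnj (U i1 l2))) = of_bool (k1 = l2 \<and> k2 = l1)"
        using kl by (simp add: unitaries_orthonormal[OF U])
    qed
  qed (unfold measurable_cong_sets[OF s refl], intro borel_measurable_sum measurable_monomial4, simp)
  finally show "(\<Sum>i1<n. \<Sum>i2<n. M i1 i2 i2 i1) = of_bool (k1 = l2 \<and> k2 = l1)" by (simp add: prob_space)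
qed

text \<open>The two unknowns B, C of \<open>moment4_form\<close> satisfy x = n^2 B + n C and y = n^2
  C + n B, where x and y record whether the columns match directly or crosswise. Inverting this
  system gives the Weingarten function of degree two.\<close>

lemma weingarten:
  assumes "i1 < n" "i2 < n" "j1 < n" "j2 < n"
  shows "M i1 i2 j1 j2 =
    (of_bool (i1 = j1 \<and> i2 = j2) * (of_bool (k1 = l1 \<and> k2 = l2) - of_bool (k1 = l2 \<and> k2 = l1) / of_nat n) +
     of_bool (i1 = j2 \<and> i2 = j1) * (of_bool (k1 = l2 \<and> k2 = l1) - of_bool (k1 = l1 \<and> k2 = l2) / of_nat n))
    / (of_nat n ^ 2 - 1)"
proof -
  define B where "B = M 0 1 0 1"
  define C where "C = M 0 1 1 0"
  define x :: complex where "x = of_bool (k1 = l1 \<and> k2 = l2)"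
  define y :: complex where "y = of_bool (k1 = l2 \<and> k2 = l1)"
  have f: "M a b a b = B + (if b = a then C else 0)" "M a b b a = C + (if b = a then B else 0)" if "a < n" "b < n" for a b
    using moment4_form[OF that that] moment4_form[OF that that(2,1)]
    unfolding B_def[symmetric] C_def[symmetric] by auto
  have "(\<Sum>i1<n. \<Sum>i2<n. M i1 i2 i1 i2) = (\<Sum>i1<n. \<Sum>i2<n. B + (if i2 = i1 then C else 0))"
    by (intro sum.cong refl f) simp_all
  then have x: "x = of_nat n ^ 2 * B + of_nat n * C"
    using moment4_sums(1) by (simp add: x_def sum.distrib power2_eq_square algebra_simps)
  have "(\<Sum>i1<n. \<Sum>i2<n. M i1 i2 i2 i1) = (\<Sum>i1<n. \<Sum>i2<n. C + (if i2 = i1 then B else 0))"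
    by (intro sum.cong refl f) simp_all
  then have y: "y = of_nat n ^ 2 * C + of_nat n * B"
    using moment4_sums(2) by (simp add: y_def sum.distrib power2_eq_square algebra_simps)
  have n0: "(of_nat n :: complex) \<noteq> 0" using n2 by simp
  have "(of_nat n :: complex) ^ 2 = of_nat (n ^ 2)" by simp
  moreover have "n ^ 2 \<noteq> 1" using n2 by (simp add: power2_eq_square)
  ultimately have n1: "(of_nat n :: complex) ^ 2 - 1 \<noteq> 0"
    by (metis eq_iff_diff_eq_0 of_nat_1 of_nat_eq_iff)
  have "x - y / of_nat n = (of_nat n ^ 2 - 1) * B" "y - x / of_nat n = (of_nat n ^ 2 - 1) * C"
    unfolding x y using n0 by (simp_all add: field_simps power2_eq_square)
  then have "B = (x - y / of_nat n) / (of_nat n ^ 2 - 1)" "C = (y - x / of_nat n) / (of_nat n ^ 2 - 1)"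
    using n1 by simp_all
  then show ?thesis
    unfolding moment4_form[OF assms] B_def[symmetric] C_def[symmetric] x_def[symmetric] y_def[symmetric]
    by (simp add: add_divide_distrib)
qed

end

section \<open>Positive semidefinite square roots and the trace norm\<close>

definition qform :: "nat \<Rightarrow> cmat \<Rightarrow> (nat \<Rightarrow> complex) \<Rightarrow> complex" where
  "qform n M x = (\<Sum>i<n. \<Sum>j<n. cnj (x i) * M i j * x j)"

lemma psd_iff: "psd n M \<longleftrightarrow> supported n M \<and> (\<forall>i j. M i j = cnj (M j i)) \<and> (\<forall>x. 0 \<le> Re (qform n M x))"
  by (simp add: psd_def qform_def)

lemma psd_hermitian: "psd n M \<Longrightarrow> M i j = cnj (M j i)"
  unfolding psd_def by blast

lemma cnj_of_bool [simp]: "cnj (of_bool b) = of_bool b"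
  by (cases b) simp_all

lemma mmul_idm_entry:
  assumes "i < n" "j < n"
  shows "mmul n (idm n) A i j = A i j"
proof -
  have "(\<Sum>k<n. idm n i k * A k j) = (\<Sum>k<n. if k = i then A i j else 0)"
    using assms by (intro sum.cong) (auto simp: idm_def)
  then show ?thesis using assms by (simp add: mmul_def)
qed

lemma sum_of_bool_left: "(i::nat) < n \<Longrightarrow> (\<Sum>a<n. of_bool (a = i) * f a) = (f i :: complex)"
  by (simp add: of_bool_def if_distrib[where f="\<lambda>x. x * _"] cong: if_cong)

lemma qform_two:
  assumes ij: "i < n" "j < n"
  shows "qform n M (\<lambda>a. s * of_bool (a = i) + t * of_bool (a = j)) =
    cnj s * s * M i i + cnj s * t * M i j + cnj t * s * M j i + cnj t * t * M j j"
proof -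
  have 1: "(\<Sum>a<n. M b a * (s * of_bool (a = i) + t * of_bool (a = j))) = M b i * s + M b j * t" for b
  proof -
    have "(\<Sum>a<n. M b a * (s * of_bool (a = i) + t * of_bool (a = j))) =
      (\<Sum>a<n. of_bool (a = i) * (M b a * s)) + (\<Sum>a<n. of_bool (a = j) * (M b a * t))"
      by (simp add: sum.distrib[symmetric] algebra_simps)
    then show ?thesis using ij by (simp only: sum_of_bool_left)
  qed
  have "qform n M (\<lambda>a. s * of_bool (a = i) + t * of_bool (a = j)) =
    (\<Sum>b<n. cnj (s * of_bool (b = i) + t * of_bool (b = j)) * (M b i * s + M b j * t))"
    unfolding qform_def 1[symmetric] by (simp add: sum_distrib_left mult.assoc)
  also have "\<dots> = (\<Sum>b<n. of_bool (b = i) * (cnj s * (M b i * s + M b j * t))) + (\<Sum>b<n. of_bool (b = j) * (cnj t * (M b i * s + M b j * t)))"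
    by (simp add: sum.distrib[symmetric] algebra_simps)
  also have "\<dots> = cnj s * (M i i * s + M i j * t) + cnj t * (M j i * s + M j j * t)"
    using ij by (simp only: sum_of_bool_left)
  finally show ?thesis by (simp add: algebra_simps)
qed

lemma qform_one: "i < n \<Longrightarrow> qform n M (\<lambda>a. of_bool (a = i)) = M i i"
  using qform_two[of i n i M 1 0] by simp

lemma psd_diag: "psd n M \<Longrightarrow> i < n \<Longrightarrow> 0 \<le> Re (M i i) \<and> Im (M i i) = 0"
proof -
  assume M: "psd n M" and i: "i < n"
  have "Im (M i i) = Im (cnj (M i i))" by (rule arg_cong[OF psd_hermitian[OF M]])
  then have "Im (M i i) = 0" by simp
  moreover have "0 \<le> Re (qform n M (\<lambda>a. of_bool (a = i)))" using M by (simp add: psd_iff)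
  then have "0 \<le> Re (M i i)" by (simp only: qform_one[OF i])
  ultimately show ?thesis by simp
qed

text \<open>Nonnegativity of a 2 by 2 principal minor. Evaluating the form at the vector with
  entries \<open>- r * M i j\<close> at \<open>i\<close> and 1 at \<open>j\<close> gives a
  nonnegative quadratic polynomial in r.\<close>

lemma psd_entry_bound:
  assumes M: "psd n M" and ij: "i < n" "j < n"
  shows "(cmod (M i j))\<^sup>2 \<le> Re (M i i) * Re (M j j)"
proof -
  have h: "M j i = cnj (M i j)" by (rule psd_hermitian[OF M])
  have pos: "0 \<le> Re (qform n M x)" for x using M by (simp add: psd_iff)
  have di: "M i i = of_real (Re (M i i))" "M j j = of_real (Re (M j j))" "0 \<le> Re (M i i)" "0 \<le> Re (M j j)"
    using psd_diag[OF M] ij by (auto simp: complex_eq_iff)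
  define a where "a = Re (M i i)" define d where "d = Re (M j j)" define m where "m = cmod (M i j)"
  have key: "0 \<le> r\<^sup>2 * m\<^sup>2 * a - 2 * r * m\<^sup>2 + d" for r
  proof -
    let ?s = "- of_real r * M i j"
    have "qform n M (\<lambda>b. ?s * of_bool (b = i) + 1 * of_bool (b = j)) =
       of_real (r\<^sup>2) * (M i j * cnj (M i j)) * of_real a - of_real (2 * r) * (M i j * cnj (M i j)) + of_real d"
      unfolding qform_two[OF ij] h a_def d_def di(1,2)[symmetric]
      by (simp add: power2_eq_square algebra_simps)
    also have "\<dots> = of_real (r\<^sup>2 * m\<^sup>2 * a - 2 * r * m\<^sup>2 + d)"
      unfolding m_def by (simp add: complex_norm_square[symmetric])
    finally show ?thesis using pos[of "\<lambda>b. ?s * of_bool (b = i) + 1 * of_bool (b = j)"] by simp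
  qed
  have ad: "0 \<le> a" "0 \<le> d" using di by (simp_all add: a_def d_def)
  show ?thesis
  proof (cases "a = 0")
    case False
    \<comment> \<open>r = 1 / a minimises the quadratic.\<close>
    have "0 \<le> (1/a)\<^sup>2 * m\<^sup>2 * a - 2 * (1/a) * m\<^sup>2 + d" by (rule key)
    also have "\<dots> = d - m\<^sup>2 / a" using False by (simp add: power2_eq_square field_simps)
    finally have "m\<^sup>2 / a \<le> d" by simp
    then show ?thesis using False ad by (simp add: a_def[symmetric] d_def[symmetric] m_def[symmetric] field_simps)
  next
    \<comment> \<open>Now the polynomial is linear in r with slope -2 m^2, so a large r forces m =
      0.\<close>
    case True
    have "m\<^sup>2 = 0"
    proof (rule ccontr)
      assume "m\<^sup>2 \<noteq> 0"
      then have "(d + 1) / m\<^sup>2 * m\<^sup>2 = d + 1" by simp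
      moreover have "0 \<le> - 2 * ((d + 1) / m\<^sup>2 * m\<^sup>2) + d" using key[of "(d + 1) / m\<^sup>2"] unfolding True by (simp only: mult_zero_right mult.assoc)
      ultimately show False using ad by linarith
    qed
    then show ?thesis using True by (simp add: a_def[symmetric] d_def[symmetric] m_def[symmetric])
  qed
qed

lemma psd_trace_zero:
  assumes M: "psd n M" and "Re (mtrace n M) = 0"
  shows "M i j = 0"
proof (cases "i < n \<and> j < n")
  case True
  have "(\<Sum>i<n. Re (M i i)) = 0" using assms(2) by (simp add: mtrace_def)
  then have "\<forall>i\<in>{..<n}. Re (M i i) = 0"
    using psd_diag[OF M] by (subst (asm) sum_nonneg_eq_0_iff) auto
  then show ?thesis using psd_entry_bound[OF M, of i j] True by simp
next
  case False
  then show ?thesis using M unfolding psd_def supported_def by blast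
qed

lemma mtrace_mmul_commute: "mtrace n (mmul n A B) = mtrace n (mmul n B A)"
  unfolding mtrace_def mmul_def by simp (subst sum.swap, simp add: mult.commute)

text \<open>Since \<open>D\<close> is Hermitian, the form of D R D at \<open>x\<close> is the form
  of \<open>R\<close> at the vector D x.\<close>

lemma psd_conjugate:
  assumes R: "psd n R" and D: "\<And>i j. D i j = cnj (D j i)"
  shows "psd n (mmul n D (mmul n R D))"
proof -
  have q: "qform n (mmul n D (mmul n R D)) x = qform n R (\<lambda>i. \<Sum>j<n. D i j * x j)" for x
  proof -
    have "qform n (mmul n D (mmul n R D)) x = (\<Sum>i<n. \<Sum>j<n. \<Sum>k<n. \<Sum>l<n. cnj (x i) * D i k * R k l * (D l j * x j))"
      unfolding qform_def mmul_def by (simp add: sum_distrib_left sum_distrib_right mult.assoc)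
    also have "\<dots> = (\<Sum>k<n. \<Sum>l<n. \<Sum>i<n. \<Sum>j<n. cnj (x i) * D i k * R k l * (D l j * x j))"
    proof -
      have "(\<Sum>i<n. \<Sum>j<n. \<Sum>k<n. \<Sum>l<n. f i j k l) = (\<Sum>k<n. \<Sum>l<n. \<Sum>i<n. \<Sum>j<n. f i j k l)" for f :: "nat \<Rightarrow> nat \<Rightarrow> nat \<Rightarrow> nat \<Rightarrow> complex"
      proof -
        have "(\<Sum>i<n. \<Sum>j<n. \<Sum>k<n. \<Sum>l<n. f i j k l) = (\<Sum>i<n. \<Sum>k<n. \<Sum>j<n. \<Sum>l<n. f i j k l)"
          by (intro sum.cong refl sum.swap)
        also have "\<dots> = (\<Sum>k<n. \<Sum>i<n. \<Sum>j<n. \<Sum>l<n. f i j k l)" by (rule sum.swap)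
        also have "\<dots> = (\<Sum>k<n. \<Sum>i<n. \<Sum>l<n. \<Sum>j<n. f i j k l)" by (intro sum.cong refl sum.swap)
        also have "\<dots> = (\<Sum>k<n. \<Sum>l<n. \<Sum>i<n. \<Sum>j<n. f i j k l)" by (intro sum.cong refl sum.swap)
        finally show ?thesis .
      qed
      then show ?thesis .
    qed
    also have "\<dots> = qform n R (\<lambda>i. \<Sum>j<n. D i j * x j)"
      unfolding qform_def
    proof (intro sum.cong refl)
      fix k l
      have c: "cnj (\<Sum>j<n. D k j * x j) = (\<Sum>i<n. cnj (x i) * D i k)"
      proof -
        have "cnj (D k i * x i) = cnj (x i) * D i k" for i by (subst D[of i k]) (simp add: mult.commute)
        then show ?thesis by (simp only: cnj_sum)
      qed
      show "(\<Sum>i<n. \<Sum>j<n. cnj (x i) * D i k * R k l * (D l j * x j)) = cnj (\<Sum>j<n. D k j * x j) * R k l * (\<Sum>j<n. D l j * x j)"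
        unfolding c by (subst sum.swap) (simp add: sum_distrib_left sum_distrib_right)
    qed
    finally show ?thesis .
  qed
  have aD: "adj D = D" unfolding adj_def by (intro ext) (rule D[symmetric])
  have aR: "adj R = R" unfolding adj_def by (intro ext) (rule psd_hermitian[OF R, symmetric])
  have aM: "adj (mmul n D (mmul n R D)) = mmul n D (mmul n R D)"
    by (simp add: adj_mmul aD aR mmul_assoc)
  have "mmul n D (mmul n R D) i j = cnj (mmul n D (mmul n R D) j i)" for i j
    using fun_cong[OF fun_cong[OF aM, of i], of j] unfolding adj_def by (rule sym)
  then show ?thesis using R unfolding psd_iff q by (intro conjI supported_mmul) blast+
qed

text \<open>With \<open>D = R - S\<close> one has \<open>R D = - D S\<close>, hence \<open>tr (D R D) + tr (D S D) = 0\<close> and so \<open>D\<^sup>3 = 0\<close>.\<close>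

lemma psd_sqrt_unique:
  assumes R: "psd n R" and S: "psd n S" and eq: "mmul n R R = mmul n S S"
  shows "R = S"
proof -
  define D where "D = (\<lambda>i j. R i j - S i j)"
  have herm: "D i j = cnj (D j i)" for i j using psd_hermitian[OF R, of i j] psd_hermitian[OF S, of i j] by (simp only: D_def complex_cnj_diff)
  have dist_l: "mmul n A D = (\<lambda>i j. mmul n A R i j - mmul n A S i j)" for A
    by (auto simp: D_def mmul_def fun_eq_iff right_diff_distrib sum_subtractf)
  have dist_r: "mmul n D A = (\<lambda>i j. mmul n R A i j - mmul n S A i j)" for A
    by (auto simp: D_def mmul_def fun_eq_iff left_diff_distrib sum_subtractf)
  have RD: "mmul n R D i j = - mmul n D S i j" for i j
    unfolding dist_l dist_r eq by simp
  have "mtrace n (mmul n D (mmul n R D)) = - mtrace n (mmul n D (mmul n D S))"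
    by (simp add: mtrace_def mmul_def[of n D "mmul n R D"] mmul_def[of n D "mmul n D S"] RD sum_negf)
  also have "mtrace n (mmul n D (mmul n D S)) = mtrace n (mmul n D (mmul n S D))"
    by (subst mtrace_mmul_commute) (simp add: mmul_assoc)
  finally have tr: "mtrace n (mmul n D (mmul n R D)) = - mtrace n (mmul n D (mmul n S D))" .
  have nonneg: "0 \<le> Re (mtrace n M)" if "psd n M" for M
    using psd_diag[OF that] by (auto simp: mtrace_def intro!: sum_nonneg)
  note pR = psd_conjugate[where D=D, OF R herm] and pS = psd_conjugate[where D=D, OF S herm]
  have "Re (mtrace n (mmul n D (mmul n R D))) = 0" "Re (mtrace n (mmul n D (mmul n S D))) = 0"
    using tr nonneg[OF pR] nonneg[OF pS] by simp_all
  then have z: "mmul n D (mmul n R D) i j = 0" "mmul n D (mmul n S D) i j = 0" for i j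
    using psd_trace_zero pR pS by blast+
  have DDD: "mmul n D (mmul n D D) i j = 0" for i j
  proof -
    have "mmul n D (mmul n D D) i j = mmul n D (mmul n R D) i j - mmul n D (mmul n S D) i j"
      unfolding dist_r[of D] by (auto simp: mmul_def[of n D] right_diff_distrib sum_subtractf)
    then show ?thesis using z by simp
  qed
  \<comment> \<open>For Hermitian \<open>M\<close> a diagonal entry of the square is the squared
    norm of a row. Used twice: D^4 = 0 yields D^2 = 0, and then D = 0.\<close>
  have square_zero: "M i j = 0" if sq: "mmul n M M i i = 0" and h: "\<And>i j. M i j = cnj (M j i)" and "i < n" "j < n" for M i j
  proof -
    have "complex_of_real (\<Sum>k<n. (cmod (M i k))\<^sup>2) = (\<Sum>k<n. M i k * M k i)"
    proof (simp only: of_real_sum complex_norm_square, intro sum.cong refl)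
      fix k
      have "M k i = cnj (M i k)" by (rule h)
      then show "M i k * cnj (M i k) = M i k * M k i" by (simp only:)
    qed
    also have "\<dots> = 0" using sq that(3) by (simp add: mmul_def)
    finally have "(\<Sum>k<n. (cmod (M i k))\<^sup>2) = 0" by (simp only: of_real_eq_0_iff)
    then have "\<forall>k\<in>{..<n}. (cmod (M i k))\<^sup>2 = 0" by (subst (asm) sum_nonneg_eq_0_iff) auto
    then show ?thesis using that(4) by simp
  qed
  have "mmul n (mmul n D D) (mmul n D D) i j = 0" for i j
  proof -
    have "mmul n (mmul n D D) (mmul n D D) = mmul n D (mmul n D (mmul n D D))" by (simp add: mmul_assoc)
    also have "\<dots> = (\<lambda>i j. 0)" by (simp add: mmul_def[of n D "mmul n D (mmul n D D)"] DDD fun_eq_iff)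
    finally show ?thesis by simp
  qed
  moreover have "mmul n D D i j = cnj (mmul n D D j i)" for i j
  proof -
    have aD: "adj D = D" unfolding adj_def by (intro ext) (rule herm[symmetric])
    have "adj (mmul n D D) = mmul n D D" by (simp only: adj_mmul aD)
    from fun_cong[OF fun_cong[OF this, of i], of j] show ?thesis by (simp only: adj_def)
  qed
  ultimately have "mmul n D D i i = 0" if "i < n" for i using square_zero[of "mmul n D D" i i] that by blast
  then have "D i j = 0" if "i < n" "j < n" for i j using square_zero[of D i j] herm that by blast
  moreover have "D i j = 0" if "\<not> (i < n \<and> j < n)" for i j
  proof -
    have "R i j = 0" using R that unfolding psd_def supported_def by blast
    moreover have "S i j = 0" using S that unfolding psd_def supported_def by blast
    ultimately show ?thesis by (simp add: D_def)
  qed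
  ultimately have "D i j = 0" for i j by blast
  then show ?thesis by (auto simp: D_def fun_eq_iff)
qed

section \<open>Compactness of the unitary group and polar decomposition\<close>

lemma compact_unitaries: "compact (unitaries n)"
proof -
  have "compact (Pi\<^sub>E UNIV (\<lambda>i. Pi\<^sub>E UNIV (\<lambda>j. cball (0::complex) 1)) :: cmat set)"
  proof -
    have 1: "compact (Pi\<^sub>E UNIV (\<lambda>j. cball (0::complex) 1) :: (nat \<Rightarrow> complex) set)"
      using compactin_PiE[of "\<lambda>_. euclidean" UNIV "\<lambda>j::nat. cball (0::complex) 1"]
      by (simp add: euclidean_product_topology)
    show ?thesis
      using compactin_PiE[of "\<lambda>_. euclidean" UNIV "\<lambda>i::nat. Pi\<^sub>E UNIV (\<lambda>j. cball (0::complex) 1) :: (nat \<Rightarrow> complex) set"] 1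
      by (simp add: euclidean_product_topology)
  qed
  \<comment> \<open>Matrices are functions on all pairs of naturals, so compactness rests on
    Tychonoff for a product of unit discs; in the product topology each condition on finitely many
    entries is closed.\<close>
  moreover have "closed (unitaries n)"
  proof -
    have ent: "continuous_on UNIV (\<lambda>U::cmat. U i j)" for i j
      by (rule continuous_on_product_then_coordinatewise, rule continuous_on_product_coordinates)
    have c1: "closed {U::cmat. U i j = 0}" for i j
      by (rule closed_Collect_eq[OF ent continuous_on_const])
    have c2: "closed {U::cmat. (\<Sum>k<n. cnj (U k i) * U k j) = of_bool (i = j)}" for i j
      by (rule closed_Collect_eq) (intro continuous_on_sum continuous_on_mult continuous_on_cnj ent, rule continuous_on_const)
    have "unitaries n = (\<Inter>i. \<Inter>j\<in>{j. \<not> (i < n \<and> j < n)}. {U. U i j = 0}) \<inter>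
       (\<Inter>i\<in>{..<n}. \<Inter>j\<in>{..<n}. {U. (\<Sum>k<n. cnj (U k i) * U k j) = of_bool (i = j)})"
      (is "_ = ?R")
    proof
      show "unitaries n \<subseteq> ?R"
      proof
        fix U assume U: "U \<in> unitaries n"
        have "(\<Sum>k<n. cnj (U k i) * U k j) = of_bool (i = j)" if "i < n" "j < n" for i j
          using unitaries_orthonormal[OF U that(2,1)] by (simp add: mult.commute eq_commute)
        then show "U \<in> ?R" using unitaries_supported[OF U] by simp
      qed
      show "?R \<subseteq> unitaries n"
        by (rule subsetI, rule unitaries_I) (simp_all add: supported_def)
    qed
    then show ?thesis by (simp only:) (intro closed_Int closed_INT ballI c1 c2)
  qed
  moreover have "unitaries n \<subseteq> Pi\<^sub>E UNIV (\<lambda>i. Pi\<^sub>E UNIV (\<lambda>j. cball (0::complex) 1))"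
    by (auto simp: PiE_def unitaries_norm_le_1)
  ultimately show ?thesis using closed_Int_compact by (metis Int_absorb2)
qed

text \<open>The operator has eigenvalue \<open>z\<close> on the unit vector \<open>v\<close> and 1
  on its orthogonal complement. It is unitary because (z - 1) + cnj (z - 1) + |z - 1|^2 = |z|^2 - 1
  = 0.\<close>

lemma rank_one_unitaries:
  assumes v: "(\<Sum>i<n. v i * cnj (v i)) = 1" and z: "cmod z = 1"
  shows "(\<lambda>i j. if i < n \<and> j < n then of_bool (i = j) + (z - 1) * v i * cnj (v j) else 0) \<in> unitaries n"
    (is "?W \<in> _")
proof (rule unitaries_I)
  fix i j assume ij: "i < n" "j < n"
  have zz: "z * cnj z = 1" using z complex_norm_square[of z] by simp
  have "(\<Sum>k<n. cnj (?W k i) * ?W k j) =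
     (\<Sum>k<n. of_bool (k = i) * (of_bool (i = j) + (z - 1) * v i * cnj (v j)) + of_bool (k = j) * (cnj (z - 1) * v i * cnj (v j))
        + cnj (z - 1) * (z - 1) * v i * cnj (v j) * (v k * cnj (v k)))"
    using ij by (intro sum.cong refl) (auto simp: algebra_simps)
  also have "\<dots> = of_bool (i = j) + ((z - 1) + cnj (z - 1) + cnj (z - 1) * (z - 1)) * (v i * cnj (v j))"
    using ij v by (simp only: sum.distrib sum_of_bool_left sum_distrib_left[symmetric]) (simp add: algebra_simps)
  also have "(z - 1) + cnj (z - 1) + cnj (z - 1) * (z - 1) = 0" using zz by (simp add: algebra_simps)
  finally show "(\<Sum>k<n. cnj (?W k i) * ?W k j) = of_bool (i = j)" by simp
qed (auto simp: supported_def)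

text \<open>Polarisation: vectors with entries 1 and 1, respectively 1 and the imaginary unit, at
  two positions control the imaginary and the real parts of the off-diagonal entries.\<close>

lemma hermitian_if_qform_real:
  assumes "supported n R" and re: "\<And>x. Im (qform n R x) = 0"
  shows "R i j = cnj (R j i)"
proof (cases "i < n \<and> j < n")
  case True
  then have ij: "i < n" "j < n" by auto
  have d: "Im (R i i) = 0" "Im (R j j) = 0" using re[of "\<lambda>a. of_bool (a = i)"] re[of "\<lambda>a. of_bool (a = j)"] ij by (simp_all add: qform_one)
  have "Im (R i j) + Im (R j i) = 0"
    using re[of "\<lambda>a. 1 * of_bool (a = i) + 1 * of_bool (a = j)"] d unfolding qform_two[OF ij] by simp
  moreover have "Re (R i j) - Re (R j i) = 0"
    using re[of "\<lambda>a. 1 * of_bool (a = i) + \<i> * of_bool (a = j)"] d unfolding qform_two[OF ij] by simp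
  ultimately show ?thesis by (auto simp: complex_eq_iff)
qed (use assms in \<open>auto simp: supported_def\<close>)

text \<open>Polar decomposition: if \<open>U\<close> maximises \<open>Re tr (U A)\<close> over the compact unitary group, then \<open>U A\<close> is
  positive semidefinite, as is seen by perturbing \<open>U\<close> to \<open>(I + (z - 1) v v*) U\<close>.\<close>

lemma polar_decomposition:
  "\<exists>R. psd n R \<and> mmul n R R = mmul n (adj A) A"
proof -
  have ent: "continuous_on UNIV (\<lambda>U::cmat. U i j)" for i j
    by (rule continuous_on_product_then_coordinatewise, rule continuous_on_product_coordinates)
  have "continuous_on (unitaries n) (\<lambda>U. Re (\<Sum>i<n. \<Sum>k<n. U i k * A k i))"
    by (intro continuous_on_Re continuous_on_sum continuous_on_mult continuous_on_const continuous_on_subset[OF ent]) simp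
  moreover have "unitaries n \<noteq> {}" using idm_unitaries[of n] by blast
  ultimately have "\<exists>U\<in>unitaries n. \<forall>W\<in>unitaries n. Re (\<Sum>i<n. \<Sum>k<n. W i k * A k i) \<le> Re (\<Sum>i<n. \<Sum>k<n. U i k * A k i)"
    by (intro continuous_attains_sup compact_unitaries)
  then obtain U where U: "U \<in> unitaries n"
    and max: "\<And>W. W \<in> unitaries n \<Longrightarrow> Re (\<Sum>i<n. \<Sum>k<n. W i k * A k i) \<le> Re (\<Sum>i<n. \<Sum>k<n. U i k * A k i)"
    by blast
  define R where "R = mmul n U A"
  have tr: "(\<Sum>i<n. \<Sum>k<n. mmul n W U i k * A k i) = (\<Sum>i<n. \<Sum>k<n. W i k * R k i)" for W
  proof -
    have "(\<Sum>i<n. \<Sum>k<n. mmul n W U i k * A k i) = mtrace n (mmul n (mmul n W U) A)"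
      by (simp add: mtrace_def mmul_def[of n "mmul n W U"])
    also have "\<dots> = (\<Sum>i<n. \<Sum>k<n. W i k * R k i)"
      unfolding mmul_assoc R_def by (simp add: mtrace_def mmul_def[of n W])
    finally show ?thesis .
  qed
  have trU: "(\<Sum>i<n. \<Sum>k<n. U i k * A k i) = (\<Sum>i<n. R i i)"
    by (simp add: R_def mmul_def)
  have unit: "Im (qform n R v) = 0 \<and> 0 \<le> Re (qform n R v)" if v: "(\<Sum>i<n. v i * cnj (v i)) = 1" for v
  proof -
    have le: "Re (z * qform n R v) \<le> Re (qform n R v)" if z: "cmod z = 1" for z
    proof -
      let ?W = "\<lambda>i j. if i < n \<and> j < n then of_bool (i = j) + (z - 1) * v i * cnj (v j) else 0"
      have "(\<Sum>i<n. \<Sum>k<n. ?W i k * R k i) = (\<Sum>i<n. \<Sum>k<n. of_bool (k = i) * R k i + (z - 1) * (cnj (v k) * R k i * v i))"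
        by (intro sum.cong refl) (auto simp: algebra_simps)
      also have "\<dots> = (\<Sum>i<n. \<Sum>k<n. of_bool (k = i) * R k i) + (\<Sum>i<n. \<Sum>k<n. (z - 1) * (cnj (v k) * R k i * v i))"
        by (simp only: sum.distrib)
      also have "(\<Sum>i<n. \<Sum>k<n. of_bool (k = i) * R k i) = (\<Sum>i<n. R i i)"
        by (intro sum.cong refl) (simp only: sum_of_bool_left lessThan_iff)
      also have "(\<Sum>i<n. \<Sum>k<n. (z - 1) * (cnj (v k) * R k i * v i)) = (z - 1) * qform n R v"
        unfolding qform_def by (subst sum.swap) (simp add: sum_distrib_left)
      finally have "Re ((z - 1) * qform n R v) \<le> 0"
        using max[OF mmul_unitaries[OF rank_one_unitaries[OF v z] U]] unfolding tr trU by simp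
      then show ?thesis by (simp add: algebra_simps)
    qed
    \<comment> \<open>The phase that rotates c onto the positive axis turns the maximality
      inequality into |c| <= Re c, so c is real and nonnegative.\<close>
    define c where "c = qform n R v"
    have "cmod c \<le> Re c"
    proof (cases "c = 0")
      case False
      have "cmod (cnj c / of_real (cmod c)) = 1" using False by (simp add: norm_divide)
      moreover have "cnj c / of_real (cmod c) * c = of_real (cmod c)"
        using False complex_norm_square[of c] by (simp add: power2_eq_square field_simps)
      ultimately show ?thesis using le[of "cnj c / of_real (cmod c)"] by (simp add: c_def)
    qed simp
    then have "cmod c = Re c" using complex_Re_le_cmod[of c] by (rule antisym)
    moreover have "(cmod c)\<^sup>2 = (Re c)\<^sup>2 + (Im c)\<^sup>2" by (rule cmod_power2)
    ultimately have "(Im c)\<^sup>2 = 0" "0 \<le> Re c" using norm_ge_zero[of c] by (simp_all only:)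
    then show ?thesis by (simp add: c_def)
  qed
  have all: "Im (qform n R x) = 0 \<and> 0 \<le> Re (qform n R x)" for x
  proof (cases "(\<Sum>i<n. (cmod (x i))\<^sup>2) = 0")
    case True
    then have "\<forall>i\<in>{..<n}. (cmod (x i))\<^sup>2 = 0" by (subst (asm) sum_nonneg_eq_0_iff) auto
    then have "qform n R x = 0" unfolding qform_def by (intro sum.neutral ballI) simp
    then show ?thesis by simp
  next
    case False
    define s where "s = (\<Sum>i<n. (cmod (x i))\<^sup>2)"
    have s: "0 < s" using False sum_nonneg[of "{..<n}" "\<lambda>i. (cmod (x i))\<^sup>2"] by (simp add: s_def)
    define v where "v i = x i / of_real (sqrt s)" for i
    have sq: "complex_of_real (sqrt s) * complex_of_real (sqrt s) = of_real s"
      using s by (simp flip: of_real_mult)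
    have "(\<Sum>i<n. v i * cnj (v i)) = (\<Sum>i<n. x i * cnj (x i)) / of_real s"
      by (simp add: v_def sum_divide_distrib sq)
    also have "(\<Sum>i<n. x i * cnj (x i)) = of_real s"
      unfolding s_def by (simp only: of_real_sum complex_norm_square)
    finally have v1: "(\<Sum>i<n. v i * cnj (v i)) = 1" using s by simp
    have "qform n R v = qform n R x / of_real s"
      by (simp add: v_def qform_def sum_divide_distrib sq)
    then have "qform n R x = of_real s * qform n R v" using s by simp
    then show ?thesis using unit[OF v1] s by simp
  qed
  have supp: "supported n R" by (simp add: R_def)
  have herm: "R i j = cnj (R j i)" for i j by (rule hermitian_if_qform_real[OF supp]) (use all in blast)
  have psd: "psd n R" unfolding psd_iff using supp herm all by blast
  have aR: "adj R = R" unfolding adj_def by (intro ext) (rule herm[symmetric])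
  have "mmul n R R = mmul n (adj R) R" by (simp add: aR)
  also have "\<dots> = mmul n (adj A) (mmul n (mmul n (adj U) U) A)" by (simp add: R_def adj_mmul mmul_assoc)
  also have "\<dots> = mmul n (adj A) A"
  proof -
    have "mmul n (adj U) U = idm n" using U by (simp add: unitaries_def)
    then show ?thesis by (intro ext) (simp add: mmul_def[of n "adj A"] mmul_idm_entry)
  qed
  finally show ?thesis using psd by blast
qed

text \<open>Existence from the polar decomposition together with uniqueness of positive roots gives
  the definite description in \<open>psd_sqrt\<close> its meaning.\<close>

lemma psd_sqrt_properties:
  "psd n (psd_sqrt n (mmul n (adj A) A)) \<and>
   mmul n (psd_sqrt n (mmul n (adj A) A)) (psd_sqrt n (mmul n (adj A) A)) = mmul n (adj A) A"
proof -
  obtain R where R: "psd n R \<and> mmul n R R = mmul n (adj A) A" using polar_decomposition by blast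
  have "S = R" if "psd n S \<and> mmul n S S = mmul n (adj A) A" for S
    using psd_sqrt_unique[of n S R] R that by simp
  with R have "\<exists>!R. psd n R \<and> mmul n R R = mmul n (adj A) A" by blast
  then show ?thesis unfolding psd_sqrt_def by (rule theI')
qed

section \<open>Comparison of the trace norm with the Hilbert-Schmidt norm\<close>

definition hs_norm_sq :: "nat \<Rightarrow> cmat \<Rightarrow> real" where
  "hs_norm_sq n A = (\<Sum>i<n. \<Sum>j<n. (cmod (A i j))\<^sup>2)"

text \<open>\<open>A\<close> and its positive part \<open>R\<close> have the same Hilbert-Schmidt
  norm, as it depends only on the product of adjoint and matrix. The entry bound for positive
  matrices then gives the first comparison, Cauchy-Schwarz on the diagonal of \<open>R\<close> the
  second. Later estimates can therefore work with entries.\<close>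

lemma trace_norm_hs:
  shows "0 \<le> trace_norm n A" "hs_norm_sq n A \<le> (trace_norm n A)\<^sup>2" "(trace_norm n A)\<^sup>2 \<le> real n * hs_norm_sq n A"
proof -
  define R where "R = psd_sqrt n (mmul n (adj A) A)"
  have R: "psd n R" and RR: "mmul n R R = mmul n (adj A) A"
    unfolding R_def by (rule conjunct1[OF psd_sqrt_properties], rule conjunct2[OF psd_sqrt_properties])
  have t: "trace_norm n A = (\<Sum>i<n. Re (R i i))" by (simp add: trace_norm_def R_def[symmetric] mtrace_def)
  have h: "R i j = cnj (R j i)" for i j by (rule psd_hermitian[OF R])
  have hsc: "complex_of_real (hs_norm_sq n M) = mtrace n (mmul n (adj M) M)" for M
  proof -
    have "mtrace n (mmul n (adj M) M) = (\<Sum>i<n. \<Sum>j<n. M j i * cnj (M j i))"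
      by (simp add: mtrace_def mmul_def adj_def mult.commute)
    also have "\<dots> = (\<Sum>j<n. \<Sum>i<n. M j i * cnj (M j i))" by (rule sum.swap)
    finally show ?thesis unfolding hs_norm_sq_def by (simp only: of_real_sum complex_norm_square)
  qed
  have "adj R = R" unfolding adj_def by (intro ext) (rule h[symmetric])
  then have "complex_of_real (hs_norm_sq n A) = complex_of_real (hs_norm_sq n R)" by (simp only: hsc RR)
  then have hs: "hs_norm_sq n A = hs_norm_sq n R" by (simp only: of_real_eq_iff)
  have d: "0 \<le> Re (R i i)" if "i < n" for i using psd_diag[OF R that] by simp
  show "0 \<le> trace_norm n A" unfolding t using d by (intro sum_nonneg) auto
  have "hs_norm_sq n R \<le> (\<Sum>i<n. \<Sum>j<n. Re (R i i) * Re (R j j))"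
    unfolding hs_norm_sq_def by (intro sum_mono psd_entry_bound[OF R]) auto
  also have "\<dots> = (trace_norm n A)\<^sup>2" by (simp add: t power2_eq_square sum_product)
  finally show "hs_norm_sq n A \<le> (trace_norm n A)\<^sup>2" by (simp add: hs)
  have "(trace_norm n A)\<^sup>2 = (\<Sum>i<n. 1 * Re (R i i))\<^sup>2" by (simp add: t)
  also have "\<dots> \<le> (\<Sum>i<n. 1\<^sup>2) * (\<Sum>i<n. (Re (R i i))\<^sup>2)" by (rule Cauchy_Schwarz_ineq_sum)
  also have "(\<Sum>i<n. (Re (R i i))\<^sup>2) \<le> hs_norm_sq n R"
    unfolding hs_norm_sq_def
  proof (rule sum_mono)
    fix i assume i: "i \<in> {..<n}"
    have "(Re (R i i))\<^sup>2 \<le> (cmod (R i i))\<^sup>2" by (simp add: abs_Re_le_cmod power2_le_iff_abs_le cmod_power2)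
    also have "\<dots> \<le> (\<Sum>j<n. (cmod (R i j))\<^sup>2)" using i by (intro member_le_sum) auto
    finally show "(Re (R i i))\<^sup>2 \<le> (\<Sum>j<n. (cmod (R i j))\<^sup>2)" .
  qed
  finally show "(trace_norm n A)\<^sup>2 \<le> real n * hs_norm_sq n A"
    by (simp add: hs mult_left_mono)
qed

section \<open>Existence of Haar measure on the unitary group\<close>

lemma measurable_cmod: "f \<in> borel_measurable M \<Longrightarrow> (\<lambda>x. cmod (f x)) \<in> borel_measurable M"
  by (rule measurable_compose[OF _ borel_measurable_norm])

text \<open>\<open>unitaries\<close> only demands orthonormal columns. For the rows, the product P
  of \<open>V\<close> with its adjoint is a Hermitian idempotent of trace n. Each diagonal entry d
  satisfies d >= d^2, so d <= 1; the trace forces d = 1, and then the off-diagonal entries have to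
  vanish.\<close>

lemma unitaries_adj:
  assumes V: "V \<in> unitaries n"
  shows "adj V \<in> unitaries n"
proof -
  define P where "P = mmul n V (adj V)"
  have supp: "supported n (adj V)" using V by (auto simp: unitaries_def supported_def adj_def)
  have herm: "P i j = cnj (P j i)" for i j by (auto simp: P_def mmul_def adj_def mult.commute)
  have "mmul n P P = mmul n V (mmul n (mmul n (adj V) V) (adj V))" by (simp add: P_def mmul_assoc)
  also have "\<dots> = P" using V by (simp add: unitaries_def mmul_idm_left[OF supp] P_def)
  finally have PP: "mmul n P P = P" .
  have diag: "P i i = complex_of_real (\<Sum>j<n. (cmod (P i j))\<^sup>2)" if "i < n" for i
  proof -
    have "mmul n P P i i = P i i" by (simp only: PP)
    then have "P i i = (\<Sum>j<n. P i j * P j i)" using that by (simp add: mmul_def)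
    also have "\<dots> = (\<Sum>j<n. P i j * cnj (P i j))"
    proof (rule sum.cong[OF refl])
      fix j
      have "P j i = cnj (P i j)" by (rule herm)
      then show "P i j * P j i = P i j * cnj (P i j)" by (simp only:)
    qed
    finally show ?thesis by (simp only: complex_norm_square[symmetric] of_real_sum)
  qed
  define d where "d i = (\<Sum>j<n. (cmod (P i j))\<^sup>2)" for i
  have split: "d i = (d i)\<^sup>2 + (\<Sum>j\<in>{..<n} - {i}. (cmod (P i j))\<^sup>2)" if "i < n" for i
  proof -
    have "d i = (cmod (P i i))\<^sup>2 + (\<Sum>j\<in>{..<n} - {i}. (cmod (P i j))\<^sup>2)"
      unfolding d_def using that by (subst sum.remove[of _ i]) auto
    moreover have "cmod (P i i) = d i"
      unfolding diag[OF that] norm_of_real d_def by (simp add: sum_nonneg)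
    ultimately show ?thesis by simp
  qed
  have le: "d i \<le> 1" if "i < n" for i
  proof (rule ccontr)
    assume "\<not> d i \<le> 1"
    then have "d i < (d i)\<^sup>2" by (simp add: power2_eq_square)
    moreover have "0 \<le> (\<Sum>j\<in>{..<n} - {i}. (cmod (P i j))\<^sup>2)" by (intro sum_nonneg) auto
    ultimately show False using split[OF that] by linarith
  qed
  have "complex_of_real (\<Sum>i<n. d i) = (\<Sum>i<n. P i i)" using diag by (simp add: d_def)
  also have "\<dots> = (\<Sum>i<n. \<Sum>k<n. V i k * cnj (V i k))" by (simp add: P_def mmul_def adj_def)
  also have "\<dots> = (\<Sum>k<n. \<Sum>i<n. V i k * cnj (V i k))" by (rule sum.swap)
  also have "\<dots> = complex_of_real (real n)" by (simp add: unitaries_orthonormal[OF V])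
  finally have sumd: "(\<Sum>i<n. d i) = real n" by (simp only: of_real_eq_iff)
  have d1: "d i = 1" if "i < n" for i
  proof -
    have "(\<Sum>i<n. 1 - d i) = 0" using sumd by (simp add: sum_subtractf)
    then have "\<forall>i\<in>{..<n}. 1 - d i = 0" by (subst (asm) sum_nonneg_eq_0_iff) (use le in auto)
    then show ?thesis using that by auto
  qed
  have "P i j = of_bool (i = j)" if "i < n" "j < n" for i j
  proof (cases "i = j")
    case True
    have "P i i = complex_of_real (d i)" using diag that by (simp only: d_def)
    then show ?thesis using True d1[of i] that by simp
  next
    case False
    have "(\<Sum>j\<in>{..<n} - {i}. (cmod (P i j))\<^sup>2) = 0" using split[of i] d1[of i] that by simp
    then have "\<forall>j\<in>{..<n} - {i}. (cmod (P i j))\<^sup>2 = 0" by (subst (asm) sum_nonneg_eq_0_iff) auto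
    then show ?thesis using that False by auto
  qed
  then have "P = idm n" by (auto simp: fun_eq_iff P_def mmul_def idm_def)
  then show ?thesis using supp by (simp add: unitaries_def P_def adj_def)
qed

lemma unitaries_isometry:
  assumes V: "V \<in> unitaries n"
  shows "(\<Sum>k<n. cnj (\<Sum>a<n. V k a * x a) * (\<Sum>b<n. V k b * y b)) = (\<Sum>a<n. cnj (x a) * y a)"
proof -
  have "(\<Sum>k<n. cnj (\<Sum>a<n. V k a * x a) * (\<Sum>b<n. V k b * y b)) =
     (\<Sum>k<n. \<Sum>a<n. \<Sum>b<n. cnj (x a) * y b * (V k b * cnj (V k a)))"
    by (simp only: cnj_sum sum_product complex_cnj_mult, intro sum.cong refl, simp add: mult_ac)
  also have "\<dots> = (\<Sum>a<n. \<Sum>b<n. \<Sum>k<n. cnj (x a) * y b * (V k b * cnj (V k a)))"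
    by (rule trans[OF sum.swap], rule sum.cong[OF refl], rule sum.swap)
  also have "\<dots> = (\<Sum>a<n. \<Sum>b<n. if b = a then cnj (x a) * y a else 0)"
    by (intro sum.cong refl) (simp add: unitaries_orthonormal[OF V] sum_distrib_left[symmetric])
  finally show ?thesis by simp
qed

lemma unitaries_isometry_norm:
  assumes V: "V \<in> unitaries n"
  shows "(\<Sum>k<n. (cmod (\<Sum>a<n. V k a * x a))\<^sup>2) = (\<Sum>a<n. (cmod (x a))\<^sup>2)"
proof -
  have "complex_of_real (\<Sum>k<n. (cmod (f k))\<^sup>2) = (\<Sum>k<n. cnj (f k) * f k)" for f
    by (simp only: of_real_sum complex_norm_square) (simp add: mult.commute)
  then have "complex_of_real (\<Sum>k<n. (cmod (\<Sum>a<n. V k a * x a))\<^sup>2) = complex_of_real (\<Sum>a<n. (cmod (x a))\<^sup>2)"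
    by (simp only: unitaries_isometry[OF V, of x x])
  then show ?thesis by (simp only: of_real_eq_iff)
qed

text \<open>Haar measure arises as the image, under Gram-Schmidt, of Lebesgue measure on all
  matrices conditioned on a set of nearly unitary ones. Measure, set and map are compatible with
  left multiplication by unitaries, so the image inherits invariance.\<close>

locale haar_construction =
  fixes n :: nat
  assumes n_pos: "0 < n"
begin

definition I :: "(nat \<times> nat) set" where "I = {..<n} \<times> {..<n}"

definition L :: "(nat \<times> nat \<Rightarrow> complex) measure" where "L = PiM I (\<lambda>_. lborel)"

lemma finite_I: "finite I" by (simp add: I_def)

sublocale product_sigma_finite "\<lambda>_::nat \<times> nat. lborel :: complex measure" ..

sublocale LS: sigma_finite_measure L
  unfolding L_def by (rule sigma_finite[OF finite_I])

sublocale LL: pair_sigma_finite L L ..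

lemma measurable_L_entry: "f \<in> N \<rightarrow>\<^sub>M L \<Longrightarrow> p \<in> I \<Longrightarrow> (\<lambda>x. f x p) \<in> borel_measurable N"
  unfolding L_def using measurable_compose[OF _ measurable_component_singleton[of p I "\<lambda>_. lborel"], of f N] by simp

lemma measurable_into_L: "(\<And>p. p \<in> I \<Longrightarrow> (\<lambda>x. f x p) \<in> borel_measurable N) \<Longrightarrow> (\<lambda>x. \<lambda>p\<in>I. f x p) \<in> N \<rightarrow>\<^sub>M L"
  unfolding L_def by (rule measurable_restrict) simp

lemma space_L: "space L = extensional I"
  by (auto simp: L_def space_PiM PiE_def)

definition add :: "(nat \<times> nat \<Rightarrow> complex) \<Rightarrow> (nat \<times> nat \<Rightarrow> complex) \<Rightarrow> nat \<times> nat \<Rightarrow> complex" where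
  "add H G = (\<lambda>p\<in>I. H p + G p)"

definition neg :: "(nat \<times> nat \<Rightarrow> complex) \<Rightarrow> nat \<times> nat \<Rightarrow> complex" where
  "neg G = (\<lambda>p\<in>I. - G p)"

definition lmul :: "cmat \<Rightarrow> (nat \<times> nat \<Rightarrow> complex) \<Rightarrow> nat \<times> nat \<Rightarrow> complex" where
  "lmul V G = (\<lambda>p\<in>I. \<Sum>a<n. V (fst p) a * G (a, snd p))"

lemma measurable_add: "f \<in> N \<rightarrow>\<^sub>M L \<Longrightarrow> g \<in> N \<rightarrow>\<^sub>M L \<Longrightarrow> (\<lambda>x. add (f x) (g x)) \<in> N \<rightarrow>\<^sub>M L"
  unfolding add_def by (intro measurable_into_L borel_measurable_add measurable_L_entry)

lemma measurable_neg: "f \<in> N \<rightarrow>\<^sub>M L \<Longrightarrow> (\<lambda>x. neg (f x)) \<in> N \<rightarrow>\<^sub>M L"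
  unfolding neg_def by (intro measurable_into_L borel_measurable_uminus measurable_L_entry)

lemma measurable_lmul: "f \<in> N \<rightarrow>\<^sub>M L \<Longrightarrow> (\<lambda>x. lmul V (f x)) \<in> N \<rightarrow>\<^sub>M L"
  unfolding lmul_def
  by (intro measurable_into_L borel_measurable_sum borel_measurable_times borel_measurable_const measurable_L_entry)
     (auto simp: I_def)

lemma add_space: "add H G \<in> space L" and neg_space: "neg G \<in> space L" and lmul_space: "lmul V G \<in> space L"
  by (auto simp: space_L add_def neg_def lmul_def)

lemma distr_add: "distr L L (add H) = L"
proof -
  have m: "add H \<in> L \<rightarrow>\<^sub>M L"
    unfolding add_def by (intro measurable_into_L borel_measurable_add borel_measurable_const measurable_L_entry[of "\<lambda>x. x"]) simp_all
  have "distr L L (add H) = PiM I (\<lambda>_. lborel)"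
  proof (rule PiM_eqI[OF finite_I])
    fix A :: "nat \<times> nat \<Rightarrow> complex set"
    assume A: "\<And>i. i \<in> I \<Longrightarrow> A i \<in> sets lborel"
    have "Pi\<^sub>E I A \<in> sets L" unfolding L_def using A finite_I by (intro sets_PiM_I_finite) auto
    then have "emeasure (distr L L (add H)) (Pi\<^sub>E I A) = emeasure L (add H -` (Pi\<^sub>E I A) \<inter> space L)"
      by (rule emeasure_distr[OF m])
    also have "add H -` (Pi\<^sub>E I A) \<inter> space L = Pi\<^sub>E I (\<lambda>i. (+) (H i) -` A i)"
      by (auto simp: space_L add_def PiE_def Pi_def)
    also have "emeasure L \<dots> = (\<Prod>i\<in>I. emeasure lborel ((+) (H i) -` A i))"
    proof -
      have "(+) (H i) -` A i \<in> sets lborel" if "i \<in> I" for i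
        using measurable_sets_borel[of "(+) (H i)" borel "A i"] A[OF that] by simp
      then show ?thesis unfolding L_def by (intro emeasure_PiM finite_I) auto
    qed
    also have "\<dots> = (\<Prod>i\<in>I. emeasure lborel (A i))"
    proof (rule prod.cong[OF refl])
      fix i assume i: "i \<in> I"
      have "emeasure lborel (A i) = emeasure (distr lborel borel ((+) (H i))) (A i)"
        by (simp add: lborel_distr_plus)
      also have "\<dots> = emeasure lborel ((+) (H i) -` A i)"
        using A[OF i] by (subst emeasure_distr) simp_all
      finally show "emeasure lborel ((+) (H i) -` A i) = emeasure lborel (A i)" ..
    qed
    finally show "emeasure (distr L L (add H)) (Pi\<^sub>E I A) = (\<Prod>i\<in>I. emeasure lborel (A i))" .
  qed (simp add: L_def)
  then show ?thesis by (simp add: L_def)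
qed

lemma nn_integral_add:
  assumes "f \<in> borel_measurable L"
  shows "(\<integral>\<^sup>+G. f (add H G) \<partial>L) = (\<integral>\<^sup>+G. f G \<partial>L)"
proof -
  have m: "add H \<in> L \<rightarrow>\<^sub>M L"
    unfolding add_def by (intro measurable_into_L borel_measurable_add borel_measurable_const measurable_L_entry[of "\<lambda>x. x"]) simp_all
  show ?thesis using nn_integral_distr[OF m, of f] assms by (simp add: distr_add)
qed

definition gram :: "(nat \<times> nat \<Rightarrow> complex) \<Rightarrow> nat \<Rightarrow> nat \<Rightarrow> complex" where
  "gram G i j = (\<Sum>k<n. cnj (G (k, i)) * G (k, j))"

text \<open>A neighbourhood of the unitary group that is invariant under left multiplication by unitaries and
  under negation, and on which Gram-Schmidt orthonormalisation does not degenerate.\<close>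

definition T :: "(nat \<times> nat \<Rightarrow> complex) set" where
  "T = {G \<in> space L. \<forall>i\<in>{..<n}. \<forall>j\<in>{..<n}. cmod (gram G i j - of_bool (i = j)) \<le> 1 / (2 * real n)}"

lemma T_bound: "G \<in> T \<Longrightarrow> i < n \<Longrightarrow> j < n \<Longrightarrow> cmod (gram G i j - of_bool (i = j)) \<le> 1 / (2 * real n)"
  by (simp add: T_def)

lemma lmul_apply: "i < n \<Longrightarrow> k < n \<Longrightarrow> lmul V G (i, k) = (\<Sum>a<n. V i a * G (a, k))"
  by (simp add: lmul_def I_def)

lemma gram_lmul:
  assumes "V \<in> unitaries n" "i < n" "j < n"
  shows "gram (lmul V G) i j = gram G i j"
proof -
  have "gram (lmul V G) i j = (\<Sum>k<n. cnj (\<Sum>a<n. V k a * G (a, i)) * (\<Sum>b<n. V k b * G (b, j)))"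
    unfolding gram_def using assms by (intro sum.cong) (auto simp: lmul_def I_def)
  then show ?thesis unfolding gram_def by (simp only: unitaries_isometry[OF assms(1), of "\<lambda>a. G (a, i)" "\<lambda>a. G (a, j)"])
qed

lemma lmul_T: "V \<in> unitaries n \<Longrightarrow> G \<in> space L \<Longrightarrow> lmul V G \<in> T \<longleftrightarrow> G \<in> T"
  unfolding T_def by (simp add: lmul_space gram_lmul)

lemma neg_T: "G \<in> space L \<Longrightarrow> neg G \<in> T \<longleftrightarrow> G \<in> T"
proof -
  have "gram (neg G) i j = gram G i j" if "i < n" "j < n" for i j
    unfolding gram_def using that by (intro sum.cong) (auto simp: neg_def I_def)
  then show "G \<in> space L \<Longrightarrow> ?thesis" unfolding T_def by (simp add: neg_space)
qed

lemma T_sets: "T \<in> sets L"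
proof -
  have "(\<lambda>G. cmod (gram G i j - of_bool (i = j))) \<in> borel_measurable L" if "i < n" "j < n" for i j
    unfolding gram_def
    by (intro measurable_cmod borel_measurable_diff borel_measurable_const borel_measurable_sum
        borel_measurable_times measurable_cnj measurable_L_entry[of "\<lambda>x. x"]) (use that in \<open>auto simp: I_def\<close>)
  then have S: "{G \<in> space L. cmod (gram G i j - of_bool (i = j)) \<le> 1 / (2 * real n)} \<in> sets L" if "i < n" "j < n" for i j
    using that by (intro borel_measurable_le borel_measurable_const) auto
  have ne: "{..<n} \<noteq> {}" using n_pos by auto
  have eq: "T = (\<Inter>i\<in>{..<n}. \<Inter>j\<in>{..<n}. {G \<in> space L. cmod (gram G i j - of_bool (i = j)) \<le> 1 / (2 * real n)})"
    unfolding T_def using n_pos by blast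
  show ?thesis
    unfolding eq by (rule sets.finite_INT[OF finite_lessThan ne], rule sets.finite_INT[OF finite_lessThan ne], rule S) simp_all
qed

lemma lmul_add: "lmul V (add H G) = add (lmul V H) (lmul V G)"
  unfolding lmul_def add_def
  by (auto simp: fun_eq_iff restrict_def I_def sum.distrib[symmetric] distrib_left intro!: sum.cong)

text \<open>Identifies the translation that shifts \<open>lmul V x\<close> by the negative of
  \<open>y\<close>. It rests on orthonormality of the rows of \<open>V\<close>, hence on
  \<open>unitaries_adj\<close>.\<close>

lemma lmul_neg_adj:
  assumes V: "V \<in> unitaries n"
  shows "lmul V (neg (lmul (adj V) y)) = neg y"
proof
  fix p
  show "lmul V (neg (lmul (adj V) y)) p = neg y p"
  proof (cases "p \<in> I")
    case True
    then obtain i j where p: "p = (i, j)" "i < n" "j < n" by (auto simp: I_def)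
    have "lmul V (neg (lmul (adj V) y)) p = (\<Sum>a<n. V i a * - (\<Sum>b<n. cnj (V b a) * y (b, j)))"
      using p by (simp add: lmul_def neg_def I_def adj_def)
    also have "\<dots> = - (\<Sum>a<n. \<Sum>b<n. V i a * cnj (V b a) * y (b, j))"
      by (simp add: sum_distrib_left mult.assoc sum_negf)
    also have "(\<Sum>a<n. \<Sum>b<n. V i a * cnj (V b a) * y (b, j)) = (\<Sum>b<n. (\<Sum>a<n. V i a * cnj (V b a)) * y (b, j))"
      by (subst sum.swap) (simp add: sum_distrib_right)
    also have "\<dots> = (\<Sum>b<n. if b = i then y (i, j) else 0)"
    proof (rule sum.cong[OF refl])
      fix b assume b: "b \<in> {..<n}"
      have "(\<Sum>a<n. V i a * cnj (V b a)) = of_bool (b = i)"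
        using unitaries_orthonormal[OF unitaries_adj[OF V], of b i] p b by (simp add: adj_def mult.commute)
      then show "(\<Sum>a<n. V i a * cnj (V b a)) * y (b, j) = (if b = i then y (i, j) else 0)" by simp
    qed
    finally have "lmul V (neg (lmul (adj V) y)) p = - y (i, j)" using p(2) by simp
    moreover have "neg y p = - y (i, j)" using p by (simp add: neg_def I_def)
    ultimately show ?thesis by (simp only:)
  qed (simp add: lmul_def neg_def)
qed

lemma L_T_finite: "emeasure L T < \<infinity>"
proof -
  have "T \<subseteq> Pi\<^sub>E I (\<lambda>_. ball 0 2)"
  proof
    fix G assume G: "G \<in> T"
    have "G (k, j) \<in> ball 0 2" if "k < n" "j < n" for k j
    proof -
      \<comment> \<open>The diagonal of the Gram matrix is the squared column norm, at most 2 on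
        \<open>T\<close>; hence every entry has modulus below 2.\<close>
      have g: "gram G j j = complex_of_real (\<Sum>k<n. (cmod (G (k, j)))\<^sup>2)"
        unfolding gram_def by (simp only: of_real_sum complex_norm_square) (simp add: mult.commute)
      have "cmod (gram G j j - 1) \<le> 1 / (2 * real n)" using T_bound[OF G that(2) that(2)] by simp
      also have "\<dots> \<le> 1" using n_pos by (simp add: field_simps)
      finally have "(\<Sum>k<n. (cmod (G (k, j)))\<^sup>2) \<le> 2"
      proof -
        assume *: "cmod (gram G j j - 1) \<le> 1"
        have "gram G j j - 1 = complex_of_real ((\<Sum>k<n. (cmod (G (k, j)))\<^sup>2) - 1)" by (simp add: g)
        then show ?thesis using * by (simp only: norm_of_real)
      qed
      moreover have "(cmod (G (k, j)))\<^sup>2 \<le> (\<Sum>k<n. (cmod (G (k, j)))\<^sup>2)"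
        using that by (intro member_le_sum) auto
      ultimately have "(cmod (G (k, j)))\<^sup>2 < 2\<^sup>2" by simp
      then show ?thesis by (simp only: mem_ball_0) (rule power2_less_imp_less, auto)
    qed
    then show "G \<in> Pi\<^sub>E I (\<lambda>_. ball 0 2)" using G by (auto simp: T_def space_L PiE_def I_def)
  qed
  then have "emeasure L T \<le> emeasure L (Pi\<^sub>E I (\<lambda>_. ball 0 2))"
    unfolding L_def using finite_I by (intro emeasure_mono sets_PiM_I_finite) auto
  also have "\<dots> = (\<Prod>i\<in>I. emeasure lborel (ball (0::complex) 2))"
    unfolding L_def by (intro emeasure_PiM finite_I) auto
  also have "\<dots> < \<infinity>"
    using emeasure_lborel_ball_finite[of "0::complex" 2] by (simp add: power_less_top_ennreal)
  finally show ?thesis .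
qed

lemma L_T_pos: "emeasure L T \<noteq> 0"
proof -
  \<comment> \<open>A box of this radius around the identity lies in \<open>T\<close>: its Gram
    matrices deviate from the identity by at most 2 r + n r^2 = 13 / (36 n), below the tolerance 1 /
    (2 n).\<close>
  define r where "r = 1 / (6 * real n)"
  have r: "0 < r" using n_pos by (simp add: r_def)
  let ?B = "Pi\<^sub>E I (\<lambda>p. ball (of_bool (fst p = snd p)) r) :: (nat \<times> nat \<Rightarrow> complex) set"
  have "?B \<subseteq> T"
  proof
    fix G assume G: "G \<in> ?B"
    define E where "E i j = G (i, j) - of_bool (i = j)" for i j
    have E: "cmod (E i j) \<le> r" if "i < n" "j < n" for i j
    proof -
      have "G (i, j) \<in> ball (of_bool (i = j)) r" using G that by (auto simp: PiE_def Pi_def I_def)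
      then show ?thesis by (simp add: E_def dist_norm norm_minus_commute)
    qed
    have "cmod (gram G i j - of_bool (i = j)) \<le> 1 / (2 * real n)" if ij: "i < n" "j < n" for i j
    proof -
      have "gram G i j = (\<Sum>k<n. cnj (of_bool (k = i) + E k i) * (of_bool (k = j) + E k j))"
        by (simp add: gram_def E_def)
      also have "\<dots> = (\<Sum>k<n. (if k = i then of_bool (i = j) + E i j else 0) + (if k = j then cnj (E j i) else 0) + cnj (E k i) * E k j)"
        by (intro sum.cong) (auto simp: algebra_simps)
      also have "\<dots> = of_bool (i = j) + E i j + cnj (E j i) + (\<Sum>k<n. cnj (E k i) * E k j)"
        using ij by (simp add: sum.distrib)
      finally have "cmod (gram G i j - of_bool (i = j)) = cmod (E i j + cnj (E j i) + (\<Sum>k<n. cnj (E k i) * E k j))"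
        by (simp add: add.assoc)
      also have "\<dots> \<le> cmod (E i j) + cmod (cnj (E j i)) + cmod (\<Sum>k<n. cnj (E k i) * E k j)"
        by (intro norm_triangle_le add_mono norm_triangle_ineq order_refl)
      also have "cmod (\<Sum>k<n. cnj (E k i) * E k j) \<le> (\<Sum>k<n. r * r)"
        using E ij r by (intro order_trans[OF norm_sum] sum_mono) (auto simp: norm_mult intro!: mult_mono)
      also have "cmod (E i j) + cmod (cnj (E j i)) + (\<Sum>k<n. r * r) \<le> r + r + real n * (r * r)"
        using E[OF ij] E[OF ij(2,1)] by simp
      also have "\<dots> \<le> 1 / (2 * real n)"
        using n_pos by (simp add: r_def field_simps)
      finally show ?thesis by simp
    qed
    then show "G \<in> T" using G by (auto simp: T_def space_L PiE_def)
  qed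
  then have "emeasure L ?B \<le> emeasure L T" by (intro emeasure_mono T_sets)
  moreover have "emeasure L ?B = (\<Prod>p\<in>I. emeasure lborel (ball (of_bool (fst p = snd p) :: complex) r))"
    unfolding L_def by (intro emeasure_PiM finite_I) auto
  moreover have "(\<Prod>p\<in>I. emeasure lborel (ball (of_bool (fst p = snd p) :: complex) r)) \<noteq> 0"
  proof -
    have "emeasure lborel (ball c r) \<noteq> 0" for c :: complex
      using content_ball_pos[OF r, of c] by (auto simp: measure_def)
    then show ?thesis by (simp add: prod_zero_iff[OF finite_I])
  qed
  ultimately show ?thesis by auto
qed

text \<open>Uniqueness of translation-invariant measures, via Fubini applied to
  \<^term>\<open>\<lambda>x y. indicator T (lmul V x) * g (add (lmul V x) y)\<close> with the symmetric invariant set \<^term>\<open>T\<close>.\<close>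

lemma nn_integral_lmul:
  assumes V: "V \<in> unitaries n" and g: "g \<in> borel_measurable L"
  shows "(\<integral>\<^sup>+x. g (lmul V x) \<partial>L) = (\<integral>\<^sup>+x. g x \<partial>L)"
proof -
  let ?f = "indicator T :: _ \<Rightarrow> ennreal"
  have f: "?f \<in> borel_measurable L" by (rule borel_measurable_indicator[OF T_sets])
  have idL: "(\<lambda>x. x) \<in> L \<rightarrow>\<^sub>M L" by simp
  note mf = measurable_compose[OF _ f] and mg = measurable_compose[OF _ g]
  have cst: "(\<lambda>x. c) \<in> N \<rightarrow>\<^sub>M L" if "c \<in> space L" for c and N :: "'z measure" using that by simp
  have fV: "?f (lmul V x) = ?f x" if "x \<in> space L" for x
    using lmul_T[OF V that] by (simp add: indicator_def)
  have "emeasure L T * (\<integral>\<^sup>+y. g y \<partial>L) = (\<integral>\<^sup>+x. ?f x * (\<integral>\<^sup>+y. g y \<partial>L) \<partial>L)"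
    by (simp add: nn_integral_multc f T_sets)
  also have "\<dots> = (\<integral>\<^sup>+x. (\<integral>\<^sup>+y. ?f (lmul V x) * g (add (lmul V x) y) \<partial>L) \<partial>L)"
  proof (rule nn_integral_cong)
    fix x assume x: "x \<in> space L"
    have "(\<lambda>y. g (add (lmul V x) y)) \<in> borel_measurable L"
      by (intro mg measurable_add idL cst lmul_space)
    then show "?f x * (\<integral>\<^sup>+y. g y \<partial>L) = (\<integral>\<^sup>+y. ?f (lmul V x) * g (add (lmul V x) y) \<partial>L)"
      using fV[OF x] by (simp add: nn_integral_cmult nn_integral_add[OF g])
  qed
  also have "\<dots> = (\<integral>\<^sup>+y. (\<integral>\<^sup>+x. ?f (lmul V x) * g (add (lmul V x) y) \<partial>L) \<partial>L)"
    by (rule LL.Fubini'[symmetric], unfold case_prod_beta)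
       (intro borel_measurable_times_ennreal mf mg measurable_add measurable_lmul measurable_fst measurable_snd)
  also have "\<dots> = (\<integral>\<^sup>+y. (\<integral>\<^sup>+x. ?f (add (neg y) (lmul V x)) * g (lmul V x) \<partial>L) \<partial>L)"
  proof (rule nn_integral_cong)
    \<comment> \<open>Translating x by the negative of V* y replaces V x by V x - y, which moves the
      shift from \<open>g\<close> into the indicator.\<close>
    fix y assume y: "y \<in> space L"
    let ?c = "neg (lmul (adj V) y)"
    have "(\<lambda>x. ?f (lmul V x) * g (add (lmul V x) y)) \<in> borel_measurable L"
      using y by (intro borel_measurable_times_ennreal mf mg measurable_add measurable_lmul idL cst)
    then have "(\<integral>\<^sup>+x. ?f (lmul V x) * g (add (lmul V x) y) \<partial>L) =
       (\<integral>\<^sup>+x. ?f (lmul V (add ?c x)) * g (add (lmul V (add ?c x)) y) \<partial>L)"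
      by (rule nn_integral_add[symmetric])
    also have "\<dots> = (\<integral>\<^sup>+x. ?f (add (neg y) (lmul V x)) * g (lmul V x) \<partial>L)"
    proof -
      have "add (add (neg y) (lmul V x)) y = lmul V x" for x
        by (auto simp: add_def neg_def lmul_def fun_eq_iff)
      then show ?thesis by (simp add: lmul_add lmul_neg_adj[OF V])
    qed
    finally show "(\<integral>\<^sup>+x. ?f (lmul V x) * g (add (lmul V x) y) \<partial>L) =
       (\<integral>\<^sup>+x. ?f (add (neg y) (lmul V x)) * g (lmul V x) \<partial>L)" .
  qed
  also have "\<dots> = (\<integral>\<^sup>+x. (\<integral>\<^sup>+y. ?f (add (neg y) (lmul V x)) * g (lmul V x) \<partial>L) \<partial>L)"
    by (rule LL.Fubini', unfold case_prod_beta)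
       (intro borel_measurable_times_ennreal mf mg measurable_add measurable_neg measurable_lmul measurable_fst measurable_snd)
  also have "\<dots> = (\<integral>\<^sup>+x. emeasure L T * g (lmul V x) \<partial>L)"
  proof (rule nn_integral_cong)
    fix x
    \<comment> \<open>By symmetry of \<open>T\<close> the indicator may be evaluated at the negative
      point, a translate of \<open>y\<close>; its integral over \<open>y\<close> is then the measure
      of \<open>T\<close>.\<close>
    have eq: "?f (add (neg y) (lmul V x)) = ?f (add (neg (lmul V x)) y)" for y
    proof -
      have "neg (add (neg y) (lmul V x)) = add (neg (lmul V x)) y"
        by (auto simp: add_def neg_def fun_eq_iff)
      then show ?thesis using neg_T[OF add_space, of "neg y" "lmul V x"] by (simp add: indicator_def)
    qed
    have "(\<lambda>y. ?f (add (neg (lmul V x)) y)) \<in> borel_measurable L"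
      by (intro mf measurable_add idL cst neg_space)
    then show "(\<integral>\<^sup>+y. ?f (add (neg y) (lmul V x)) * g (lmul V x) \<partial>L) = emeasure L T * g (lmul V x)"
      unfolding eq by (simp add: nn_integral_multc nn_integral_add[OF f] T_sets)
  qed
  also have "\<dots> = emeasure L T * (\<integral>\<^sup>+x. g (lmul V x) \<partial>L)"
    by (intro nn_integral_cmult mg measurable_lmul idL)
  \<comment> \<open>Cancellation in the extended reals uses that \<open>T\<close> has positive and
    finite measure.\<close>
  finally show ?thesis
    using L_T_pos L_T_finite by (auto simp: ennreal_mult_cancel_left)
qed

section \<open>Gram-Schmidt orthonormalisation as an equivariant map\<close>

definition residual :: "cmat \<Rightarrow> (nat \<times> nat \<Rightarrow> complex) \<Rightarrow> nat \<Rightarrow> nat \<Rightarrow> complex" where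
  "residual Q G k i = G (i, k) - (\<Sum>l<k. (\<Sum>j<n. cnj (Q j l) * G (j, k)) * Q i l)"

primrec gram_schmidt :: "(nat \<times> nat \<Rightarrow> complex) \<Rightarrow> nat \<Rightarrow> cmat" where
  "gram_schmidt G 0 = (\<lambda>i l. 0)"
| "gram_schmidt G (Suc k) = (\<lambda>i l. if l = k
     then residual (gram_schmidt G k) G k i / of_real (sqrt (\<Sum>j<n. (cmod (residual (gram_schmidt G k) G k j))\<^sup>2))
     else gram_schmidt G k i l)"

text \<open>Gram-Schmidt uses only inner products and linear combinations of columns; a unitary on
  the left preserves the former and commutes with the latter.\<close>

lemma gram_schmidt_lmul:
  assumes V: "V \<in> unitaries n"
  shows "k \<le> n \<Longrightarrow> i < n \<Longrightarrow> gram_schmidt (lmul V G) k i l = (\<Sum>a<n. V i a * gram_schmidt G k a l)"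
proof (induction k arbitrary: i l)
  case (Suc k)
  have kn: "k < n" "k \<le> n" using Suc.prems by auto
  let ?Q = "gram_schmidt G k" and ?Q' = "gram_schmidt (lmul V G) k"
  have res: "residual ?Q' (lmul V G) k i = (\<Sum>a<n. V i a * residual ?Q G k a)" if i: "i < n" for i
  proof -
    have ip: "(\<Sum>j<n. cnj (?Q' j l) * lmul V G (j, k)) = (\<Sum>j<n. cnj (?Q j l) * G (j, k))" for l
    proof -
      have "(\<Sum>j<n. cnj (?Q' j l) * lmul V G (j, k)) = (\<Sum>j<n. cnj (\<Sum>a<n. V j a * ?Q a l) * (\<Sum>b<n. V j b * G (b, k)))"
        using kn by (intro sum.cong refl) (simp add: lmul_apply Suc.IH)
      then show ?thesis by (simp only: unitaries_isometry[OF V, of "\<lambda>a. ?Q a l" "\<lambda>b. G (b, k)"])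
    qed
    define c where "c l = (\<Sum>j<n. cnj (?Q j l) * G (j, k))" for l
    have "residual ?Q' (lmul V G) k i = lmul V G (i, k) - (\<Sum>l<k. c l * ?Q' i l)"
      unfolding residual_def ip c_def ..
    also have "\<dots> = (\<Sum>a<n. V i a * G (a, k)) - (\<Sum>l<k. c l * (\<Sum>a<n. V i a * ?Q a l))"
      using kn i by (simp add: lmul_apply Suc.IH)
    also have "(\<Sum>l<k. c l * (\<Sum>a<n. V i a * ?Q a l)) = (\<Sum>a<n. V i a * (\<Sum>l<k. c l * ?Q a l))"
      by (simp add: sum_distrib_left mult.left_commute) (rule sum.swap)
    finally show ?thesis
      unfolding residual_def c_def by (simp add: right_diff_distrib sum_subtractf)
  qed
  have nrm: "(\<Sum>j<n. (cmod (residual ?Q' (lmul V G) k j))\<^sup>2) = (\<Sum>j<n. (cmod (residual ?Q G k j))\<^sup>2)"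
    using unitaries_isometry_norm[OF V, of "residual ?Q G k"] by (simp add: res)
  show ?case
  proof (cases "l = k")
    case True
    then show ?thesis using res[OF Suc.prems(2)] by (simp add: nrm sum_divide_distrib)
  next
    case False
    then show ?thesis using Suc by simp
  qed
qed simp

text \<open>By the tolerance 1 / (2 n) in \<open>T\<close>, the rows of Gram matrix minus identity
  have absolute sum at most 1/2. A linear dependency, read at its coefficient of largest modulus,
  gives |x j| <= |x j| / 2.\<close>

lemma T_independent:
  assumes G: "G \<in> T" and x0: "\<And>i. i < n \<Longrightarrow> (\<Sum>j<n. x j * G (i, j)) = 0" and "k < n"
  shows "x k = 0"
proof -
  obtain j where j: "j < n" "\<And>l. l < n \<Longrightarrow> cmod (x l) \<le> cmod (x j)"
  proof -
    have "Max ((\<lambda>j. cmod (x j)) ` {..<n}) \<in> (\<lambda>j. cmod (x j)) ` {..<n}"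
      using n_pos by (intro Max_in) auto
    then obtain j where "j < n" "Max ((\<lambda>j. cmod (x j)) ` {..<n}) = cmod (x j)" by auto
    moreover have "cmod (x l) \<le> Max ((\<lambda>j. cmod (x j)) ` {..<n})" if "l < n" for l
      using that by (intro Max_ge) auto
    ultimately show ?thesis using that[of j] by simp
  qed
  have "(\<Sum>l<n. x l * gram G j l) = (\<Sum>i<n. cnj (G (i, j)) * (\<Sum>l<n. x l * G (i, l)))"
    unfolding gram_def by (simp add: sum_distrib_left mult.left_commute) (rule sum.swap)
  also have "\<dots> = 0" using x0 by simp
  finally have "(\<Sum>l<n. x l * gram G j l) = 0" .
  moreover have "(\<Sum>l<n. x l * gram G j l) = (\<Sum>l<n. x l * (gram G j l - of_bool (j = l)) + (if l = j then x j else 0))"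
    by (intro sum.cong) (auto simp: algebra_simps)
  ultimately have "x j = - (\<Sum>l<n. x l * (gram G j l - of_bool (j = l)))"
    using j(1) by (simp add: sum.distrib add_eq_0_iff)
  then have "cmod (x j) \<le> (\<Sum>l<n. cmod (x l * (gram G j l - of_bool (j = l))))"
    using norm_sum[of "\<lambda>l. x l * (gram G j l - of_bool (j = l))" "{..<n}"] by simp
  also have "\<dots> \<le> (\<Sum>l<n. cmod (x j) * (1 / (2 * real n)))"
  proof (rule sum_mono)
    fix l assume "l \<in> {..<n}"
    then show "cmod (x l * (gram G j l - of_bool (j = l))) \<le> cmod (x j) * (1 / (2 * real n))"
      unfolding norm_mult by (intro mult_mono j(2) T_bound[OF G j(1)]) simp_all
  qed
  also have "\<dots> = cmod (x j) / 2" using n_pos by simp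
  finally have "cmod (x j) \<le> 0" by simp
  then show ?thesis using j(2)[OF assms(3)] by simp
qed

text \<open>The second conjunct, triangularity with respect to the columns of \<open>G\<close>,
  strengthens the induction: the residual is a combination of original columns, and their
  independence keeps the normalising denominator nonzero.\<close>

lemma gram_schmidt_orthonormal:
  assumes G: "G \<in> T"
  shows "k \<le> n \<Longrightarrow> (\<forall>l<k. \<forall>m<k. (\<Sum>i<n. cnj (gram_schmidt G k i l) * gram_schmidt G k i m) = of_bool (l = m)) \<and>
    (\<forall>l<k. \<exists>a. (\<forall>i<n. gram_schmidt G k i l = (\<Sum>j<n. a j * G (i, j))) \<and> (\<forall>j>l. a j = 0))"
proof (induction k)
  case (Suc k)
  define Q where "Q = gram_schmidt G k"
  define c where "c l = (\<Sum>j<n. cnj (Q j l) * G (j, k))" for l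
  define r where "r = residual Q G k"
  have r: "r i = G (i, k) - (\<Sum>l<k. c l * Q i l)" for i by (simp add: r_def residual_def c_def)
  have orth: "(\<Sum>i<n. cnj (Q i l) * Q i m) = of_bool (l = m)" if "l < k" "m < k" for l m
    using Suc that by (simp add: Q_def)
  have "\<forall>l. \<exists>a. l < k \<longrightarrow> (\<forall>i<n. Q i l = (\<Sum>j<n. a j * G (i, j))) \<and> (\<forall>j>l. a j = 0)"
    using Suc by (auto simp: Q_def)
  from choice[OF this] obtain a where "\<forall>l. l < k \<longrightarrow> (\<forall>i<n. Q i l = (\<Sum>j<n. a l j * G (i, j))) \<and> (\<forall>j>l. a l j = 0)" by blast
  then have a: "\<And>l i. l < k \<Longrightarrow> i < n \<Longrightarrow> Q i l = (\<Sum>j<n. a l j * G (i, j))" "\<And>l j. l < k \<Longrightarrow> l < j \<Longrightarrow> a l j = 0"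
    by blast+
  \<comment> \<open>Coefficients of the residual in the original columns. That of column
    \<open>k\<close> is 1, as the earlier columns do not involve it.\<close>
  define b where "b j = of_bool (j = k) - (\<Sum>l<k. c l * a l j)" for j
  have bk: "b k = 1" using a(2) by (simp add: b_def)
  have b0: "b j = 0" if "k < j" for j using a(2) that by (simp add: b_def)
  have rb: "r i = (\<Sum>j<n. b j * G (i, j))" if i: "i < n" for i
  proof -
    have "(\<Sum>l<k. c l * Q i l) = (\<Sum>l<k. \<Sum>j<n. c l * a l j * G (i, j))"
      using a(1) i by (simp add: sum_distrib_left mult.assoc)
    also have "\<dots> = (\<Sum>j<n. (\<Sum>l<k. c l * a l j) * G (i, j))"
      by (subst sum.swap) (simp add: sum_distrib_right)
    finally have A: "(\<Sum>l<k. c l * Q i l) = (\<Sum>j<n. (\<Sum>l<k. c l * a l j) * G (i, j))" .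
    have B: "(\<Sum>j<n. of_bool (j = k) * G (i, j)) = G (i, k)"
      using Suc.prems by (intro sum_of_bool_left) auto
    show ?thesis unfolding r b_def left_diff_distrib sum_subtractf A B ..
  qed
  define s where "s = (\<Sum>j<n. (cmod (r j))\<^sup>2)"
  have "s \<noteq> 0"
  proof
    assume "s = 0"
    then have "\<forall>j\<in>{..<n}. (cmod (r j))\<^sup>2 = 0" unfolding s_def by (subst (asm) sum_nonneg_eq_0_iff) auto
    then have "b k = 0" using T_independent[OF G, of b k] rb Suc.prems by auto
    then show False by (simp add: bk)
  qed
  then have s: "0 < s" using sum_nonneg[of "{..<n}" "\<lambda>j. (cmod (r j))\<^sup>2"] by (simp add: s_def less_le)
  have sq: "complex_of_real (sqrt s) * complex_of_real (sqrt s) = complex_of_real s"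
    using s by (simp flip: of_real_mult)
  have Suc_eq: "gram_schmidt G (Suc k) i l = (if l = k then r i / of_real (sqrt s) else Q i l)" for i l
    by (simp add: r_def Q_def s_def)
  have rr: "(\<Sum>i<n. cnj (r i) * r i) = complex_of_real s"
    unfolding s_def by (simp only: of_real_sum complex_norm_square) (simp add: mult.commute)
  have qr: "(\<Sum>i<n. cnj (Q i l) * r i) = 0" if "l < k" for l
  proof -
    have "(\<Sum>i<n. cnj (Q i l) * r i) = c l - (\<Sum>i<n. \<Sum>m<k. c m * (cnj (Q i l) * Q i m))"
      by (simp add: r c_def right_diff_distrib sum_subtractf sum_distrib_left mult.left_commute)
    also have "(\<Sum>i<n. \<Sum>m<k. c m * (cnj (Q i l) * Q i m)) = (\<Sum>m<k. c m * (\<Sum>i<n. cnj (Q i l) * Q i m))"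
      by (subst sum.swap) (simp add: sum_distrib_left)
    also have "\<dots> = (\<Sum>m<k. if m = l then c l else 0)" using that by (intro sum.cong) (auto simp: orth)
    finally show ?thesis using that by simp
  qed
  have rq: "(\<Sum>i<n. cnj (r i) * Q i l) = 0" if "l < k" for l
  proof -
    have "(\<Sum>i<n. cnj (r i) * Q i l) = cnj (\<Sum>i<n. cnj (Q i l) * r i)" by (simp add: mult.commute)
    then show ?thesis using qr[OF that] by simp
  qed
  have "(\<Sum>i<n. cnj (gram_schmidt G (Suc k) i l) * gram_schmidt G (Suc k) i m) = of_bool (l = m)" if "l < Suc k" "m < Suc k" for l m
  proof -
    have "l = k \<or> l < k" "m = k \<or> m < k" using that by auto
    then show ?thesis
    proof (elim disjE)
      assume 1: "l = k" "m = k"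
      have "(\<Sum>i<n. cnj (r i / of_real (sqrt s)) * (r i / of_real (sqrt s))) = (\<Sum>i<n. cnj (r i) * r i) / of_real s"
        by (simp add: sum_divide_distrib sq)
      then show ?thesis using 1 s unfolding Suc_eq by (simp add: rr)
    next
      assume 2: "l = k" "m < k"
      have "(\<Sum>i<n. cnj (r i / of_real (sqrt s)) * Q i m) = (\<Sum>i<n. cnj (r i) * Q i m) / of_real (sqrt s)"
        by (simp add: sum_divide_distrib)
      then show ?thesis using 2 unfolding Suc_eq by (simp add: rq)
    next
      assume 3: "l < k" "m = k"
      have "(\<Sum>i<n. cnj (Q i l) * (r i / of_real (sqrt s))) = (\<Sum>i<n. cnj (Q i l) * r i) / of_real (sqrt s)"
        by (simp add: sum_divide_distrib)
      then show ?thesis using 3 unfolding Suc_eq by (simp add: qr)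
    next
      assume 4: "l < k" "m < k"
      then show ?thesis unfolding Suc_eq by (simp add: orth)
    qed
  qed
  moreover have "\<exists>a. (\<forall>i<n. gram_schmidt G (Suc k) i l = (\<Sum>j<n. a j * G (i, j))) \<and> (\<forall>j>l. a j = 0)" if "l < Suc k" for l
  proof (cases "l = k")
    case True
    have "(\<forall>i<n. gram_schmidt G (Suc k) i l = (\<Sum>j<n. (b j / of_real (sqrt s)) * G (i, j))) \<and> (\<forall>j>l. b j / of_real (sqrt s) = 0)"
      unfolding Suc_eq using True rb b0 by (simp add: sum_divide_distrib)
    then show ?thesis by (intro exI[of _ "\<lambda>j. b j / of_real (sqrt s)"])
  next
    case False
    then show ?thesis unfolding Suc_eq using that a by (intro exI[of _ "a l"]) auto
  qed
  ultimately show ?case by blast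
qed simp

lemma measurable_gram_schmidt:
  "k \<le> n \<Longrightarrow> i < n \<Longrightarrow> l < n \<Longrightarrow> (\<lambda>G. gram_schmidt G k i l) \<in> borel_measurable L"
proof (induction k arbitrary: i l)
  case (Suc k)
  have res: "(\<lambda>G. residual (gram_schmidt G k) G k i) \<in> borel_measurable L" if "i < n" for i
    unfolding residual_def
    by (intro borel_measurable_diff borel_measurable_sum borel_measurable_times measurable_cnj
        measurable_L_entry[of "\<lambda>x. x"] Suc.IH) (use Suc.prems that in \<open>auto simp: I_def\<close>)
  show ?case
  proof (cases "l = k")
    case True
    then show ?thesis
      unfolding gram_schmidt.simps(2) using Suc.prems
      by (simp only: if_True simp_thms) (rule borel_measurable_divide[OF res measurable_compose[OF
        measurable_compose[OF borel_measurable_sum[OF borel_measurable_power[OF measurable_cmod[OF res]]] borel_measurable_sqrt] borel_measurable_of_real]]; simp)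
  next
    case False
    then show ?thesis using Suc by simp
  qed
qed simp

definition unitarize :: "(nat \<times> nat \<Rightarrow> complex) \<Rightarrow> cmat" where
  "unitarize G = (\<lambda>i j. if i < n \<and> j < n then gram_schmidt G n i j else 0)"

lemma measurable_unitarize: "unitarize \<in> L \<rightarrow>\<^sub>M borel"
proof (rule measurable_cmatI)
  fix i j
  show "(\<lambda>G. unitarize G i j) \<in> borel_measurable L"
  proof (cases "i < n \<and> j < n")
    case True
    then show ?thesis by (simp add: unitarize_def measurable_gram_schmidt)
  next
    case False
    then have "(\<lambda>G. unitarize G i j) = (\<lambda>G. 0)" by (auto simp: unitarize_def)
    then show ?thesis by simp
  qed
qed

lemma unitarize_lmul: "V \<in> unitaries n \<Longrightarrow> unitarize (lmul V G) = mmul n V (unitarize G)"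
  by (intro ext) (simp add: unitarize_def mmul_def gram_schmidt_lmul)

lemma unitarize_unitaries: "G \<in> T \<Longrightarrow> unitarize G \<in> unitaries n"
  using gram_schmidt_orthonormal[of G n] by (intro unitaries_I) (auto simp: unitarize_def supported_def)

lemma haar_exists:
  "\<exists>\<mu>. sets \<mu> = sets borel \<and> prob_space \<mu> \<and> emeasure \<mu> (unitaries n) = 1 \<and>
      (\<forall>V \<in> unitaries n. distr \<mu> borel (\<lambda>U. mmul n V U) = \<mu>)"
proof -
  define \<mu>0 where "\<mu>0 = uniform_measure L T"
  have s0: "sets \<mu>0 = sets L" by (simp add: \<mu>0_def)
  interpret \<mu>0: prob_space \<mu>0
    unfolding \<mu>0_def using L_T_finite by (intro prob_space_uniform_measure L_T_pos) simp
  have m: "unitarize \<in> \<mu>0 \<rightarrow>\<^sub>M borel" unfolding measurable_cong_sets[OF s0 refl] by (rule measurable_unitarize)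
  define \<mu> where "\<mu> = distr \<mu>0 borel unitarize"
  have em: "emeasure \<mu> A = emeasure L (T \<inter> (unitarize -` A \<inter> space L)) / emeasure L T" if "A \<in> sets borel" for A
  proof -
    have "emeasure \<mu> A = emeasure \<mu>0 (unitarize -` A \<inter> space L)"
      unfolding \<mu>_def using emeasure_distr[OF m that] by (simp add: \<mu>0_def)
    also have "\<dots> = emeasure L (T \<inter> (unitarize -` A \<inter> space L)) / emeasure L T"
      unfolding \<mu>0_def by (rule emeasure_uniform_measure[OF T_sets measurable_sets[OF measurable_unitarize that]])
    finally show ?thesis .
  qed
  have TT: "T \<inter> (unitarize -` unitaries n \<inter> space L) = T"
    using unitarize_unitaries by (auto simp: T_def)
  have "emeasure \<mu> (unitaries n) = emeasure L T / emeasure L T"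
    by (simp only: em[OF measurable_unitaries] TT)
  also have "\<dots> = 1" using L_T_pos L_T_finite by (intro ennreal_divide_self) auto
  finally have "emeasure \<mu> (unitaries n) = 1" .
  moreover have "distr \<mu> borel (\<lambda>U. mmul n V U) = \<mu>" if V: "V \<in> unitaries n" for V
  proof (rule measure_eqI)
    fix A assume "A \<in> sets (distr \<mu> borel (\<lambda>U. mmul n V U))"
    then have A: "A \<in> sets borel" by simp
    have mV: "(\<lambda>U. mmul n V U) \<in> borel_measurable borel" by (rule measurable_mmul) simp_all
    have smu: "sets \<mu> = sets borel" by (simp add: \<mu>_def)
    have A': "mmul n V -` A \<in> sets borel" using measurable_sets_borel[OF mV A] by simp
    have B: "T \<inter> (unitarize -` A \<inter> space L) \<in> sets L"
      by (intro sets.Int T_sets measurable_sets[OF measurable_unitarize A])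
    have mV': "(\<lambda>U. mmul n V U) \<in> \<mu> \<rightarrow>\<^sub>M borel" unfolding measurable_cong_sets[OF smu refl] by (rule mV)
    have "emeasure (distr \<mu> borel (\<lambda>U. mmul n V U)) A = emeasure \<mu> (mmul n V -` A)"
      using emeasure_distr[OF mV' A] by (simp add: \<mu>_def)
    also have "\<dots> = emeasure L (T \<inter> (unitarize -` mmul n V -` A \<inter> space L)) / emeasure L T"
      by (rule em[OF A'])
    \<comment> \<open>Equivariance of \<open>unitarize\<close> and invariance of \<open>T\<close>
      turn this into a preimage under \<open>lmul V\<close>, where invariance of Lebesgue measure
      applies.\<close>
    also have "T \<inter> (unitarize -` mmul n V -` A \<inter> space L) = lmul V -` (T \<inter> (unitarize -` A \<inter> space L)) \<inter> space L"
      using V by (auto simp: lmul_T unitarize_lmul lmul_space)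
    also have "emeasure L \<dots> = emeasure L (T \<inter> (unitarize -` A \<inter> space L))"
    proof -
      let ?B = "T \<inter> (unitarize -` A \<inter> space L)"
      have ml: "lmul V \<in> L \<rightarrow>\<^sub>M L" using measurable_lmul[of "\<lambda>x. x" L V] by simp
      have "emeasure L (lmul V -` ?B \<inter> space L) = (\<integral>\<^sup>+x. indicator (lmul V -` ?B \<inter> space L) x \<partial>L)"
        by (rule nn_integral_indicator[symmetric], rule measurable_sets[OF ml B])
      also have "\<dots> = (\<integral>\<^sup>+x. indicator ?B (lmul V x) \<partial>L)"
        by (intro nn_integral_cong) (auto simp: indicator_def)
      also have "\<dots> = (\<integral>\<^sup>+x. indicator ?B x \<partial>L)"
        by (rule nn_integral_lmul[OF V borel_measurable_indicator[OF B]])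
      also have "\<dots> = emeasure L ?B" by (rule nn_integral_indicator[OF B])
      finally show ?thesis .
    qed
    finally show "emeasure (distr \<mu> borel (\<lambda>U. mmul n V U)) A = emeasure \<mu> A" by (simp add: em[OF A])
  qed (simp add: \<mu>_def)
  moreover have "prob_space \<mu>" unfolding \<mu>_def by (rule \<mu>0.prob_space_distr[OF m])
  moreover have "sets \<mu> = sets borel" by (simp add: \<mu>_def)
  ultimately show ?thesis by blast
qed

end

text \<open>\<open>haar\<close> is a choice among all measures with the defining properties; the
  construction only supplies a witness, and all moments are computed from the properties.\<close>

lemma left_invariant_haar:
  assumes "0 < n"
  shows "left_invariant n (haar n)"
proof -
  interpret haar_construction n by standard fact
  have *: "sets (haar n) = sets borel \<and> prob_space (haar n) \<and> emeasure (haar n) (unitaries n) = 1 \<and>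
      (\<forall>V \<in> unitaries n. distr (haar n) borel (\<lambda>U. mmul n V U) = haar n)"
    unfolding haar_def by (rule someI_ex[OF haar_exists])
  then interpret prob_space "haar n" by simp
  have "AE U in haar n. U \<in> unitaries n"
    using * by (intro AE_prob_1) (auto simp: measure_def)
  then show ?thesis using * by (simp add: left_invariant_def unitary_ensemble_def)
qed

section \<open>Moment operator of a local Haar-random gate\<close>

text \<open>With \<open>eqF\<close>: the entries of the identity and of the swap of two copies, read
  only through the coordinate \<open>f\<close>. For \<open>f = id\<close> these are the full
  operators; for a coordinate of a gate they see only its support.\<close>

definition eqI :: "nat \<Rightarrow> (nat \<Rightarrow> nat) \<Rightarrow> nat \<Rightarrow> nat \<Rightarrow> bool" where
  "eqI D f p q \<longleftrightarrow> f (p div D) = f (q div D) \<and> f (p mod D) = f (q mod D)"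

definition eqF :: "nat \<Rightarrow> (nat \<Rightarrow> nat) \<Rightarrow> nat \<Rightarrow> nat \<Rightarrow> bool" where
  "eqF D f p q \<longleftrightarrow> f (p div D) = f (q mod D) \<and> f (p mod D) = f (q div D)"

definition kernel_trace :: "nat \<Rightarrow> (nat \<Rightarrow> nat \<Rightarrow> bool) \<Rightarrow> cmat \<Rightarrow> complex" where
  "kernel_trace D K X = (\<Sum>p<D * D. \<Sum>q<D * D. of_bool (K p q) * X p q)"

lemma div_mod_less: "p < D * D \<Longrightarrow> p div D < D \<and> p mod D < (D::nat)"
  by (metis less_mult_imp_div_less mod_less_divisor mult_0 neq0_conv not_less_zero)

text \<open>Contraction with identity or swap pairs each \<open>U\<close> with a conjugate
  \<open>U\<close>, and column orthonormality removes both.\<close>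

lemma kernel_trace_quad:
  assumes U: "U \<in> unitaries D" and "p' < D * D" "q' < D * D"
  shows "kernel_trace D (eqI D id) (\<lambda>p q. quad D U p q p' q') = of_bool (eqI D id p' q')"
    and "kernel_trace D (eqF D id) (\<lambda>p q. quad D U p q p' q') = of_bool (eqF D id p' q')"
proof -
  note lt = div_mod_less[OF assms(2)] div_mod_less[OF assms(3)]
  have "kernel_trace D (eqI D id) (\<lambda>p q. quad D U p q p' q') =
     (\<Sum>x1<D. \<Sum>x2<D. \<Sum>y1<D. \<Sum>y2<D. of_bool (x1 = y1 \<and> x2 = y2) *
       (U x1 (p' div D) * U x2 (p' mod D) * (cnj (U y1 (q' div D)) * cnj (U y2 (q' mod D)))))"
    unfolding kernel_trace_def sum_prod_index by (intro sum.cong refl) (simp add: eqI_def quad_def)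
  also have "\<dots> = (\<Sum>x1<D. \<Sum>x2<D. \<Sum>y1<D. \<Sum>y2<D. if y2 = x2 then (if y1 = x1 then
       U x1 (p' div D) * cnj (U x1 (q' div D)) * (U x2 (p' mod D) * cnj (U x2 (q' mod D))) else 0) else 0)"
    by (intro sum.cong refl) auto
  also have "\<dots> = (\<Sum>x1<D. U x1 (p' div D) * cnj (U x1 (q' div D))) * (\<Sum>x2<D. U x2 (p' mod D) * cnj (U x2 (q' mod D)))"
    by (simp add: sum_product)
  also have "\<dots> = of_bool (eqI D id p' q')"
    using lt by (simp add: unitaries_orthonormal[OF U] eqI_def)
  finally show "kernel_trace D (eqI D id) (\<lambda>p q. quad D U p q p' q') = of_bool (eqI D id p' q')" .
  have "kernel_trace D (eqF D id) (\<lambda>p q. quad D U p q p' q') =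
     (\<Sum>x1<D. \<Sum>x2<D. \<Sum>y1<D. \<Sum>y2<D. of_bool (x1 = y2 \<and> x2 = y1) *
       (U x1 (p' div D) * U x2 (p' mod D) * (cnj (U y1 (q' div D)) * cnj (U y2 (q' mod D)))))"
    unfolding kernel_trace_def sum_prod_index by (intro sum.cong refl) (simp add: eqF_def quad_def)
  also have "\<dots> = (\<Sum>x1<D. \<Sum>x2<D. \<Sum>y1<D. \<Sum>y2<D. if y2 = x1 then (if y1 = x2 then
       U x1 (p' div D) * cnj (U x1 (q' mod D)) * (U x2 (p' mod D) * cnj (U x2 (q' div D))) else 0) else 0)"
    by (intro sum.cong refl) auto
  also have "\<dots> = (\<Sum>x1<D. U x1 (p' div D) * cnj (U x1 (q' mod D))) * (\<Sum>x2<D. U x2 (p' mod D) * cnj (U x2 (q' div D)))"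
    by (simp add: sum_product)
  also have "\<dots> = of_bool (eqF D id p' q')"
    using lt by (simp add: unitaries_orthonormal[OF U] eqF_def)
  finally show "kernel_trace D (eqF D id) (\<lambda>p q. quad D U p q p' q') = of_bool (eqF D id p' q')" .
qed

text \<open>Valid for every ensemble. The Haar average depends on \<open>X\<close> only through
  these two traces, so it is insensitive to any circuit applied before it.\<close>

lemma kernel_trace_moment2:
  assumes ens: "unitary_ensemble D \<nu>" and K: "K = eqI D id \<or> K = eqF D id"
  shows "kernel_trace D K (moment2 D \<nu> X) = kernel_trace D K X"
proof -
  interpret prob_space \<nu> using ens by (simp add: unitary_ensemble_def)
  have AE: "AE U in \<nu>. U \<in> unitaries D" using ens by (simp add: unitary_ensemble_def)
  have s: "sets \<nu> = sets borel" using ens by (simp add: unitary_ensemble_def)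
  note [simp] = integrable_quad[OF ens]
  have q: "kernel_trace D K (\<lambda>p q. quad_int D \<nu> p q p' q') = of_bool (K p' q')" if "p' < D * D" "q' < D * D" for p' q'
  proof -
    have "kernel_trace D K (\<lambda>p q. quad_int D \<nu> p q p' q') = (LINT U|\<nu>. kernel_trace D K (\<lambda>p q. quad D U p q p' q'))"
      unfolding kernel_trace_def quad_int_def by simp
    also have "\<dots> = (LINT U|\<nu>. of_bool (K p' q'))"
    proof (rule integral_cong_AE)
      show "AE U in \<nu>. kernel_trace D K (\<lambda>p q. quad D U p q p' q') = of_bool (K p' q')"
        using AE by eventually_elim (use K kernel_trace_quad that in auto)
      show "(\<lambda>U. kernel_trace D K (\<lambda>p q. quad D U p q p' q')) \<in> borel_measurable \<nu>"
        unfolding kernel_trace_def measurable_cong_sets[OF s refl]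
        by (intro borel_measurable_sum borel_measurable_times borel_measurable_const measurable_quad0)
    qed simp
    finally show ?thesis by (simp add: prob_space)
  qed
  have "kernel_trace D K (moment2 D \<nu> X) =
     (\<Sum>p<D * D. \<Sum>q<D * D. \<Sum>p'<D * D. \<Sum>q'<D * D. of_bool (K p q) * quad_int D \<nu> p q p' q' * X p' q')"
    unfolding kernel_trace_def moment2_eq[OF ens] by (simp add: sum_distrib_left mult.assoc)
  also have "\<dots> = (\<Sum>p'<D * D. \<Sum>q'<D * D. \<Sum>p<D * D. \<Sum>q<D * D. of_bool (K p q) * quad_int D \<nu> p q p' q' * X p' q')"
  proof -
    let ?A = "{..<D * D}"
    have "(\<Sum>p\<in>?A. \<Sum>q\<in>?A. \<Sum>p'\<in>?A. \<Sum>q'\<in>?A. f p q p' q') = (\<Sum>p'\<in>?A. \<Sum>q'\<in>?A. \<Sum>p\<in>?A. \<Sum>q\<in>?A. f p q p' q')"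
      for f :: "nat \<Rightarrow> nat \<Rightarrow> nat \<Rightarrow> nat \<Rightarrow> complex"
    proof -
      have "(\<Sum>p\<in>?A. \<Sum>q\<in>?A. \<Sum>p'\<in>?A. \<Sum>q'\<in>?A. f p q p' q') = (\<Sum>p\<in>?A. \<Sum>p'\<in>?A. \<Sum>q\<in>?A. \<Sum>q'\<in>?A. f p q p' q')"
        by (rule sum.cong[OF refl], rule sum.swap)
      also have "\<dots> = (\<Sum>p'\<in>?A. \<Sum>p\<in>?A. \<Sum>q\<in>?A. \<Sum>q'\<in>?A. f p q p' q')" by (rule sum.swap)
      also have "\<dots> = (\<Sum>p'\<in>?A. \<Sum>p\<in>?A. \<Sum>q'\<in>?A. \<Sum>q\<in>?A. f p q p' q')"
        by (rule sum.cong[OF refl], rule sum.cong[OF refl], rule sum.swap)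
      also have "\<dots> = (\<Sum>p'\<in>?A. \<Sum>q'\<in>?A. \<Sum>p\<in>?A. \<Sum>q\<in>?A. f p q p' q')"
        by (rule sum.cong[OF refl], rule sum.swap)
      finally show ?thesis .
    qed
    then show ?thesis .
  qed
  also have "\<dots> = (\<Sum>p'<D * D. \<Sum>q'<D * D. kernel_trace D K (\<lambda>p q. quad_int D \<nu> p q p' q') * X p' q')"
    unfolding kernel_trace_def by (simp only: sum_distrib_right)
  also have "\<dots> = kernel_trace D K X"
    unfolding kernel_trace_def[of D K X] by (intro sum.cong refl) (simp add: q)
  finally show ?thesis .
qed

text \<open>A basis index \<open>x\<close> is split into its part \<open>s x\<close> in the support
  of the gate and its part \<open>c x\<close> in the complement. An abstract bijection treats all
  supports, contiguous or not, and the full group at once.\<close>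

locale gate_split =
  fixes D n m :: nat and s c :: "nat \<Rightarrow> nat" and \<mu> :: "cmat measure"
  assumes n2: "2 \<le> n" and bij: "bij_betw (\<lambda>x. (s x, c x)) {..<D} ({..<n} \<times> {..<m})"
    and inv: "left_invariant n \<mu>"
begin

definition emb :: "cmat \<Rightarrow> cmat" where
  "emb U = (\<lambda>x y. if x < D \<and> y < D \<and> c x = c y then U (s x) (s y) else 0)"

abbreviation "\<nu> \<equiv> distr \<mu> borel emb"

lemma s_less: "x < D \<Longrightarrow> s x < n" and c_less: "x < D \<Longrightarrow> c x < m"
  using bij by (auto simp: bij_betw_def)

lemma split_inj: "x < D \<Longrightarrow> y < D \<Longrightarrow> s x = s y \<Longrightarrow> c x = c y \<Longrightarrow> x = y"
  using bij by (auto simp: bij_betw_def inj_on_def)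

lemma sum_split: "(\<Sum>x<D. f (s x) (c x)) = (\<Sum>a<n. \<Sum>b<m. (f a b :: complex))"
  using sum.reindex_bij_betw[OF bij, of "\<lambda>(a, b). f a b"] by (simp add: sum.cartesian_product)

lemma emb_unitaries:
  assumes U: "U \<in> unitaries n"
  shows "emb U \<in> unitaries D"
proof (rule unitaries_I)
  fix i j assume ij: "i < D" "j < D"
  have "(\<Sum>k<D. cnj (emb U k i) * emb U k j) =
     (\<Sum>k<D. of_bool (c k = c i \<and> c k = c j) * (cnj (U (s k) (s i)) * U (s k) (s j)))"
    using ij by (intro sum.cong refl) (auto simp: emb_def)
  also have "\<dots> = (\<Sum>a<n. \<Sum>b<m. of_bool (b = c i \<and> b = c j) * (cnj (U a (s i)) * U a (s j)))"
    by (rule sum_split)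
  also have "\<dots> = (\<Sum>a<n. \<Sum>b<m. if b = c i then of_bool (c i = c j) * (cnj (U a (s i)) * U a (s j)) else 0)"
    by (intro sum.cong refl) auto
  also have "\<dots> = of_bool (c i = c j) * (\<Sum>a<n. U a (s j) * cnj (U a (s i)))"
    using c_less[OF ij(1)] by (simp add: sum_distrib_left mult.commute)
  also have "\<dots> = of_bool (c i = c j) * of_bool (s j = s i)"
    using ij by (simp add: unitaries_orthonormal[OF U] s_less)
  also have "\<dots> = of_bool (i = j)" using split_inj[OF ij] by auto
  finally show "(\<Sum>k<D. cnj (emb U k i) * emb U k j) = of_bool (i = j)" .
qed (auto simp: supported_def emb_def)

lemma measurable_emb: "emb \<in> borel_measurable borel"
proof (rule measurable_cmatI)
  fix x y
  show "(\<lambda>U. emb U x y) \<in> borel_measurable borel"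
    by (cases "x < D \<and> y < D \<and> c x = c y") (auto simp: emb_def measurable_cmat_entry)
qed

lemma ens: "unitary_ensemble n \<mu>" using inv by (simp add: left_invariant_def)

lemma measurable_emb': "emb \<in> \<mu> \<rightarrow>\<^sub>M borel"
proof -
  have "sets \<mu> = sets borel" using ens by (simp add: unitary_ensemble_def)
  from measurable_cong_sets[OF this refl] show ?thesis using measurable_emb by blast
qed

lemma unitary_ensemble_gate: "unitary_ensemble D \<nu>"
proof -
  interpret prob_space \<mu> using ens by (simp add: unitary_ensemble_def)
  have "AE U in \<mu>. U \<in> unitaries n" using ens by (simp add: unitary_ensemble_def)
  then have "AE U in \<mu>. emb U \<in> unitaries D" by eventually_elim (rule emb_unitaries)
  then have "AE U in \<nu>. U \<in> unitaries D"
    using AE_distr_iff[OF measurable_emb', of "\<lambda>U. U \<in> unitaries D"] by simp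
  then show ?thesis using prob_space_distr[OF measurable_emb'] by (simp add: unitary_ensemble_def)
qed

text \<open>Off its support the gate is the identity, which gives the indicator; on the support the
  Weingarten formula applies.\<close>

lemma quad_int_gate:
  assumes "p < D * D" "q < D * D" "p' < D * D" "q' < D * D"
  shows "quad_int D \<nu> p q p' q' = of_bool (eqI D c p p' \<and> eqI D c q q') *
    ((of_bool (eqI D s p q) * (of_bool (eqI D s p' q') - of_bool (eqF D s p' q') / of_nat n) +
      of_bool (eqF D s p q) * (of_bool (eqF D s p' q') - of_bool (eqI D s p' q') / of_nat n)) / (of_nat n ^ 2 - 1))"
proof -
  note lt = div_mod_less[OF assms(1)] div_mod_less[OF assms(2)] div_mod_less[OF assms(3)] div_mod_less[OF assms(4)]
  interpret w: left_invariant_measure n \<mu> "s (p' div D)" "s (p' mod D)" "s (q' div D)" "s (q' mod D)"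
    by standard (use lt s_less inv n2 in auto)
  have "quad_int D \<nu> p q p' q' = (LINT U|\<mu>. quad D (emb U) p q p' q')"
    unfolding quad_int_def by (rule integral_distr[OF measurable_emb' measurable_quad0])
  also have "\<dots> = (LINT U|\<mu>. of_bool (eqI D c p p' \<and> eqI D c q q') * (U (s (p div D)) (s (p' div D)) * U (s (p mod D)) (s (p' mod D)) *
       (cnj (U (s (q div D)) (s (q' div D))) * cnj (U (s (q mod D)) (s (q' mod D))))))"
    using lt by (intro Bochner_Integration.integral_cong refl) (auto simp: quad_def emb_def eqI_def)
  also have "\<dots> = of_bool (eqI D c p p' \<and> eqI D c q q') * moment4 \<mu> (s (p' div D)) (s (p' mod D)) (s (q' div D)) (s (q' mod D))
      (s (p div D)) (s (p mod D)) (s (q div D)) (s (q mod D))"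
    unfolding moment4_def by (rule integral_mult_right_zero)
  also have "\<dots> = of_bool (eqI D c p p' \<and> eqI D c q q') *
    ((of_bool (eqI D s p q) * (of_bool (eqI D s p' q') - of_bool (eqF D s p' q') / of_nat n) +
      of_bool (eqF D s p q) * (of_bool (eqF D s p' q') - of_bool (eqI D s p' q') / of_nat n)) / (of_nat n ^ 2 - 1))"
    using lt by (subst w.weingarten) (auto simp: s_less eqI_def eqF_def)
  finally show ?thesis .
qed

definition partial_trace :: "(nat \<Rightarrow> nat \<Rightarrow> bool) \<Rightarrow> cmat \<Rightarrow> nat \<Rightarrow> nat \<Rightarrow> nat \<Rightarrow> nat \<Rightarrow> complex" where
  "partial_trace K X a b a' b' = (\<Sum>p<D * D. \<Sum>q<D * D.
     of_bool (c (p div D) = a \<and> c (p mod D) = b \<and> c (q div D) = a' \<and> c (q mod D) = b') * (of_bool (K p q) * X p q))"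

definition coeffI :: "cmat \<Rightarrow> nat \<Rightarrow> nat \<Rightarrow> nat \<Rightarrow> nat \<Rightarrow> complex" where
  "coeffI X a b a' b' = (partial_trace (eqI D s) X a b a' b' - partial_trace (eqF D s) X a b a' b' / of_nat n) / (of_nat n ^ 2 - 1)"

definition coeffF :: "cmat \<Rightarrow> nat \<Rightarrow> nat \<Rightarrow> nat \<Rightarrow> nat \<Rightarrow> complex" where
  "coeffF X a b a' b' = (partial_trace (eqF D s) X a b a' b' - partial_trace (eqI D s) X a b a' b' / of_nat n) / (of_nat n ^ 2 - 1)"

text \<open>Averaging leaves identity and swap on the support, with operators on the complement as
  coefficients; these come from inverting the 2 by 2 Gram matrix of identity and swap.\<close>

lemma moment2_gate:
  assumes pq: "p < D * D" "q < D * D"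
  shows "moment2 D \<nu> X p q =
     of_bool (eqI D s p q) * coeffI X (c (p div D)) (c (p mod D)) (c (q div D)) (c (q mod D)) +
     of_bool (eqF D s p q) * coeffF X (c (p div D)) (c (p mod D)) (c (q div D)) (c (q mod D))"
proof -
  let ?k = "of_nat n ^ 2 - 1 :: complex" and ?P = "\<lambda>K. partial_trace K X (c (p div D)) (c (p mod D)) (c (q div D)) (c (q mod D))"
  let ?e = "\<lambda>p' q'. of_bool (eqI D c p p' \<and> eqI D c q q') :: complex"
  have P: "?P K = (\<Sum>p'<D * D. \<Sum>q'<D * D. ?e p' q' * (of_bool (K p' q') * X p' q'))" for K
    unfolding partial_trace_def by (intro sum.cong refl arg_cong2[where f="(*)"] arg_cong[where f=of_bool]) (auto simp: eqI_def)
  have "moment2 D \<nu> X p q = (\<Sum>p'<D * D. \<Sum>q'<D * D. quad_int D \<nu> p q p' q' * X p' q')"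
    using pq by (simp add: moment2_eq[OF unitary_ensemble_gate])
  also have "\<dots> = (\<Sum>p'<D * D. \<Sum>q'<D * D.
      of_bool (eqI D s p q) / ?k * (?e p' q' * (of_bool (eqI D s p' q') * X p' q')) - of_bool (eqI D s p q) / ?k / of_nat n * (?e p' q' * (of_bool (eqF D s p' q') * X p' q'))
      + (of_bool (eqF D s p q) / ?k * (?e p' q' * (of_bool (eqF D s p' q') * X p' q')) - of_bool (eqF D s p q) / ?k / of_nat n * (?e p' q' * (of_bool (eqI D s p' q') * X p' q'))))"
  proof (intro sum.cong refl)
    have alg: "e * ((A * (I - F / N) + B * (F - I / N)) / k) * x =
      A / k * (e * (I * x)) - A / k / N * (e * (F * x)) + (B / k * (e * (F * x)) - B / k / N * (e * (I * x)))" for e A I F N B k x :: complex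
      by (simp add: diff_divide_distrib add_divide_distrib algebra_simps)
    fix p' q' assume "p' \<in> {..<D * D}" "q' \<in> {..<D * D}"
    then show "quad_int D \<nu> p q p' q' * X p' q' = of_bool (eqI D s p q) / ?k * (?e p' q' * (of_bool (eqI D s p' q') * X p' q')) - of_bool (eqI D s p q) / ?k / of_nat n * (?e p' q' * (of_bool (eqF D s p' q') * X p' q'))
      + (of_bool (eqF D s p q) / ?k * (?e p' q' * (of_bool (eqF D s p' q') * X p' q')) - of_bool (eqF D s p q) / ?k / of_nat n * (?e p' q' * (of_bool (eqI D s p' q') * X p' q')))"
      unfolding lessThan_iff using quad_int_gate[OF pq] alg by (simp only:)
  qed
  also have "\<dots> = of_bool (eqI D s p q) / ?k * ?P (eqI D s) - of_bool (eqI D s p q) / ?k / of_nat n * ?P (eqF D s)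
      + (of_bool (eqF D s p q) / ?k * ?P (eqF D s) - of_bool (eqF D s p q) / ?k / of_nat n * ?P (eqI D s))"
    unfolding P by (simp only: sum.distrib sum_subtractf sum_distrib_left)
  also have "\<dots> = of_bool (eqI D s p q) * coeffI X (c (p div D)) (c (p mod D)) (c (q div D)) (c (q mod D)) +
     of_bool (eqF D s p q) * coeffF X (c (p div D)) (c (p mod D)) (c (q div D)) (c (q mod D))"
    unfolding coeffI_def coeffF_def by (simp add: diff_divide_distrib algebra_simps)
  finally show ?thesis .
qed

lemma fiber_sum:
  assumes "a < m" "b < m"
  shows "(\<Sum>p<D * D. of_bool (c (p div D) = a \<and> c (p mod D) = b) * f (s (p div D)) (s (p mod D))) =
     (\<Sum>i<n. \<Sum>j<n. f i j :: complex)"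
proof -
  have one: "(\<Sum>x<D. of_bool (c x = a) * g (s x)) = (\<Sum>i<n. g i)" if "a < m" for a and g :: "nat \<Rightarrow> complex"
  proof -
    have "(\<Sum>x<D. of_bool (c x = a) * g (s x)) = (\<Sum>i<n. \<Sum>b<m. of_bool (b = a) * g i)" by (rule sum_split)
    also have "\<dots> = (\<Sum>i<n. \<Sum>b<m. if b = a then g i else 0)" by (intro sum.cong refl) auto
    finally show ?thesis using that by simp
  qed
  have "(\<Sum>p<D * D. of_bool (c (p div D) = a \<and> c (p mod D) = b) * f (s (p div D)) (s (p mod D))) =
     (\<Sum>x<D. \<Sum>y<D. of_bool (c x = a) * (of_bool (c y = b) * f (s x) (s y)))"
    unfolding sum_prod_index by (intro sum.cong refl) auto
  also have "\<dots> = (\<Sum>x<D. of_bool (c x = a) * (\<Sum>j<n. f (s x) j))"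
    using one[OF assms(2)] by (simp only: sum_distrib_left[symmetric])
  also have "\<dots> = (\<Sum>i<n. \<Sum>j<n. f i j)" by (rule one[OF assms(1)])
  finally show ?thesis .
qed

text \<open>For a product operator the factor on the complement passes through, so the coefficients
  on the support become scalars.\<close>

lemma moment2_gate_tensor:
  assumes X: "\<And>p q. p < D * D \<Longrightarrow> q < D * D \<Longrightarrow> X p q =
      y (s (p div D)) (s (p mod D)) (s (q div D)) (s (q mod D)) * z (c (p div D)) (c (p mod D)) (c (q div D)) (c (q mod D))"
    and pq: "p < D * D" "q < D * D"
  shows "moment2 D \<nu> X p q = z (c (p div D)) (c (p mod D)) (c (q div D)) (c (q mod D)) *
     (of_bool (eqI D s p q) * (((\<Sum>i<n. \<Sum>j<n. y i j i j) - (\<Sum>i<n. \<Sum>j<n. y i j j i) / of_nat n) / (of_nat n ^ 2 - 1)) +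
      of_bool (eqF D s p q) * (((\<Sum>i<n. \<Sum>j<n. y i j j i) - (\<Sum>i<n. \<Sum>j<n. y i j i j) / of_nat n) / (of_nat n ^ 2 - 1)))"
proof -
  have pt: "partial_trace K X a b a' b' = z a b a' b' * (\<Sum>i<n. \<Sum>j<n. \<Sum>k<n. \<Sum>l<n. of_bool (k0 i j k l) * y i j k l)"
    if "a < m" "b < m" "a' < m" "b' < m" and K: "\<And>p q. K p q \<longleftrightarrow> k0 (s (p div D)) (s (p mod D)) (s (q div D)) (s (q mod D))"
    for K k0 a b a' b'
  proof -
    have "partial_trace K X a b a' b' = (\<Sum>p<D * D. \<Sum>q<D * D. z a b a' b' * (of_bool (c (p div D) = a \<and> c (p mod D) = b) *
       (of_bool (c (q div D) = a' \<and> c (q mod D) = b') * (of_bool (k0 (s (p div D)) (s (p mod D)) (s (q div D)) (s (q mod D))) *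
        y (s (p div D)) (s (p mod D)) (s (q div D)) (s (q mod D))))))"
      unfolding partial_trace_def by (intro sum.cong refl) (auto simp: X K)
    also have "\<dots> = z a b a' b' * (\<Sum>p<D * D. of_bool (c (p div D) = a \<and> c (p mod D) = b) * (\<Sum>q<D * D.
       of_bool (c (q div D) = a' \<and> c (q mod D) = b') * (of_bool (k0 (s (p div D)) (s (p mod D)) (s (q div D)) (s (q mod D))) *
        y (s (p div D)) (s (p mod D)) (s (q div D)) (s (q mod D)))))"
      by (simp only: sum_distrib_left)
    also have "\<dots> = z a b a' b' * (\<Sum>p<D * D. of_bool (c (p div D) = a \<and> c (p mod D) = b) *
       (\<Sum>k<n. \<Sum>l<n. of_bool (k0 (s (p div D)) (s (p mod D)) k l) * y (s (p div D)) (s (p mod D)) k l))"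
      by (subst fiber_sum[OF that(3,4)]) (rule refl)
    also have "\<dots> = z a b a' b' * (\<Sum>i<n. \<Sum>j<n. \<Sum>k<n. \<Sum>l<n. of_bool (k0 i j k l) * y i j k l)"
      by (subst fiber_sum[OF that(1,2)]) (rule refl)
    finally show ?thesis .
  qed
  have I: "(\<Sum>i<n. \<Sum>j<n. \<Sum>k<n. \<Sum>l<n. of_bool (i = k \<and> j = l) * y i j k l) = (\<Sum>i<n. \<Sum>j<n. y i j i j)"
  proof -
    have "(\<Sum>i<n. \<Sum>j<n. \<Sum>k<n. \<Sum>l<n. of_bool (i = k \<and> j = l) * y i j k l) =
      (\<Sum>i<n. \<Sum>j<n. \<Sum>k<n. \<Sum>l<n. if l = j then (if k = i then y i j i j else 0) else 0)"
      by (intro sum.cong refl) auto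
    then show ?thesis by simp
  qed
  have F: "(\<Sum>i<n. \<Sum>j<n. \<Sum>k<n. \<Sum>l<n. of_bool (i = l \<and> j = k) * y i j k l) = (\<Sum>i<n. \<Sum>j<n. y i j j i)"
  proof -
    have "(\<Sum>i<n. \<Sum>j<n. \<Sum>k<n. \<Sum>l<n. of_bool (i = l \<and> j = k) * y i j k l) =
      (\<Sum>i<n. \<Sum>j<n. \<Sum>k<n. \<Sum>l<n. if l = i then (if k = j then y i j j i else 0) else 0)"
      by (intro sum.cong refl) auto
    then show ?thesis by simp
  qed
  note lt = div_mod_less[OF pq(1)] div_mod_less[OF pq(2)]
  have cl: "c (p div D) < m" "c (p mod D) < m" "c (q div D) < m" "c (q mod D) < m" using lt c_less by auto
  have PI: "partial_trace (eqI D s) X (c (p div D)) (c (p mod D)) (c (q div D)) (c (q mod D)) =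
      z (c (p div D)) (c (p mod D)) (c (q div D)) (c (q mod D)) * (\<Sum>i<n. \<Sum>j<n. y i j i j)"
    using pt[OF cl, of "eqI D s" "\<lambda>i j k l. i = k \<and> j = l"] unfolding I eqI_def by blast
  have PF: "partial_trace (eqF D s) X (c (p div D)) (c (p mod D)) (c (q div D)) (c (q mod D)) =
      z (c (p div D)) (c (p mod D)) (c (q div D)) (c (q mod D)) * (\<Sum>i<n. \<Sum>j<n. y i j j i)"
    using pt[OF cl, of "eqF D s" "\<lambda>i j k l. i = l \<and> j = k"] unfolding F eqF_def by blast
  show ?thesis
    unfolding moment2_gate[OF pq] coeffI_def coeffF_def PI PF
    by (simp add: diff_divide_distrib algebra_simps)
qed

end

section \<open>Complete positivity and the diamond norm\<close>

lemma psd_supported: "psd n M \<Longrightarrow> supported n M"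
  unfolding psd_def by blast

lemma psd_qform: "psd n M \<Longrightarrow> 0 \<le> Re (qform n M x)"
  unfolding psd_iff by blast

lemma psd_add:
  assumes A: "psd n A" and B: "psd n B"
  shows "psd n (\<lambda>i j. A i j + B i j)"
  unfolding psd_iff
proof (intro conjI allI)
  show "supported n (\<lambda>i j. A i j + B i j)"
    using psd_supported[OF A] psd_supported[OF B] by (simp add: supported_def)
  show "A i j + B i j = cnj (A j i + B j i)" for i j
    using psd_hermitian[OF A, of i j] psd_hermitian[OF B, of i j] by (simp only: complex_cnj_add)
  have "qform n (\<lambda>i j. A i j + B i j) x = qform n A x + qform n B x" for x
    unfolding qform_def sum.distrib[symmetric] by (intro sum.cong refl) (simp add: algebra_simps)
  then show "0 \<le> Re (qform n (\<lambda>i j. A i j + B i j) x)" for x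
    using psd_qform[OF A, of x] psd_qform[OF B, of x] by simp
qed

lemma completely_positive_add:
  assumes "completely_positive m \<Phi>" "completely_positive m \<Psi>"
  shows "completely_positive m (\<lambda>X p q. \<Phi> X p q + \<Psi> X p q)"
  unfolding completely_positive_def
proof (intro allI impI)
  fix k Y assume "psd (m * k) Y"
  then have "psd (m * k) (\<lambda>p q. tensor_id m k \<Phi> Y p q + tensor_id m k \<Psi> Y p q)"
    using assms by (intro psd_add) (auto simp: completely_positive_def)
  moreover have "tensor_id m k (\<lambda>X p q. \<Phi> X p q + \<Psi> X p q) Y = (\<lambda>p q. tensor_id m k \<Phi> Y p q + tensor_id m k \<Psi> Y p q)"
    by (auto simp: tensor_id_def fun_eq_iff)
  ultimately show "psd (m * k) (tensor_id m k (\<lambda>X p q. \<Phi> X p q + \<Psi> X p q) Y)" by (simp only:)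
qed

lemma qform_prod_index:
  "qform (m * k) M x = (\<Sum>i<m. \<Sum>r<k. \<Sum>j<m. \<Sum>t<k. cnj (x (i * k + r)) * M (i * k + r) (j * k + t) * x (j * k + t))"
  unfolding qform_def sum_prod_index ..

text \<open>A measure-and-prepare map: since \<open>Q'\<close> is a Gram matrix, the functional sums
  values of the form of \<open>X\<close> at the rows of \<open>B\<close>, and \<open>Q\<close> is
  positive for the same reason. With an ancilla, the form of the output is a nonnegative combination
  of values of the form of \<open>Y\<close> at product vectors.\<close>

lemma completely_positive_rank_one:
  assumes Q: "\<And>i j. i < m \<Longrightarrow> j < m \<Longrightarrow> Q i j = (\<Sum>l<m. cnj (A l i) * A l j)"
    and Q': "\<And>i j. i < m \<Longrightarrow> j < m \<Longrightarrow> Q' i j = (\<Sum>l<m. cnj (B l i) * B l j)"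
    and t: "0 \<le> t"
  shows "completely_positive m (\<lambda>X p q. of_real t * (Q p q * (\<Sum>i<m. \<Sum>j<m. Q' i j * X i j)))" (is "completely_positive m ?\<Phi>")
  unfolding completely_positive_def
proof (intro allI impI)
  fix k Y assume Y: "psd (m * k) Y"
  \<comment> \<open>The operator left on the ancilla when the functional acts on the system
    alone.\<close>
  define Z where "Z r u = (\<Sum>i<m. \<Sum>j<m. Q' i j * Y (i * k + r) (j * k + u))" for r u
  have T: "tensor_id m k ?\<Phi> Y p q = (if p < m * k \<and> q < m * k then of_real t * (Q (p div k) (q div k) * Z (p mod k) (q mod k)) else 0)" for p q
    unfolding tensor_id_def Z_def by simp
  have hQ: "Q i j = cnj (Q j i)" if "i < m" "j < m" for i j
    using that by (simp add: Q mult.commute)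
  have hQ': "Q' i j = cnj (Q' j i)" if "i < m" "j < m" for i j
    using that by (simp add: Q' mult.commute)
  have hZ: "Z r u = cnj (Z u r)" for r u
  proof -
    have "cnj (Z u r) = (\<Sum>i<m. \<Sum>j<m. cnj (Q' i j) * cnj (Y (i * k + u) (j * k + r)))"
      by (simp add: Z_def)
    also have "\<dots> = (\<Sum>i<m. \<Sum>j<m. Q' j i * Y (j * k + r) (i * k + u))"
    proof (intro sum.cong refl)
      fix i j assume ij: "i \<in> {..<m}" "j \<in> {..<m}"
      have "cnj (Q' i j) = Q' j i" using hQ'[of j i] ij by simp
      moreover have "cnj (Y (i * k + u) (j * k + r)) = Y (j * k + r) (i * k + u)" by (rule psd_hermitian[OF Y, symmetric])
      ultimately show "cnj (Q' i j) * cnj (Y (i * k + u) (j * k + r)) = Q' j i * Y (j * k + r) (i * k + u)" by (simp only:)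
    qed
    also have "\<dots> = Z r u" unfolding Z_def by (rule sum.swap)
    finally show ?thesis by (rule sym)
  qed
  have zform: "(\<Sum>r<k. \<Sum>u<k. cnj (w r) * Z r u * w u) = (\<Sum>l<m. qform (m * k) Y (\<lambda>p. B l (p div k) * w (p mod k)))" for w
  proof -
    have "(\<Sum>l<m. qform (m * k) Y (\<lambda>p. B l (p div k) * w (p mod k))) =
      (\<Sum>l<m. \<Sum>i<m. \<Sum>r<k. \<Sum>j<m. \<Sum>u<k. (cnj (w r) * w u * Y (i * k + r) (j * k + u)) * (cnj (B l i) * B l j))"
      unfolding qform_prod_index by (intro sum.cong refl) (simp add: mult_ac)
    also have "\<dots> = (\<Sum>i<m. \<Sum>r<k. \<Sum>j<m. \<Sum>u<k. \<Sum>l<m. (cnj (w r) * w u * Y (i * k + r) (j * k + u)) * (cnj (B l i) * B l j))"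
      by (rule trans[OF sum.swap], rule sum.cong[OF refl], rule trans[OF sum.swap], rule sum.cong[OF refl],
          rule trans[OF sum.swap], rule sum.cong[OF refl], rule sum.swap)
    also have "\<dots> = (\<Sum>i<m. \<Sum>r<k. \<Sum>j<m. \<Sum>u<k. (cnj (w r) * w u * Y (i * k + r) (j * k + u)) * Q' i j)"
      by (intro sum.cong refl) (simp add: Q' sum_distrib_left)
    also have "\<dots> = (\<Sum>r<k. \<Sum>i<m. \<Sum>u<k. \<Sum>j<m. (cnj (w r) * w u * Y (i * k + r) (j * k + u)) * Q' i j)"
      by (rule trans[OF sum.swap], rule sum.cong[OF refl], rule sum.cong[OF refl], rule sum.swap)
    also have "\<dots> = (\<Sum>r<k. \<Sum>u<k. \<Sum>i<m. \<Sum>j<m. (cnj (w r) * w u * Y (i * k + r) (j * k + u)) * Q' i j)"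
      by (rule sum.cong[OF refl], rule sum.swap)
    also have "\<dots> = (\<Sum>r<k. \<Sum>u<k. cnj (w r) * Z r u * w u)"
      unfolding Z_def by (intro sum.cong refl) (simp add: sum_distrib_left sum_distrib_right mult_ac)
    finally show ?thesis by (rule sym)
  qed
  have tform: "qform (m * k) (tensor_id m k ?\<Phi> Y) x =
     of_real t * (\<Sum>l<m. \<Sum>r<k. \<Sum>u<k. cnj (\<Sum>j<m. A l j * x (j * k + r)) * Z r u * (\<Sum>j<m. A l j * x (j * k + u)))" for x
  proof -
    have "qform (m * k) (tensor_id m k ?\<Phi> Y) x = (\<Sum>i<m. \<Sum>r<k. \<Sum>j<m. \<Sum>u<k. \<Sum>l<m.
        of_real t * (cnj (A l i * x (i * k + r)) * Z r u * (A l j * x (j * k + u))))"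
      unfolding qform_prod_index
    proof (intro sum.cong refl)
      fix i r j u assume *: "i \<in> {..<m}" "r \<in> {..<k}" "j \<in> {..<m}" "u \<in> {..<k}"
      then have "i * k + r < m * k" "j * k + u < m * k" by (auto intro: mult_add_less)
      then have "tensor_id m k ?\<Phi> Y (i * k + r) (j * k + u) = of_real t * (Q i j * Z r u)"
        using * unfolding T by simp
      then show "cnj (x (i * k + r)) * tensor_id m k ?\<Phi> Y (i * k + r) (j * k + u) * x (j * k + u) =
        (\<Sum>l<m. of_real t * (cnj (A l i * x (i * k + r)) * Z r u * (A l j * x (j * k + u))))"
        using * by (simp add: Q sum_distrib_left sum_distrib_right mult_ac)
    qed
    also have "\<dots> = (\<Sum>l<m. \<Sum>i<m. \<Sum>r<k. \<Sum>j<m. \<Sum>u<k. of_real t * (cnj (A l i * x (i * k + r)) * Z r u * (A l j * x (j * k + u))))"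
      by (rule sym, rule trans[OF sum.swap], rule sum.cong[OF refl], rule trans[OF sum.swap], rule sum.cong[OF refl],
          rule trans[OF sum.swap], rule sum.cong[OF refl], rule sum.swap)
    also have "\<dots> = (\<Sum>l<m. \<Sum>r<k. \<Sum>u<k. \<Sum>i<m. \<Sum>j<m. of_real t * (cnj (A l i * x (i * k + r)) * Z r u * (A l j * x (j * k + u))))"
      by (rule sum.cong[OF refl], rule trans[OF sum.swap], rule sum.cong[OF refl],
          rule trans[OF sum.cong[OF refl sum.swap] sum.swap])
    also have "\<dots> = of_real t * (\<Sum>l<m. \<Sum>r<k. \<Sum>u<k. cnj (\<Sum>j<m. A l j * x (j * k + r)) * Z r u * (\<Sum>j<m. A l j * x (j * k + u)))"
      unfolding sum_distrib_left[of "of_real t"] cnj_sum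
      by (rule sum.cong[OF refl], rule sum.cong[OF refl], rule sum.cong[OF refl], rule trans[OF sum.swap])
         (simp only: sum_distrib_left sum_distrib_right)
    finally show ?thesis .
  qed
  show "psd (m * k) (tensor_id m k ?\<Phi> Y)"
    unfolding psd_iff
  proof (intro conjI allI)
    show "supported (m * k) (tensor_id m k ?\<Phi> Y)" by (auto simp: supported_def tensor_id_def)
    show "tensor_id m k ?\<Phi> Y i j = cnj (tensor_id m k ?\<Phi> Y j i)" for i j
    proof (cases "i < m * k \<and> j < m * k")
      case True
      then have a: "Q (i div k) (j div k) = cnj (Q (j div k) (i div k))" by (intro hQ) (auto simp: less_mult_imp_div_less)
      have b: "Z (i mod k) (j mod k) = cnj (Z (j mod k) (i mod k))" by (rule hZ)
      have "tensor_id m k ?\<Phi> Y i j = of_real t * (Q (i div k) (j div k) * Z (i mod k) (j mod k))"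
        "tensor_id m k ?\<Phi> Y j i = of_real t * (Q (j div k) (i div k) * Z (j mod k) (i mod k))"
        unfolding T using True by simp_all
      then show ?thesis by (simp only: a b complex_cnj_mult complex_cnj_complex_of_real)
    qed (auto simp: T)
    have nn: "0 \<le> Re (qform (m * k) Y v)" for v by (rule psd_qform[OF Y])
    show "0 \<le> Re (qform (m * k) (tensor_id m k ?\<Phi> Y) x)" for x
      unfolding tform zform using nn t by (simp add: sum_nonneg)
  qed
qed

text \<open>By Cauchy-Schwarz, entries bounded by \<open>b\<close> bound the form by n b times the
  squared norm, which the multiple of the identity compensates. This turns a Hermitian eigenvector
  into an admissible input for a positivity test.\<close>

lemma hermitian_add_identity_psd:
  assumes supp: "supported n M" and herm: "\<And>i j. M i j = cnj (M j i)" and bound: "\<And>i j. cmod (M i j) \<le> b"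
    and c: "real n * b \<le> c"
  shows "psd n (\<lambda>i j. of_real c * idm n i j + M i j)"
  unfolding psd_iff
proof (intro conjI allI)
  show "supported n (\<lambda>i j. of_real c * idm n i j + M i j)" using supp by (auto simp: supported_def idm_def)
  show "of_real c * idm n i j + M i j = cnj (of_real c * idm n j i + M j i)" for i j
  proof -
    have "M i j = cnj (M j i)" by (rule herm)
    then show ?thesis by (cases "i = j") (simp_all add: idm_def)
  qed
  fix x
  have b0: "0 \<le> b" using bound[of 0 0] norm_ge_zero order_trans by blast
  have "qform n (\<lambda>i j. of_real c * idm n i j + M i j) x = (\<Sum>i<n. \<Sum>j<n. (if j = i then of_real c * (x i * cnj (x i)) else 0) + cnj (x i) * M i j * x j)"
    unfolding qform_def by (intro sum.cong refl) (auto simp: idm_def algebra_simps)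
  also have "\<dots> = (\<Sum>i<n. of_real c * (x i * cnj (x i))) + qform n M x"
    unfolding qform_def by (simp add: sum.distrib)
  also have "(\<Sum>i<n. of_real c * (x i * cnj (x i))) = of_real (c * (\<Sum>i<n. (cmod (x i))\<^sup>2))"
    by (simp only: of_real_mult of_real_sum complex_norm_square sum_distrib_left)
  finally have eq: "Re (qform n (\<lambda>i j. of_real c * idm n i j + M i j) x) = c * (\<Sum>i<n. (cmod (x i))\<^sup>2) + Re (qform n M x)" by simp
  have "cmod (qform n M x) \<le> (\<Sum>i<n. \<Sum>j<n. b * (cmod (x i) * cmod (x j)))"
    unfolding qform_def
  proof (rule order_trans[OF norm_sum], rule sum_mono, rule order_trans[OF norm_sum], rule sum_mono)
    fix i j
    have "cmod (cnj (x i) * M i j * x j) = cmod (M i j) * (cmod (x i) * cmod (x j))" by (simp add: norm_mult)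
    also have "\<dots> \<le> b * (cmod (x i) * cmod (x j))" by (intro mult_right_mono bound) simp
    finally show "cmod (cnj (x i) * M i j * x j) \<le> b * (cmod (x i) * cmod (x j))" .
  qed
  also have "\<dots> = b * (\<Sum>i<n. 1 * cmod (x i))\<^sup>2"
    unfolding power2_eq_square sum_product by (simp only: sum_distrib_left mult_1)
  also have "\<dots> \<le> b * ((\<Sum>i<n. 1\<^sup>2) * (\<Sum>i<n. (cmod (x i))\<^sup>2))"
    by (intro mult_left_mono Cauchy_Schwarz_ineq_sum b0)
  also have "\<dots> = (real n * b) * (\<Sum>i<n. (cmod (x i))\<^sup>2)" by simp
  also have "\<dots> \<le> c * (\<Sum>i<n. (cmod (x i))\<^sup>2)" by (intro mult_right_mono c sum_nonneg) simp
  finally have "cmod (qform n M x) \<le> c * (\<Sum>i<n. (cmod (x i))\<^sup>2)" .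
  then show "0 \<le> Re (qform n (\<lambda>i j. of_real c * idm n i j + M i j) x)"
    unfolding eq using abs_Re_le_cmod[of "qform n M x"] by linarith
qed

lemma trace_norm_bound:
  assumes "\<And>i j. i < n \<Longrightarrow> j < n \<Longrightarrow> cmod (A i j) \<le> b" and b: "0 \<le> b"
  shows "trace_norm n A \<le> real n * real n * b"
proof (cases "n = 0")
  case True
  then have "(trace_norm n A)\<^sup>2 \<le> 0" using trace_norm_hs(3)[of n A] by simp
  then show ?thesis using True by simp
next
  case False
  have "hs_norm_sq n A \<le> (\<Sum>i<n. \<Sum>j<n. b\<^sup>2)"
    unfolding hs_norm_sq_def using assms by (intro sum_mono power_mono) auto
  then have "(trace_norm n A)\<^sup>2 \<le> real n * (real n * (real n * b\<^sup>2))"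
    using trace_norm_hs(3)[of n A] mult_left_mono[of "hs_norm_sq n A" "real n * (real n * b\<^sup>2)" "real n"] by simp
  also have "\<dots> \<le> (real n * real n * b)\<^sup>2"
  proof -
    have "1 * (real n * (real n * (real n * b\<^sup>2))) \<le> real n * (real n * (real n * (real n * b\<^sup>2)))"
      using False by (intro mult_right_mono) auto
    then show ?thesis by (simp add: power2_eq_square mult_ac)
  qed
  finally show ?thesis by (rule power2_le_imp_le) (simp add: b)
qed

lemma entry_le_trace_norm:
  assumes "i < n" "j < n"
  shows "cmod (A i j) \<le> trace_norm n A"
proof -
  have "(cmod (A i j))\<^sup>2 \<le> (\<Sum>j<n. (cmod (A i j))\<^sup>2)" using assms by (intro member_le_sum) auto
  also have "\<dots> \<le> hs_norm_sq n A" unfolding hs_norm_sq_def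
    using assms by (intro member_le_sum[where f="\<lambda>i. \<Sum>j<n. (cmod (A i j))\<^sup>2"] sum_nonneg) auto
  also have "\<dots> \<le> (trace_norm n A)\<^sup>2" by (rule trace_norm_hs)
  finally show ?thesis using trace_norm_hs(1) by (rule power2_le_imp_le)
qed

text \<open>The least upper bound in the diamond norm is only meaningful once boundedness is known.\<close>

lemma diamond_norm_bounds:
  assumes lin: "\<And>X p q b. (\<And>i j. i < m \<Longrightarrow> j < m \<Longrightarrow> cmod (X i j) \<le> b) \<Longrightarrow> 0 \<le> b \<Longrightarrow> cmod (\<Phi> X p q) \<le> B * b"
    and B: "0 \<le> B"
  shows "diamond_norm m \<Phi> \<le> real (m * m) * real (m * m) * B"
    and "trace_norm (m * m) Y \<le> 1 \<Longrightarrow> trace_norm (m * m) (tensor_id m m \<Phi> Y) \<le> diamond_norm m \<Phi>"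
proof -
  have bd: "trace_norm (m * m) (tensor_id m m \<Phi> Y) \<le> real (m * m) * real (m * m) * B" if Y: "trace_norm (m * m) Y \<le> 1" for Y
  proof (rule trace_norm_bound[OF _ B])
    fix p q assume pq: "p < m * m" "q < m * m"
    have mm: "p mod m < m" "q mod m < m" using div_mod_less[OF pq(1)] div_mod_less[OF pq(2)] by auto
    \<comment> \<open>Inputs of trace norm at most 1 have entries of modulus at most 1, so the
      entrywise bound on \<Phi> applies to each block.\<close>
    have "cmod (\<Phi> (\<lambda>i j. if i < m \<and> j < m then Y (i * m + p mod m) (j * m + q mod m) else 0) (p div m) (q div m)) \<le> B * 1"
    proof (rule lin)
      fix i j assume "i < m" "j < m"
      then have "cmod (Y (i * m + p mod m) (j * m + q mod m)) \<le> 1"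
        using entry_le_trace_norm[of "i * m + p mod m" "m * m" "j * m + q mod m" Y] mm Y mult_add_less[of i m "p mod m" m] mult_add_less[of j m "q mod m" m] by simp
      then show "cmod (if i < m \<and> j < m then Y (i * m + p mod m) (j * m + q mod m) else 0) \<le> 1" by simp
    qed simp
    then show "cmod (tensor_id m m \<Phi> Y p q) \<le> B" using pq by (simp add: tensor_id_def)
  qed
  let ?S = "{trace_norm (m * m) (tensor_id m m \<Phi> Y) | Y. trace_norm (m * m) Y \<le> 1}"
  have "trace_norm (m * m) (\<lambda>i j. 0) \<le> real (m * m) * real (m * m) * 0" by (rule trace_norm_bound) auto
  then have "trace_norm (m * m) (\<lambda>i j. 0) \<le> 1" by simp
  then have ne: "?S \<noteq> {}" by blast
  show "diamond_norm m \<Phi> \<le> real (m * m) * real (m * m) * B"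
    unfolding diamond_norm_def by (rule cSup_least[OF ne]) (use bd in blast)
  have "bdd_above ?S" by (rule bdd_aboveI[of _ "real (m * m) * real (m * m) * B"]) (use bd in blast)
  then show "trace_norm (m * m) Y \<le> 1 \<Longrightarrow> trace_norm (m * m) (tensor_id m m \<Phi> Y) \<le> diamond_norm m \<Phi>"
    unfolding diamond_norm_def by (intro cSup_upper) auto
qed

section \<open>The three gates of the circuits\<close>

text \<open>Identity and swap under one Boolean label, so that products of them over A, B, R can be
  handled through their labels.\<close>

definition sw :: "bool \<Rightarrow> nat \<Rightarrow> nat \<Rightarrow> nat \<Rightarrow> nat \<Rightarrow> bool" where
  "sw \<sigma> a b a' b' \<longleftrightarrow> (if \<sigma> then a = b' \<and> b = a' else a = a' \<and> b = b')"

lemma eqI_sw: "eqI D f p q \<longleftrightarrow> sw False (f (p div D)) (f (p mod D)) (f (q div D)) (f (q mod D))"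
  by (simp add: eqI_def sw_def)

lemma eqF_sw: "eqF D f p q \<longleftrightarrow> sw True (f (p div D)) (f (p mod D)) (f (q div D)) (f (q mod D))"
  by (simp add: eqF_def sw_def)

lemma sum_mod_div:
  fixes f g :: "nat \<Rightarrow> nat \<Rightarrow> complex"
  shows "(\<Sum>i<2 * K. \<Sum>j<2 * K. f (i mod 2) (j mod 2) * g (i div 2) (j div 2)) =
    (\<Sum>a<2. \<Sum>b<2. f a b) * (\<Sum>u<K. \<Sum>v<K. g u v)"
proof -
  have "(\<Sum>i<2 * K. \<Sum>j<2 * K. f (i mod 2) (j mod 2) * g (i div 2) (j div 2)) =
     (\<Sum>u<K. \<Sum>a<2. \<Sum>v<K. \<Sum>b<2. f a b * g u v)"
    unfolding mult.commute[of 2 K] sum_prod_index by (intro sum.cong refl) auto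
  also have "\<dots> = (\<Sum>u<K. \<Sum>v<K. \<Sum>a<2. \<Sum>b<2. f a b * g u v)"
    by (rule sum.cong[OF refl], rule sum.swap)
  also have "\<dots> = (\<Sum>u<K. \<Sum>v<K. (\<Sum>a<2. \<Sum>b<2. f a b) * g u v)"
    by (simp only: sum_distrib_right)
  finally show ?thesis by (simp only: sum_distrib_left)
qed

text \<open>The support is split into one qubit, its low bit, and a remainder of dimension
  \<open>K\<close>, and the traces factor. Every gate here has this form, with \<open>K\<close>
  equal to \<open>R\<close> or 2, and \<open>2 * R\<close> for the full group.\<close>

lemma (in gate_split) moment2_gate_pair:
  assumes n: "n = 2 * K"
    and X: "\<And>p q. p < D * D \<Longrightarrow> q < D * D \<Longrightarrow> X p q =
      f (s (p div D) mod 2) (s (p mod D) mod 2) (s (q div D) mod 2) (s (q mod D) mod 2) *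
      g (s (p div D) div 2) (s (p mod D) div 2) (s (q div D) div 2) (s (q mod D) div 2) *
      z (c (p div D)) (c (p mod D)) (c (q div D)) (c (q mod D))"
    and pq: "p < D * D" "q < D * D"
  shows "moment2 D \<nu> X p q = z (c (p div D)) (c (p mod D)) (c (q div D)) (c (q mod D)) *
     (of_bool (eqI D s p q) * (((\<Sum>a<2. \<Sum>b<2. f a b a b) * (\<Sum>u<K. \<Sum>v<K. g u v u v) -
          (\<Sum>a<2. \<Sum>b<2. f a b b a) * (\<Sum>u<K. \<Sum>v<K. g u v v u) / of_nat (2 * K)) / (of_nat (2 * K) ^ 2 - 1)) +
      of_bool (eqF D s p q) * (((\<Sum>a<2. \<Sum>b<2. f a b b a) * (\<Sum>u<K. \<Sum>v<K. g u v v u) -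
          (\<Sum>a<2. \<Sum>b<2. f a b a b) * (\<Sum>u<K. \<Sum>v<K. g u v u v) / of_nat (2 * K)) / (of_nat (2 * K) ^ 2 - 1)))"
proof -
  let ?y = "\<lambda>i j k l. f (i mod 2) (j mod 2) (k mod 2) (l mod 2) * g (i div 2) (j div 2) (k div 2) (l div 2)"
  have 1: "(\<Sum>i<n. \<Sum>j<n. ?y i j i j) = (\<Sum>a<2. \<Sum>b<2. f a b a b) * (\<Sum>u<K. \<Sum>v<K. g u v u v)"
    unfolding n by (rule sum_mod_div)
  have 2: "(\<Sum>i<n. \<Sum>j<n. ?y i j j i) = (\<Sum>a<2. \<Sum>b<2. f a b b a) * (\<Sum>u<K. \<Sum>v<K. g u v v u)"
    unfolding n by (rule sum_mod_div)
  show ?thesis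
    using moment2_gate_tensor[of X ?y z p q, OF X pq] unfolding 1 2 unfolding n .
qed

lemma bit_sum: "(\<Sum>k<m. y div 2 ^ k mod 2 * 2 ^ k) = y mod (2 ^ m :: nat)"
proof (induction m)
  case (Suc m)
  have "y mod 2 ^ Suc m = 2 ^ m * (y div 2 ^ m mod 2) + y mod 2 ^ m"
    using mod_mult2_eq[of y "2 ^ m" 2] by (simp add: mult.commute)
  then show ?case using Suc by simp
qed simp

lemma bits_eq_iff:
  assumes "x < 2 ^ m" "y < (2 ^ m :: nat)"
  shows "(\<forall>k<m. x div 2 ^ k mod 2 = y div 2 ^ k mod 2) \<longleftrightarrow> x = y"
proof
  assume *: "\<forall>k<m. x div 2 ^ k mod 2 = y div 2 ^ k mod 2"
  have "x = (\<Sum>k<m. x div 2 ^ k mod 2 * 2 ^ k)" using assms by (simp add: bit_sum)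
  also have "\<dots> = (\<Sum>k<m. y div 2 ^ k mod 2 * 2 ^ k)" using * by (intro sum.cong) auto
  also have "\<dots> = y" using assms by (simp add: bit_sum)
  finally show "x = y" .
qed simp

text \<open>A basis index \<open>x\<close> of the \<open>N\<close> qubits has the coordinates \<open>ca x\<close> (qubit 1), \<open>cb x\<close> (qubit 2) and
  \<open>cr x\<close> (qubits 3 to \<open>N\<close>).\<close>

definition ca :: "nat \<Rightarrow> nat" where "ca x = x mod 2"
definition cb :: "nat \<Rightarrow> nat" where "cb x = x div 2 mod 2"
definition cr :: "nat \<Rightarrow> nat" where "cr x = x div 4"
definition sBR :: "nat \<Rightarrow> nat" where "sBR x = x div 2"
definition sAB :: "nat \<Rightarrow> nat" where "sAB x = x mod 4"
definition sAR :: "nat \<Rightarrow> nat" where "sAR x = x mod 2 + 2 * (x div 4)"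

text \<open>In each support the first listed qubit is the low bit, the shape expected by
  \<open>moment2_gate_pair\<close>.\<close>

lemma split_coords:
  "sBR x mod 2 = cb x" "sBR x div 2 = cr x" "sAB x mod 2 = ca x" "sAB x div 2 = cb x" "sAR x mod 2 = ca x" "sAR x div 2 = cr x"
proof -
  have *: "x mod 4 = 2 * (x div 2 mod 2) + x mod 2" using mod_mult2_eq[of x 2 2] by simp
  show "sBR x mod 2 = cb x" by (simp add: sBR_def cb_def)
  show "sBR x div 2 = cr x" by (simp add: sBR_def cr_def div_mult2_eq[symmetric])
  show "sAB x mod 2 = ca x" unfolding sAB_def ca_def * by simp
  show "sAB x div 2 = cb x" unfolding sAB_def cb_def * by simp
  show "sAR x mod 2 = ca x" by (simp add: sAR_def ca_def)
  show "sAR x div 2 = cr x" by (simp add: sAR_def cr_def)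
qed

lemma sw_mod_div:
  "sw \<sigma> i j k l \<longleftrightarrow> sw \<sigma> (i mod 2) (j mod 2) (k mod 2) (l mod 2) \<and> sw \<sigma> (i div 2) (j div 2) (k div 2) (l div 2)"
proof -
  have e: "x = y \<longleftrightarrow> x mod 2 = y mod 2 \<and> x div 2 = y div 2" for x y :: nat by (metis mult_div_mod_eq)
  show ?thesis
  proof (cases \<sigma>)
    case True
    show ?thesis unfolding sw_def using True e[of i l] e[of j k] by (simp only: if_True) blast
  next
    case False
    show ?thesis unfolding sw_def using False e[of i k] e[of j l] by (simp only: if_False) blast
  qed
qed

locale qubits =
  fixes N :: nat
  assumes N3: "3 \<le> N"
begin

definition R :: nat where "R = 2 ^ (N - 2)"
definition D :: nat where "D = 2 ^ N"

lemma D_eq: "D = 4 * R"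
proof -
  have "N = (N - 2) + 2" using N3 by simp
  then have "(2::nat) ^ N = 2 ^ ((N - 2) + 2)" by (rule arg_cong)
  also have "\<dots> = 4 * 2 ^ (N - 2)" by (simp only: power_add) simp
  finally show ?thesis by (simp only: D_def R_def)
qed

lemma R2: "2 \<le> R"
proof -
  have "2 ^ 1 \<le> (2::nat) ^ (N - 2)" using N3 by (intro power_increasing) auto
  then show ?thesis by (simp add: R_def)
qed

lemma pow_N1: "2 ^ (N - Suc 0) = 2 * R"
proof -
  have "N - Suc 0 = Suc (N - 2)" using N3 by simp
  then show ?thesis by (simp add: R_def)
qed

sublocale BR: gate_split D "2 * R" 2 sBR ca "haar (2 * R)"
proof
  show "bij_betw (\<lambda>x. (sBR x, ca x)) {..<D} ({..<2 * R} \<times> {..<2})"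
    by (rule bij_betw_byWitness[where f'="\<lambda>(i, j). i * 2 + j"]) (auto simp: D_eq sBR_def ca_def)
qed (use R2 in \<open>auto intro: left_invariant_haar\<close>)

sublocale AB: gate_split D 4 R sAB cr "haar 4"
proof
  show "bij_betw (\<lambda>x. (sAB x, cr x)) {..<D} ({..<4} \<times> {..<R})"
    by (rule bij_betw_byWitness[where f'="\<lambda>(i, j). j * 4 + i"]) (auto simp: D_eq sAB_def cr_def)
qed (auto intro: left_invariant_haar)

sublocale AR: gate_split D "2 * R" 2 sAR cb "haar (2 * R)"
proof
  \<comment> \<open>The inverse reinserts the bit of B between that of A and those of R.\<close>
  have 1: "sAR x mod 2 + 2 * cb x + 4 * (sAR x div 2) = x" for x
    unfolding split_coords unfolding ca_def cb_def cr_def by presburger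
  have 2: "sAR (i mod 2 + 2 * j + 4 * (i div 2)) = i" "cb (i mod 2 + 2 * j + 4 * (i div 2)) = j" if "j < 2" for i j
  proof -
    have "j = 0 \<or> j = 1" using that by auto
    moreover obtain u where "i = 2 * u \<or> i = 2 * u + 1" by (metis oddE evenE)
    ultimately show "sAR (i mod 2 + 2 * j + 4 * (i div 2)) = i" "cb (i mod 2 + 2 * j + 4 * (i div 2)) = j"
      unfolding sAR_def cb_def by (elim disjE; simp; presburger?)+
  qed
  have 3: "sAR x < 2 * R" "cb x < 2" if "x < D" for x
  proof -
    have "x div 4 < R" "x mod 2 < 2" using that by (auto simp: D_eq)
    then show "sAR x < 2 * R" unfolding sAR_def by linarith
  qed (simp add: cb_def)
  have 4: "i mod 2 + 2 * j + 4 * (i div 2) < D" if "i < 2 * R" "j < 2" for i j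
  proof -
    have "i div 2 < R" "i mod 2 < 2" using that by auto
    then show ?thesis using that unfolding D_eq by linarith
  qed
  show "bij_betw (\<lambda>x. (sAR x, cb x)) {..<D} ({..<2 * R} \<times> {..<2})"
    by (rule bij_betw_byWitness[where f'="\<lambda>(i, j). i mod 2 + 2 * j + 4 * (i div 2)"]) (use 1 2 3 4 in auto)
qed (use R2 in \<open>auto intro: left_invariant_haar\<close>)

text \<open>The full group as a gate with trivial complement, so that the Haar moment operator is
  covered by the same formulas.\<close>

sublocale FU: gate_split D D 1 id "\<lambda>_. 0" "haar D"
proof
  show "bij_betw (\<lambda>x. (id x, 0)) {..<D} ({..<D} \<times> {..<1::nat})"
    by (rule bij_betw_byWitness[where f'=fst]) auto
  have "0 < D" by (simp add: D_def)
  then show "left_invariant D (haar D)" by (rule left_invariant_haar)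
  show "2 \<le> D" using R2 by (simp add: D_eq)
qed

lemma sub_index_BR: "x < D \<Longrightarrow> sub_index [2..<N + 1] x = sBR x"
proof -
  assume x: "x < D"
  have "sub_index [2..<N + 1] x = (\<Sum>k<N - 1. x div 2 div 2 ^ k mod 2 * 2 ^ k)"
    unfolding sub_index_def
  proof (rule sum.cong)
    fix k assume "k \<in> {..<N - 1}"
    then have "[2..<N + 1] ! k - 1 = k + 1" by (simp add: nth_upt del: upt_Suc)
    then show "bitof x ([2..<N + 1] ! k - 1) * 2 ^ k = x div 2 div 2 ^ k mod 2 * 2 ^ k"
      unfolding bitof_def by (simp add: div_mult2_eq[symmetric])
  qed (use N3 in \<open>simp del: upt_Suc\<close>)
  also have "\<dots> = sBR x"
    using x pow_N1 by (simp add: bit_sum sBR_def D_eq)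
  finally show ?thesis .
qed

lemma sub_index_AR: "x < D \<Longrightarrow> sub_index (1 # [3..<N + 1]) x = sAR x"
proof -
  assume x: "x < D"
  have len: "length (1 # [3..<N + 1]) = Suc (N - 2)" using N3 by simp
  have "sub_index (1 # [3..<N + 1]) x = x mod 2 + (\<Sum>k<N - 2. bitof x ((1 # [3..<N + 1]) ! Suc k - 1) * 2 ^ Suc k)"
    unfolding sub_index_def len sum.lessThan_Suc_shift by (simp add: bitof_def)
  also have "(\<Sum>k<N - 2. bitof x ((1 # [3..<N + 1]) ! Suc k - 1) * 2 ^ Suc k) = (\<Sum>k<N - 2. 2 * (x div 4 div 2 ^ k mod 2 * 2 ^ k))"
  proof (intro sum.cong refl)
    fix k assume "k \<in> {..<N - 2}"
    then have "(1 # [3..<N + 1]) ! Suc k - 1 = k + 2" by (simp add: nth_upt del: upt_Suc)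
    moreover have "x div 2 ^ (k + 2) = x div 4 div 2 ^ k" by (simp add: div_mult2_eq[symmetric] power_add mult.commute)
    ultimately show "bitof x ((1 # [3..<N + 1]) ! Suc k - 1) * 2 ^ Suc k = 2 * (x div 4 div 2 ^ k mod 2 * 2 ^ k)"
      unfolding bitof_def by simp
  qed
  also have "\<dots> = 2 * (x div 4)"
    unfolding sum_distrib_left[symmetric] bit_sum using x by (simp add: R_def[symmetric] D_eq)
  finally show ?thesis by (simp add: sAR_def)
qed

lemma sub_index_AB: "sub_index [1, 2] x = sAB x"
proof -
  have "sub_index [1, 2] x = x mod 2 + x div 2 mod 2 * 2"
    by (simp add: sub_index_def bitof_def lessThan_Suc numeral_2_eq_2)
  then show ?thesis using mod_mult2_eq[of x 2 2] by (simp add: sAB_def)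
qed

lemma embed_BR: "embed N [2..<N + 1] = BR.emb"
proof (intro ext)
  fix U x y
  have "{1..N} - set [2..<N + 1] = {1}" using N3 by auto
  then have "(\<forall>q\<in>{1..N} - set [2..<N + 1]. bitof x (q - 1) = bitof y (q - 1)) \<longleftrightarrow> ca x = ca y"
    by (simp add: bitof_def ca_def)
  then show "embed N [2..<N + 1] U x y = BR.emb U x y"
    unfolding embed_def BR.emb_def D_def[symmetric] using sub_index_BR by auto
qed

lemma embed_AR: "embed N (1 # [3..<N + 1]) = AR.emb"
proof (intro ext)
  fix U x y
  have "{1..N} - set (1 # [3..<N + 1]) = {2}" using N3 by auto
  then have "(\<forall>q\<in>{1..N} - set (1 # [3..<N + 1]). bitof x (q - 1) = bitof y (q - 1)) \<longleftrightarrow> cb x = cb y"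
    by (simp add: bitof_def cb_def)
  then show "embed N (1 # [3..<N + 1]) U x y = AR.emb U x y"
    unfolding embed_def AR.emb_def D_def[symmetric] using sub_index_AR by auto
qed

lemma embed_AB: "embed N [1, 2] = AB.emb"
proof (intro ext)
  fix U x y
  have "(\<forall>q\<in>{1..N} - set [1, 2]. bitof x (q - 1) = bitof y (q - 1)) \<longleftrightarrow> cr x = cr y" if xy: "x < D" "y < D"
  proof -
    have sh: "x div 2 ^ (k + 2) = x div 4 div 2 ^ k" for x k :: nat by (simp add: div_mult2_eq[symmetric] power_add mult.commute)
    have "(\<forall>q\<in>{1..N} - set [1, 2]. bitof x (q - 1) = bitof y (q - 1)) \<longleftrightarrow> (\<forall>k<N - 2. bitof x (k + 2) = bitof y (k + 2))"
    proof (intro iffI allI impI ballI)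
      fix k assume a: "\<forall>q\<in>{1..N} - set [1, 2]. bitof x (q - 1) = bitof y (q - 1)" and "k < N - 2"
      then have "k + 3 \<in> {1..N} - set [1, 2]" by auto
      from bspec[OF a this] show "bitof x (k + 2) = bitof y (k + 2)" by simp
    next
      fix q assume a: "\<forall>k<N - 2. bitof x (k + 2) = bitof y (k + 2)" and q: "q \<in> {1..N} - set [1, 2]"
      then have "q - 3 < N - 2" "q - 3 + 2 = q - 1" by auto
      then show "bitof x (q - 1) = bitof y (q - 1)" using a by metis
    qed
    also have "\<dots> \<longleftrightarrow> cr x = cr y"
      unfolding bitof_def sh cr_def using xy by (intro bits_eq_iff) (simp_all add: R_def[symmetric] D_eq)
    finally show ?thesis .
  qed
  then show "embed N [1, 2] U x y = AB.emb U x y"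
    unfolding embed_def AB.emb_def D_def[symmetric] sub_index_AB by auto
qed

lemma gate_BR: "gate N [2..<N + 1] = BR.\<nu>" and gate_AR: "gate N (1 # [3..<N + 1]) = AR.\<nu>" and gate_AB: "gate N [1, 2] = AB.\<nu>"
proof -
  have l: "length [2..<N + 1] = N - Suc 0" "length (1 # [3..<N + 1]) = N - Suc 0" "length [1::nat, 2] = 2" using N3 by simp_all
  show "gate N [2..<N + 1] = BR.\<nu>" unfolding gate_def l embed_BR pow_N1 ..
  show "gate N (1 # [3..<N + 1]) = AR.\<nu>" unfolding gate_def l embed_AR pow_N1 ..
  show "gate N [1, 2] = AB.\<nu>" unfolding gate_def l embed_AB by simp
qed

text \<open>\<open>FU.emb\<close> only clears entries outside the matrix, which the kernel at valid
  indices does not see.\<close>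

lemma moment2_full: "moment2 D (haar D) = moment2 D FU.\<nu>"
proof (intro ext)
  fix X p q
  have "quad_int D FU.\<nu> p q p' q' = quad_int D (haar D) p q p' q'" if "p < D * D" "q < D * D" "p' < D * D" "q' < D * D" for p' q'
  proof -
    have "quad_int D FU.\<nu> p q p' q' = (LINT U|haar D. quad D (FU.emb U) p q p' q')"
      unfolding quad_int_def by (rule integral_distr[OF FU.measurable_emb' measurable_quad0])
    also have "\<dots> = quad_int D (haar D) p q p' q'"
      unfolding quad_int_def using div_mod_less that by (intro Bochner_Integration.integral_cong refl) (simp add: quad_def FU.emb_def)
    finally show ?thesis .
  qed
  then show "moment2 D (haar D) X p q = moment2 D FU.\<nu> X p q"
    by (simp add: moment2_eq[OF FU.ens] moment2_eq[OF FU.unitary_ensemble_gate])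
qed

text \<open>The tensor product over \<open>A\<close>, \<open>B\<close>, \<open>R\<close> of identities (\<open>False\<close>) and swaps (\<open>True\<close>) of the two copies.\<close>

definition E :: "bool \<Rightarrow> bool \<Rightarrow> bool \<Rightarrow> cmat" where
  "E \<sigma> \<tau> \<rho> p q = of_bool (p < D * D \<and> q < D * D \<and>
     sw \<sigma> (ca (p div D)) (ca (p mod D)) (ca (q div D)) (ca (q mod D)) \<and>
     sw \<tau> (cb (p div D)) (cb (p mod D)) (cb (q div D)) (cb (q mod D)) \<and>
     sw \<rho> (cr (p div D)) (cr (p mod D)) (cr (q div D)) (cr (q mod D)))"

definition cnt :: "bool \<Rightarrow> nat \<Rightarrow> complex" where
  "cnt \<sigma> K = (if \<sigma> then of_nat K else of_nat K ^ 2)"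

lemma cnt_sums:
  "(\<Sum>a<K. \<Sum>b<K. of_bool (sw \<sigma> a b a b)) = cnt \<sigma> K"
  "(\<Sum>a<K. \<Sum>b<K. of_bool (sw \<sigma> a b b a)) = cnt (\<not> \<sigma>) K"
proof -
  have d: "(\<Sum>a<K. \<Sum>b<K. of_bool (a = b)) = (of_nat K :: complex)"
  proof -
    have "(\<Sum>a<K. \<Sum>b<K. of_bool (a = b)) = (\<Sum>a<K. \<Sum>b<K. if b = a then 1 else (0::complex))"
      by (intro sum.cong refl) auto
    then show ?thesis by simp
  qed
  have c: "(\<Sum>a<K. \<Sum>b<K. (1::complex)) = of_nat K ^ 2" by (simp add: power2_eq_square)
  show "(\<Sum>a<K. \<Sum>b<K. of_bool (sw \<sigma> a b a b)) = cnt \<sigma> K"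
    using d c by (cases \<sigma>) (simp_all add: sw_def cnt_def conj_commute eq_commute)
  show "(\<Sum>a<K. \<Sum>b<K. of_bool (sw \<sigma> a b b a)) = cnt (\<not> \<sigma>) K"
    using d c by (cases \<sigma>) (simp_all add: sw_def cnt_def conj_commute eq_commute)
qed

text \<open>The coefficient of the identity after averaging a product with label \<tau> on a qubit
  and \<rho> on a remainder of dimension \<open>K\<close>. Multiplication by the full swap negates
  both labels; hence the second term, and hence the full swap receives the coefficient with negated
  labels.\<close>

definition coef :: "nat \<Rightarrow> bool \<Rightarrow> bool \<Rightarrow> complex" where
  "coef K \<tau> \<rho> = (cnt \<tau> 2 * cnt \<rho> K - cnt (\<not> \<tau>) 2 * cnt (\<not> \<rho>) K / of_nat (2 * K)) / (of_nat (2 * K) ^ 2 - 1)"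

lemma BR_E: "moment2 D BR.\<nu> (E \<sigma> \<tau> \<rho>) = (\<lambda>p q. coef R \<tau> \<rho> * E \<sigma> False False p q + coef R (\<not> \<tau>) (\<not> \<rho>) * E \<sigma> True True p q)"
proof (intro ext)
  fix p q
  show "moment2 D BR.\<nu> (E \<sigma> \<tau> \<rho>) p q = coef R \<tau> \<rho> * E \<sigma> False False p q + coef R (\<not> \<tau>) (\<not> \<rho>) * E \<sigma> True True p q"
  proof (cases "p < D * D \<and> q < D * D")
    case True
    then have pq: "p < D * D" "q < D * D" by auto
    have "moment2 D BR.\<nu> (E \<sigma> \<tau> \<rho>) p q = of_bool (sw \<sigma> (ca (p div D)) (ca (p mod D)) (ca (q div D)) (ca (q mod D))) *
      (of_bool (eqI D sBR p q) * coef R \<tau> \<rho> + of_bool (eqF D sBR p q) * coef R (\<not> \<tau>) (\<not> \<rho>))"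
      by (rule trans[OF BR.moment2_gate_pair[OF refl _ pq, where f="\<lambda>a b a' b'. of_bool (sw \<tau> a b a' b')" and g="\<lambda>a b a' b'. of_bool (sw \<rho> a b a' b')"
            and z="\<lambda>a b a' b'. of_bool (sw \<sigma> a b a' b')"]])
         (simp add: E_def split_coords of_bool_conj mult_ac, simp only: cnt_sums coef_def not_not)
    then show ?thesis
      using True unfolding eqI_sw eqF_sw sw_mod_div[of _ "sBR _"] split_coords by (auto simp: E_def)
  qed (auto simp: moment2_eq[OF BR.unitary_ensemble_gate] E_def)
qed

lemma AB_E: "moment2 D AB.\<nu> (E \<sigma> \<tau> \<rho>) = (\<lambda>p q. coef 2 \<sigma> \<tau> * E False False \<rho> p q + coef 2 (\<not> \<sigma>) (\<not> \<tau>) * E True True \<rho> p q)"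
proof (intro ext)
  fix p q
  show "moment2 D AB.\<nu> (E \<sigma> \<tau> \<rho>) p q = coef 2 \<sigma> \<tau> * E False False \<rho> p q + coef 2 (\<not> \<sigma>) (\<not> \<tau>) * E True True \<rho> p q"
  proof (cases "p < D * D \<and> q < D * D")
    case True
    then have pq: "p < D * D" "q < D * D" by auto
    have "moment2 D AB.\<nu> (E \<sigma> \<tau> \<rho>) p q = of_bool (sw \<rho> (cr (p div D)) (cr (p mod D)) (cr (q div D)) (cr (q mod D))) *
      (of_bool (eqI D sAB p q) * coef 2 \<sigma> \<tau> + of_bool (eqF D sAB p q) * coef 2 (\<not> \<sigma>) (\<not> \<tau>))"
      by (rule trans[OF AB.moment2_gate_pair[OF _ _ pq, where K=2 and f="\<lambda>a b a' b'. of_bool (sw \<sigma> a b a' b')" and g="\<lambda>a b a' b'. of_bool (sw \<tau> a b a' b')"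
            and z="\<lambda>a b a' b'. of_bool (sw \<rho> a b a' b')"]])
         (simp, simp add: E_def split_coords of_bool_conj mult_ac, simp only: cnt_sums coef_def not_not)
    then show ?thesis
      using True unfolding eqI_sw eqF_sw sw_mod_div[of _ "sAB _"] split_coords by (auto simp: E_def)
  qed (auto simp: moment2_eq[OF AB.unitary_ensemble_gate] E_def)
qed

text \<open>The operator on A is left arbitrary because after the gate on B and R a general input
  has become identity or swap there, with any operator on A as coefficient.\<close>

lemma AR_tensor:
  fixes M :: "nat \<Rightarrow> nat \<Rightarrow> nat \<Rightarrow> nat \<Rightarrow> complex"
  assumes X: "\<And>p q. p < D * D \<Longrightarrow> q < D * D \<Longrightarrow> X p q = M (ca (p div D)) (ca (p mod D)) (ca (q div D)) (ca (q mod D)) *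
      of_bool (sw \<tau> (cb (p div D)) (cb (p mod D)) (cb (q div D)) (cb (q mod D)) \<and> sw \<rho> (cr (p div D)) (cr (p mod D)) (cr (q div D)) (cr (q mod D)))"
  shows "moment2 D AR.\<nu> X = (\<lambda>p q.
     ((\<Sum>a<2. \<Sum>b<2. M a b a b) * cnt \<rho> R - (\<Sum>a<2. \<Sum>b<2. M a b b a) * cnt (\<not> \<rho>) R / of_nat (2 * R)) / (of_nat (2 * R) ^ 2 - 1) * E False \<tau> False p q +
     ((\<Sum>a<2. \<Sum>b<2. M a b b a) * cnt (\<not> \<rho>) R - (\<Sum>a<2. \<Sum>b<2. M a b a b) * cnt \<rho> R / of_nat (2 * R)) / (of_nat (2 * R) ^ 2 - 1) * E True \<tau> True p q)"
    (is "_ = (\<lambda>p q. ?A * _ p q + ?B * _ p q)")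
proof (intro ext)
  fix p q
  show "moment2 D AR.\<nu> X p q = ?A * E False \<tau> False p q + ?B * E True \<tau> True p q"
  proof (cases "p < D * D \<and> q < D * D")
    case True
    then have pq: "p < D * D" "q < D * D" by auto
    have "moment2 D AR.\<nu> X p q = of_bool (sw \<tau> (cb (p div D)) (cb (p mod D)) (cb (q div D)) (cb (q mod D))) *
      (of_bool (eqI D sAR p q) * ?A + of_bool (eqF D sAR p q) * ?B)"
      by (rule trans[OF AR.moment2_gate_pair[OF refl _ pq, where f=M and g="\<lambda>a b a' b'. of_bool (sw \<rho> a b a' b')"
            and z="\<lambda>a b a' b'. of_bool (sw \<tau> a b a' b')"]])
         (simp add: X split_coords of_bool_conj mult_ac, simp only: cnt_sums)
    then show ?thesis
      using True unfolding eqI_sw eqF_sw sw_mod_div[of _ "sAR _"] split_coords by (auto simp: E_def)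
  qed (auto simp: moment2_eq[OF AR.unitary_ensemble_gate] E_def)
qed

lemma AR_E: "moment2 D AR.\<nu> (E \<sigma> \<tau> \<rho>) = (\<lambda>p q. coef R \<sigma> \<rho> * E False \<tau> False p q + coef R (\<not> \<sigma>) (\<not> \<rho>) * E True \<tau> True p q)"
  by (rule trans[OF AR_tensor[where M="\<lambda>a b a' b'. of_bool (sw \<sigma> a b a' b')" and \<tau>=\<tau> and \<rho>=\<rho>]])
     (simp add: E_def of_bool_conj mult_ac, simp only: cnt_sums coef_def not_not)

definition tr :: "bool \<Rightarrow> bool \<Rightarrow> bool \<Rightarrow> cmat \<Rightarrow> complex" where
  "tr \<sigma> \<tau> \<rho> X = (\<Sum>p<D * D. \<Sum>q<D * D. E \<sigma> \<tau> \<rho> p q * X p q)"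

text \<open>Tracing those coefficient operators on A against identity and swap recovers the overlaps
  of \<open>X\<close> with the four operators that are products over A and BR.\<close>

lemma BR_partial_trace:
  "(\<Sum>a<2. \<Sum>b<2. BR.partial_trace (eqI D sBR) X a b a b) = tr False False False X"
  "(\<Sum>a<2. \<Sum>b<2. BR.partial_trace (eqI D sBR) X a b b a) = tr True False False X"
  "(\<Sum>a<2. \<Sum>b<2. BR.partial_trace (eqF D sBR) X a b a b) = tr False True True X"
  "(\<Sum>a<2. \<Sum>b<2. BR.partial_trace (eqF D sBR) X a b b a) = tr True True True X"
proof -
  have ca2: "ca x = 0 \<or> ca x = 1" for x by (auto simp: ca_def)
  have gen: "(\<Sum>a<2. \<Sum>b<2. BR.partial_trace K X a b (if \<sigma> then b else a) (if \<sigma> then a else b)) =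
     (\<Sum>p<D * D. \<Sum>q<D * D. of_bool (sw \<sigma> (ca (p div D)) (ca (p mod D)) (ca (q div D)) (ca (q mod D)) \<and> K p q) * X p q)" for K \<sigma>
  proof -
    have "(\<Sum>a<2. \<Sum>b<2. BR.partial_trace K X a b (if \<sigma> then b else a) (if \<sigma> then a else b)) =
      (\<Sum>p<D * D. \<Sum>q<D * D. \<Sum>a<2. \<Sum>b<2. of_bool (ca (p div D) = a \<and> ca (p mod D) = b \<and> ca (q div D) = (if \<sigma> then b else a) \<and> ca (q mod D) = (if \<sigma> then a else b)) * (of_bool (K p q) * X p q))"
      unfolding BR.partial_trace_def by (simp only: numeral_2_eq_2 sum.lessThan_Suc lessThan_0 sum.empty add_0 sum.distrib)
    also have "\<dots> = (\<Sum>p<D * D. \<Sum>q<D * D. of_bool (sw \<sigma> (ca (p div D)) (ca (p mod D)) (ca (q div D)) (ca (q mod D)) \<and> K p q) * X p q)"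
    proof (intro sum.cong refl)
      fix p q
      show "(\<Sum>a<2. \<Sum>b<2. of_bool (ca (p div D) = a \<and> ca (p mod D) = b \<and> ca (q div D) = (if \<sigma> then b else a) \<and> ca (q mod D) = (if \<sigma> then a else b)) * (of_bool (K p q) * X p q)) =
        of_bool (sw \<sigma> (ca (p div D)) (ca (p mod D)) (ca (q div D)) (ca (q mod D)) \<and> K p q) * X p q"
        using ca2[of "p div D"] ca2[of "p mod D"] ca2[of "q div D"] ca2[of "q mod D"]
        by (elim disjE; cases \<sigma>) (simp_all add: numeral_2_eq_2 sw_def)
    qed
    finally show ?thesis .
  qed
  have fin: "(\<Sum>p<D * D. \<Sum>q<D * D. of_bool (sw \<sigma> (ca (p div D)) (ca (p mod D)) (ca (q div D)) (ca (q mod D)) \<and>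
      sw \<tau> (sBR (p div D)) (sBR (p mod D)) (sBR (q div D)) (sBR (q mod D))) * X p q) = tr \<sigma> \<tau> \<tau> X" for \<sigma> \<tau>
    unfolding tr_def by (intro sum.cong refl) (simp add: E_def sw_mod_div[of _ "sBR _"] split_coords)
  show "(\<Sum>a<2. \<Sum>b<2. BR.partial_trace (eqI D sBR) X a b a b) = tr False False False X"
    using gen[of "eqI D sBR" False] unfolding eqI_sw fin by simp
  show "(\<Sum>a<2. \<Sum>b<2. BR.partial_trace (eqI D sBR) X a b b a) = tr True False False X"
    using gen[of "eqI D sBR" True] unfolding eqI_sw fin by simp
  show "(\<Sum>a<2. \<Sum>b<2. BR.partial_trace (eqF D sBR) X a b a b) = tr False True True X"
    using gen[of "eqF D sBR" False] unfolding eqF_sw fin by simp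
  show "(\<Sum>a<2. \<Sum>b<2. BR.partial_trace (eqF D sBR) X a b b a) = tr True True True X"
    using gen[of "eqF D sBR" True] unfolding eqF_sw fin by simp
qed

end

section \<open>Spectrum of the two circuits\<close>

text \<open>\<open>al\<close> is the weight with which a remainder of dimension \<open>K\<close>
  follows the qubit, \<open>be\<close> the weight with which the qubit follows the remainder. At
  \<open>K = 2\<close> both are 2/5.\<close>

definition al :: "nat \<Rightarrow> real" where "al K = 3 * real K / (4 * real K ^ 2 - 1)"
definition be :: "nat \<Rightarrow> real" where "be K = (2 * real K ^ 2 - 2) / (4 * real K ^ 2 - 1)"

text \<open>Collects the coefficients of two successive gates and a final factor \<open>a\<close>.
  The variables \<open>t1\<close> to \<open>t4\<close> stand for the overlaps of the input with the
  four operators, in either of two orders.\<close>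

lemma gate_coefficient_algebra:
  fixes r k :: complex
  assumes "r \<noteq> 0" "k \<noteq> 0"
  shows "((t3 - t1 / (2 * r)) / k * r - (t2 - t4 / (2 * r)) / k * r ^ 2 / (2 * r)) / k * a =
     a * r / k / k * (t3 + t4 / (4 * r) - t1 / (2 * r) - t2 / 2)"
  using assms by (simp add: field_simps power2_eq_square)

context qubits
begin

lemma coef_values:
  assumes "1 \<le> K"
  shows "coef K False False = 1" "coef K True True = 0"
    "coef K False True = of_real (al K)" "coef K True False = of_real (be K)"
proof -
  define k where "k = complex_of_nat K"
  have k0: "k \<noteq> 0" using assms by (simp add: k_def)
  have "1 \<le> real K ^ 2" using assms by (intro one_le_power) simp
  then have "complex_of_real (4 * real K ^ 2 - 1) \<noteq> 0" by (simp only: of_real_eq_0_iff)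
  then have k1: "4 * k ^ 2 - 1 \<noteq> 0" by (simp add: k_def)
  have c: "coef K a b = (cnt a 2 * cnt b K - cnt (\<not> a) 2 * cnt (\<not> b) K / (2 * k)) / (4 * k ^ 2 - 1)" for a b
    unfolding coef_def k_def by (simp add: power_mult_distrib)
  show "coef K False False = 1" unfolding c cnt_def using k0 k1 by (simp add: k_def[symmetric] field_simps power2_eq_square)
  show "coef K True True = 0" unfolding c cnt_def using k0 by (simp add: k_def[symmetric] field_simps power2_eq_square)
  show "coef K False True = of_real (al K)" unfolding c cnt_def al_def using k0 by (simp add: k_def[symmetric] field_simps power2_eq_square)
  show "coef K True False = of_real (be K)" unfolding c cnt_def be_def using k0 by (simp add: k_def[symmetric] field_simps power2_eq_square)
qed

lemma R1: "1 \<le> R" "1 \<le> 2 * R" using R2 by auto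

lemma coef_2: "coef 2 False True = 2 / 5" "coef 2 True False = 2 / 5" "coef 2 False False = 1" "coef 2 True True = 0"
  using coef_values[of 2] by (simp_all add: al_def be_def)

lemmas coefs = coef_values[OF R1(1)] coef_2

abbreviation "E1 \<equiv> E False False False"
abbreviation "E2 \<equiv> E True True True"
abbreviation "E3 \<equiv> E False True True"
abbreviation "E4 \<equiv> E True False False"

lemma full_E: "moment2 D (haar D) (E \<sigma> \<tau> \<tau>) = (\<lambda>p q. coef (2 * R) \<sigma> \<tau> * E1 p q + coef (2 * R) (\<not> \<sigma>) (\<not> \<tau>) * E2 p q)"
proof (intro ext)
  fix p q
  have Es: "E \<sigma> \<tau> \<tau> p q = of_bool (sw \<sigma> (p div D mod 2) (p mod D mod 2) (q div D mod 2) (q mod D mod 2)) *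
     of_bool (sw \<tau> (p div D div 2) (p mod D div 2) (q div D div 2) (q mod D div 2))" if "p < D * D" "q < D * D" for \<sigma> \<tau> p q
  proof -
    have d: "x div 2 = sBR x" "x mod 2 = ca x" for x by (simp_all add: sBR_def ca_def)
    show ?thesis unfolding d unfolding sw_mod_div[of \<tau> "sBR _"] split_coords using that by (simp add: E_def of_bool_conj mult_ac)
  qed
  show "moment2 D (haar D) (E \<sigma> \<tau> \<tau>) p q = coef (2 * R) \<sigma> \<tau> * E1 p q + coef (2 * R) (\<not> \<sigma>) (\<not> \<tau>) * E2 p q"
  proof (cases "p < D * D \<and> q < D * D")
    case True
    then have pq: "p < D * D" "q < D * D" by auto
    have "moment2 D FU.\<nu> (E \<sigma> \<tau> \<tau>) p q = 1 * (of_bool (eqI D id p q) * coef (2 * R) \<sigma> \<tau> + of_bool (eqF D id p q) * coef (2 * R) (\<not> \<sigma>) (\<not> \<tau>))"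
      by (rule trans[OF FU.moment2_gate_pair[OF _ _ pq, where K="2 * R" and f="\<lambda>a b a' b'. of_bool (sw \<sigma> a b a' b')" and g="\<lambda>a b a' b'. of_bool (sw \<tau> a b a' b')"
            and z="\<lambda>a b a' b'. 1"]])
         (simp add: D_eq, simp add: Es, simp only: cnt_sums coef_def not_not)
    moreover have "of_bool (eqI D id p q) = E1 p q" "of_bool (eqF D id p q) = E2 p q"
      unfolding eqI_sw eqF_sw id_apply Es[OF pq] of_bool_conj[symmetric] sw_mod_div[symmetric] by (rule refl)+
    ultimately show ?thesis unfolding moment2_full by (simp add: mult.commute)
  qed (auto simp: moment2_eq[OF FU.ens] E_def)
qed

lemma full_formula:
  "moment2 D (haar D) X = (\<lambda>p q. (tr False False False X - tr True True True X / of_nat D) / (of_nat D ^ 2 - 1) * E1 p q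
     + (tr True True True X - tr False False False X / of_nat D) / (of_nat D ^ 2 - 1) * E2 p q)"
proof (intro ext)
  fix p q
  have Es: "of_bool (eqI D id p q) = E1 p q" "of_bool (eqF D id p q) = E2 p q" if "p < D * D" "q < D * D" for p q
  proof -
    have d: "x div 2 = sBR x" "x mod 2 = ca x" for x by (simp_all add: sBR_def ca_def)
    show "of_bool (eqI D id p q) = E1 p q"
      unfolding eqI_sw id_apply sw_mod_div[of False "p div D"] unfolding d unfolding sw_mod_div[of False "sBR _"] split_coords using that by (simp add: E_def)
    show "of_bool (eqF D id p q) = E2 p q"
      unfolding eqF_sw id_apply sw_mod_div[of True "p div D"] unfolding d unfolding sw_mod_div[of True "sBR _"] split_coords using that by (simp add: E_def)
  qed
  have pt: "FU.partial_trace (eqI D id) X 0 0 0 0 = tr False False False X" "FU.partial_trace (eqF D id) X 0 0 0 0 = tr True True True X"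
    unfolding FU.partial_trace_def tr_def by (intro sum.cong refl; simp add: Es)+
  show "moment2 D (haar D) X p q = (tr False False False X - tr True True True X / of_nat D) / (of_nat D ^ 2 - 1) * E1 p q
     + (tr True True True X - tr False False False X / of_nat D) / (of_nat D ^ 2 - 1) * E2 p q"
  proof (cases "p < D * D \<and> q < D * D")
    case True
    then have pq: "p < D * D" "q < D * D" by auto
    show ?thesis unfolding moment2_full FU.moment2_gate[OF pq] FU.coeffI_def FU.coeffF_def pt Es[OF pq] by (simp add: mult.commute)
  qed (auto simp: moment2_eq[OF FU.ens] E_def)
qed

lemma tr_kernel: "tr False False False X = kernel_trace D (eqI D id) X" "tr True True True X = kernel_trace D (eqF D id) X"
proof -
  have d: "x div 2 = sBR x" "x mod 2 = ca x" for x by (simp_all add: sBR_def ca_def)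
  show "tr False False False X = kernel_trace D (eqI D id) X"
    unfolding tr_def kernel_trace_def
  proof (intro sum.cong refl arg_cong2[where f="(*)"])
    fix p q assume "p \<in> {..<D * D}" "q \<in> {..<D * D}"
    then show "E1 p q = of_bool (eqI D id p q)"
      unfolding eqI_sw id_apply sw_mod_div[of False "p div D"] unfolding d unfolding sw_mod_div[of False "sBR _"] split_coords by (simp add: E_def)
  qed
  show "tr True True True X = kernel_trace D (eqF D id) X"
    unfolding tr_def kernel_trace_def
  proof (intro sum.cong refl arg_cong2[where f="(*)"])
    fix p q assume "p \<in> {..<D * D}" "q \<in> {..<D * D}"
    then show "E2 p q = of_bool (eqF D id p q)"
      unfolding eqF_sw id_apply sw_mod_div[of True "p div D"] unfolding d unfolding sw_mod_div[of True "sBR _"] split_coords by (simp add: E_def)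
  qed
qed

lemma full_absorbs:
  assumes "unitary_ensemble D \<nu>"
  shows "moment2 D (haar D) (moment2 D \<nu> X) = moment2 D (haar D) X"
  unfolding full_formula tr_kernel kernel_trace_moment2[OF assms disjI1[OF refl]] kernel_trace_moment2[OF assms disjI2[OF refl]] ..

section \<open>Eigenvectors of the two circuits\<close>

lemmas full_lin = moment2_linear[OF FU.ens]

text \<open>In the class of \<open>E3\<close> (for \<open>False\<close>) or \<open>E4\<close> (for
  \<open>True\<close>) modulo \<open>E1\<close> and \<open>E2\<close>, the representative killed by
  the Haar average. It makes eigenvectors of the quotient genuine eigenvectors.\<close>

definition E' :: "bool \<Rightarrow> cmat" where
  "E' \<sigma> p q = E \<sigma> (\<not> \<sigma>) (\<not> \<sigma>) p q - moment2 D (haar D) (E \<sigma> (\<not> \<sigma>) (\<not> \<sigma>)) p q"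

lemma full_fixed: "moment2 D (haar D) E1 = E1" "moment2 D (haar D) E2 = E2"
  unfolding full_E by (simp_all add: coef_values[OF R1(2)])

lemma full_E': "moment2 D (haar D) (E' \<sigma>) = (\<lambda>p q. 0)"
proof -
  have "E' \<sigma> = (\<lambda>p q. 1 * E \<sigma> (\<not> \<sigma>) (\<not> \<sigma>) p q + (- 1) * moment2 D (haar D) (E \<sigma> (\<not> \<sigma>) (\<not> \<sigma>)) p q)"
    by (simp add: E'_def fun_eq_iff)
  then show ?thesis by (simp only: full_lin full_absorbs[OF FU.ens]) simp
qed

text \<open>The values of \<open>x\<close> and \<open>y\<close> do not have to be related to
  \<open>l\<close> by hand: applying the Haar projection to \<open>eq\<close> shows that the
  remainder is 1 - l times the projection of the operator, exactly what the correction in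
  \<open>E'\<close> cancels.\<close>

lemma eigen:
  assumes ens: "unitary_ensemble D \<nu>" and fix1: "moment2 D \<nu> E1 = E1" and fix2: "moment2 D \<nu> E2 = E2"
    and eq: "moment2 D \<nu> (E \<sigma> (\<not> \<sigma>) (\<not> \<sigma>)) = (\<lambda>p q. l * E \<sigma> (\<not> \<sigma>) (\<not> \<sigma>) p q + 1 * (x * E1 p q + y * E2 p q))"
  shows "moment2 D \<nu> (E' \<sigma>) = (\<lambda>p q. l * E' \<sigma> p q)"
proof -
  let ?F = "E \<sigma> (\<not> \<sigma>) (\<not> \<sigma>)"
  note lin = moment2_linear[OF ens]
  obtain u v where h: "moment2 D (haar D) ?F = (\<lambda>p q. u * E1 p q + v * E2 p q)" using full_E by blast
  have "moment2 D (haar D) (moment2 D \<nu> ?F) = moment2 D (haar D) ?F" by (rule full_absorbs[OF ens])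
  then have "(\<lambda>p q. l * moment2 D (haar D) ?F p q + 1 * (x * E1 p q + y * E2 p q)) = moment2 D (haar D) ?F"
    unfolding eq full_lin full_fixed .
  then have w: "l * moment2 D (haar D) ?F p q + (x * E1 p q + y * E2 p q) = moment2 D (haar D) ?F p q" for p q
    by (simp add: fun_eq_iff)
  have "E' \<sigma> = (\<lambda>p q. 1 * ?F p q + (- 1) * (u * E1 p q + v * E2 p q))"
    by (simp add: E'_def fun_eq_iff h)
  then have "moment2 D \<nu> (E' \<sigma>) = (\<lambda>p q. 1 * (l * ?F p q + 1 * (x * E1 p q + y * E2 p q)) + (- 1) * (u * E1 p q + v * E2 p q))"
    by (simp only: lin eq fix1 fix2)
  also have "\<dots> = (\<lambda>p q. l * E' \<sigma> p q)"
  proof (intro ext)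
    fix p q
    show "1 * (l * ?F p q + 1 * (x * E1 p q + y * E2 p q)) + (- 1) * (u * E1 p q + v * E2 p q) = l * E' \<sigma> p q"
      using w[of p q] unfolding E'_def h by (simp add: algebra_simps)
  qed
  finally show ?thesis .
qed

lemma eigen_pow:
  assumes "moment2 D \<nu> (E' \<sigma>) = (\<lambda>p q. l * E' \<sigma> p q)" "unitary_ensemble D \<nu>"
  shows "(moment2 D \<nu> ^^ d) (E' \<sigma>) = (\<lambda>p q. l ^ d * E' \<sigma> p q)"
proof (induction d)
  case (Suc d)
  have "(\<lambda>p q. l ^ d * E' \<sigma> p q) = (\<lambda>p q. l ^ d * E' \<sigma> p q + 0 * E' \<sigma> p q)" by simp
  then have "moment2 D \<nu> (\<lambda>p q. l ^ d * E' \<sigma> p q) = (\<lambda>p q. l ^ Suc d * E' \<sigma> p q)"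
    by (simp only: moment2_linear[OF assms(2)] assms(1)) (simp add: mult_ac)
  then show ?case by (simp add: Suc)
qed simp

lemma circC_moment2:
  "unitary_ensemble D (circC N)"
  "moment2 D (circC N) X = moment2 D BR.\<nu> (moment2 D AB.\<nu> (moment2 D AR.\<nu> (moment2 D AB.\<nu> (moment2 D BR.\<nu> X))))"
  unfolding circC_def D_def[symmetric] gate_BR gate_AB gate_AR
  by (simp_all add: unitary_ensemble_prod BR.unitary_ensemble_gate AB.unitary_ensemble_gate AR.unitary_ensemble_gate)

lemma circC'_moment2:
  "unitary_ensemble D (circC' N)"
  "moment2 D (circC' N) X = moment2 D BR.\<nu> (moment2 D AR.\<nu> (moment2 D BR.\<nu> X))"
  unfolding circC'_def D_def[symmetric] gate_BR gate_AR
  by (simp_all add: unitary_ensemble_prod BR.unitary_ensemble_gate AR.unitary_ensemble_gate)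

lemmas gate_lin = moment2_linear[OF BR.unitary_ensemble_gate] moment2_linear[OF AR.unitary_ensemble_gate] moment2_linear[OF AB.unitary_ensemble_gate]

lemma gate_fixed:
  "moment2 D BR.\<nu> (E \<sigma> \<tau> \<tau>) = E \<sigma> \<tau> \<tau>"
  "moment2 D AR.\<nu> (E \<tau> \<sigma> \<tau>) = E \<tau> \<sigma> \<tau>"
  "moment2 D AB.\<nu> (E \<tau> \<tau> \<sigma>) = E \<tau> \<tau> \<sigma>"
  by (cases \<tau>; simp add: BR_E AR_E AB_E coefs)+

text \<open>One slow direction suffices for a lower bound. On A, B, R the path is I F F, I I F, F I
  F, I I F, I F F, with factors 2/5, \<open>be R\<close>, 2/5, \<open>be R\<close>; every branch
  that leaves it ends in \<open>E1\<close> or \<open>E2\<close>.\<close>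

lemma circC_eigen: "moment2 D (circC N) (E' False) = (\<lambda>p q. of_real (4 / 25 * be R ^ 2) * E' False p q)"
proof (rule eigen[OF circC_moment2(1)])
  show "moment2 D (circC N) E1 = E1" "moment2 D (circC N) E2 = E2"
    by (simp_all only: circC_moment2(2) gate_fixed)
  let ?a = "complex_of_real (al R)" and ?b = "complex_of_real (be R)"
  have AB1: "moment2 D AB.\<nu> E3 = (\<lambda>p q. 2 / 5 * E False False True p q + 2 / 5 * E2 p q)"
    and AB2: "moment2 D AB.\<nu> (E True False True) = (\<lambda>p q. 2 / 5 * E False False True p q + 2 / 5 * E2 p q)"
    by (simp_all add: AB_E coefs)
  have AR1: "moment2 D AR.\<nu> (E False False True) = (\<lambda>p q. ?a * E1 p q + ?b * E True False True p q)"
    by (simp add: AR_E coefs)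
  have BR1: "moment2 D BR.\<nu> (E False False True) = (\<lambda>p q. ?a * E1 p q + ?b * E3 p q)"
    by (simp add: BR_E coefs)
  show "moment2 D (circC N) (E False (\<not> False) (\<not> False)) = (\<lambda>p q. of_real (4 / 25 * be R ^ 2) * E False (\<not> False) (\<not> False) p q +
      1 * ((2 / 5 * ?a + 4 / 25 * ?b * ?a) * E1 p q + (2 / 5 + 4 / 25 * ?b) * E2 p q))"
    unfolding circC_moment2(2) not_False_eq_True gate_fixed AB1 gate_lin AR1 AB2 BR1
    by (simp add: fun_eq_iff algebra_simps power2_eq_square)
qed

text \<open>An upper bound needs both directions. The paths are I F F, I F I, I F F and F I I, F I
  F, F I I, with factor \<open>al R\<close> at each step.\<close>

lemma circC'_eigen: "moment2 D (circC' N) (E' \<sigma>) = (\<lambda>p q. of_real (al R ^ 2) * E' \<sigma> p q)"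
proof (cases \<sigma>)
  let ?a = "complex_of_real (al R)" and ?b = "complex_of_real (be R)"
  have fx: "moment2 D (circC' N) E1 = E1" "moment2 D (circC' N) E2 = E2"
    by (simp_all only: circC'_moment2(2) gate_fixed)
  have AR1: "moment2 D AR.\<nu> E3 = (\<lambda>p q. ?a * E False True False p q + ?b * E2 p q)"
    and AR2: "moment2 D AR.\<nu> E4 = (\<lambda>p q. ?b * E1 p q + ?a * E True False True p q)"
    by (simp_all add: AR_E coefs)
  have BR1: "moment2 D BR.\<nu> (E False True False) = (\<lambda>p q. ?b * E1 p q + ?a * E3 p q)"
    and BR2: "moment2 D BR.\<nu> (E True False True) = (\<lambda>p q. ?a * E4 p q + ?b * E2 p q)"
    by (simp_all add: BR_E coefs)
  {
    case True
    have "moment2 D (circC' N) (E True (\<not> True) (\<not> True)) = (\<lambda>p q. of_real (al R ^ 2) * E True (\<not> True) (\<not> True) p q + 1 * (?b * E1 p q + (?a * ?b) * E2 p q))"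
      unfolding circC'_moment2(2) not_True_eq_False gate_fixed AR2 gate_lin BR2
      by (simp add: fun_eq_iff algebra_simps power2_eq_square)
    from eigen[OF circC'_moment2(1) fx this] show ?thesis using True by simp
  next
    case False
    have "moment2 D (circC' N) (E False (\<not> False) (\<not> False)) = (\<lambda>p q. of_real (al R ^ 2) * E False (\<not> False) (\<not> False) p q + 1 * ((?a * ?b) * E1 p q + ?b * E2 p q))"
      unfolding circC'_moment2(2) not_False_eq_True gate_fixed AR1 gate_lin BR1
      by (simp add: fun_eq_iff algebra_simps power2_eq_square)
    from eigen[OF circC'_moment2(1) fx this] show ?thesis using False by simp
  }
qed

definition g0 :: real where "g0 = al R * real R / ((4 * real R ^ 2 - 1) ^ 2)"

text \<open>\<open>a3\<close> and \<open>a4\<close> are the coordinates along \<open>E3\<close> and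
  \<open>E4\<close> of the output of the short circuit. Their explicit form enters the domination by
  the Haar operator.\<close>

definition a3 :: "cmat \<Rightarrow> complex" where
  "a3 X = of_real g0 * (tr False True True X + tr True False False X / of_nat (4 * R) - tr False False False X / of_nat (2 * R) - tr True True True X / 2)"

definition a4 :: "cmat \<Rightarrow> complex" where
  "a4 X = of_real g0 * (tr True False False X + tr False True True X / of_nat (4 * R) - tr True True True X / of_nat (2 * R) - tr False False False X / 2)"

text \<open>Averages over BR and AR leave only products of labels, whatever the input, so one copy
  already maps everything into the span of four operators. The other two coordinates stay
  existential, as preservation of the Haar projection determines them.\<close>

lemma circC'_range:
  "\<exists>c1 c2. moment2 D (circC' N) X = (\<lambda>p q. 1 * (c1 * E1 p q + c2 * E2 p q) + 1 * (a3 X * E3 p q + a4 X * E4 p q))"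
proof -
  let ?a = "complex_of_real (al R)" and ?b = "complex_of_real (be R)"
  define k :: complex where "k = of_nat (2 * R) ^ 2 - 1"
  let ?n = "of_nat (2 * R) :: complex"
  let ?M1 = "BR.coeffI X" and ?M2 = "BR.coeffF X"
  \<comment> \<open>\<open>X1\<close> and \<open>X2\<close> are the two terms of the first average:
    identity and swap on BR with operators on A as coefficients.\<close>
  define X1 where "X1 p q = (?M1 (ca (p div D)) (ca (p mod D)) (ca (q div D)) (ca (q mod D))) *
      of_bool (sw False (cb (p div D)) (cb (p mod D)) (cb (q div D)) (cb (q mod D)) \<and> sw False (cr (p div D)) (cr (p mod D)) (cr (q div D)) (cr (q mod D)))" for p q
  define X2 where "X2 p q = (?M2 (ca (p div D)) (ca (p mod D)) (ca (q div D)) (ca (q mod D))) *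
      of_bool (sw True (cb (p div D)) (cb (p mod D)) (cb (q div D)) (cb (q mod D)) \<and> sw True (cr (p div D)) (cr (p mod D)) (cr (q div D)) (cr (q mod D)))" for p q
  define SI1 where "SI1 = (\<Sum>a<2. \<Sum>b<2. ?M1 a b a b)"
  define SF1 where "SF1 = (\<Sum>a<2. \<Sum>b<2. ?M1 a b b a)"
  define SI2 where "SI2 = (\<Sum>a<2. \<Sum>b<2. ?M2 a b a b)"
  define SF2 where "SF2 = (\<Sum>a<2. \<Sum>b<2. ?M2 a b b a)"
  have S: "SI1 = (tr False False False X - tr False True True X / ?n) / k" "SF1 = (tr True False False X - tr True True True X / ?n) / k"
    "SI2 = (tr False True True X - tr False False False X / ?n) / k" "SF2 = (tr True True True X - tr True False False X / ?n) / k"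
    unfolding SI1_def SF1_def SI2_def SF2_def BR.coeffI_def BR.coeffF_def k_def
    by (simp_all only: sum_divide_distrib[symmetric] sum_subtractf BR_partial_trace)
  have "moment2 D AR.\<nu> (moment2 D BR.\<nu> X) = moment2 D AR.\<nu> (\<lambda>p q. 1 * X1 p q + 1 * X2 p q)"
  proof (rule moment2_cong[OF _ AR.unitary_ensemble_gate])
    fix p q assume pq: "p < D * D" "q < D * D"
    show "moment2 D BR.\<nu> X p q = 1 * X1 p q + 1 * X2 p q"
      unfolding BR.moment2_gate[OF pq] eqI_sw eqF_sw sw_mod_div[of _ "sBR _"] split_coords X1_def X2_def by (simp add: mult.commute)
  qed
  also have "\<dots> = (\<lambda>p q. 1 * moment2 D AR.\<nu> X1 p q + 1 * moment2 D AR.\<nu> X2 p q)" by (rule gate_lin)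
  finally have st: "moment2 D AR.\<nu> (moment2 D BR.\<nu> X) = (\<lambda>p q. 1 * moment2 D AR.\<nu> X1 p q + 1 * moment2 D AR.\<nu> X2 p q)" .
  define c1 where "c1 = (SI1 * cnt False R - SF1 * cnt (\<not> False) R / ?n) / k"
  define c2 where "c2 = (SF1 * cnt (\<not> False) R - SI1 * cnt False R / ?n) / k"
  define c1' where "c1' = (SI2 * cnt True R - SF2 * cnt (\<not> True) R / ?n) / k"
  define c2' where "c2' = (SF2 * cnt (\<not> True) R - SI2 * cnt True R / ?n) / k"
  have t1: "moment2 D AR.\<nu> X1 = (\<lambda>p q. c1 * E1 p q + c2 * E True False True p q)"
    unfolding c1_def c2_def SI1_def SF1_def k_def by (rule AR_tensor) (simp add: X1_def)
  have t2: "moment2 D AR.\<nu> X2 = (\<lambda>p q. c1' * E False True False p q + c2' * E2 p q)"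
    unfolding c1'_def c2'_def SI2_def SF2_def k_def by (rule AR_tensor) (simp add: X2_def)
  have BR1: "moment2 D BR.\<nu> (E False True False) = (\<lambda>p q. ?b * E1 p q + ?a * E3 p q)"
    and BR2: "moment2 D BR.\<nu> (E True False True) = (\<lambda>p q. ?a * E4 p q + ?b * E2 p q)"
    by (simp_all add: BR_E coefs)
  have R0: "complex_of_nat R \<noteq> 0" using R2 by simp
  have k: "k = of_real (4 * real R ^ 2 - 1)" by (simp add: k_def power_mult_distrib)
  have "1 \<le> real R ^ 2" using R2 by (intro one_le_power) simp
  then have k0: "k \<noteq> 0" unfolding k by (simp only: of_real_eq_0_iff)
  have g: "complex_of_real g0 = ?a * of_nat R / k / k" unfolding k g0_def by (simp add: power2_eq_square)
  have A3: "c1' * ?a = a3 X"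
    unfolding c1'_def a3_def g S cnt_def not_True_eq_False if_True if_False of_nat_mult of_nat_numeral
    by (rule gate_coefficient_algebra[OF R0 k0])
  have A4: "c2 * ?a = a4 X"
    unfolding c2_def a4_def g S cnt_def not_False_eq_True if_True if_False of_nat_mult of_nat_numeral
    by (rule gate_coefficient_algebra[OF R0 k0])
  have "moment2 D (circC' N) X = (\<lambda>p q. 1 * ((c1 + c1' * ?b) * E1 p q + (c2 * ?b + c2') * E2 p q) + 1 * (c1' * ?a * E3 p q + c2 * ?a * E4 p q))"
    unfolding circC'_moment2(2) st t1 t2 gate_lin BR1 BR2 gate_fixed by (simp add: fun_eq_iff algebra_simps)
  then show ?thesis unfolding A3 A4 by blast
qed

lemma circC'_delta:
  "moment2 D (circC' N) X p q - moment2 D (haar D) X p q = a3 X * E' False p q + a4 X * E' True p q"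
proof -
  obtain c1 c2 where f: "moment2 D (circC' N) X = (\<lambda>p q. 1 * (c1 * E1 p q + c2 * E2 p q) + 1 * (a3 X * E3 p q + a4 X * E4 p q))"
    using circC'_range by blast
  have "moment2 D (haar D) X = moment2 D (haar D) (moment2 D (circC' N) X)" by (rule full_absorbs[OF circC'_moment2(1), symmetric])
  also have "\<dots> = (\<lambda>p q. 1 * (c1 * E1 p q + c2 * E2 p q) + 1 * (a3 X * moment2 D (haar D) E3 p q + a4 X * moment2 D (haar D) E4 p q))"
    unfolding f full_lin full_fixed ..
  finally show ?thesis unfolding f E'_def by (simp add: algebra_simps)
qed

text \<open>After one copy the difference to Haar lies in an eigenspace, and each further copy
  multiplies it by the eigenvalue; hence the exponent \<open>d\<close> for \<open>Suc d\<close>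
  copies.\<close>

lemma circC'_pow:
  "(moment2 D (circC' N) ^^ Suc d) X p q - moment2 D (haar D) X p q =
     of_real (al R ^ 2) ^ d * (moment2 D (circC' N) X p q - moment2 D (haar D) X p q)"
proof (induction d arbitrary: X)
  case (Suc d)
  let ?f = "moment2 D (circC' N)" and ?h = "moment2 D (haar D)" and ?l = "complex_of_real (al R ^ 2)"
  have "(?f ^^ Suc (Suc d)) X p q - ?h X p q = (?f ^^ Suc d) (?f X) p q - ?h (?f X) p q"
    by (simp only: funpow_Suc_right o_apply full_absorbs[OF circC'_moment2(1)])
  also have "\<dots> = ?l ^ d * (?f (?f X) p q - ?h (?f X) p q)" by (rule Suc.IH)
  also have "?f (?f X) p q - ?h (?f X) p q = ?l * (?f X p q - ?h X p q)"
  proof -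
    obtain u v where h: "?h X = (\<lambda>p q. u * E1 p q + v * E2 p q)" using full_formula by blast
    have fx: "?f E1 = E1" "?f E2 = E2" by (simp_all only: circC'_moment2(2) gate_fixed)
    have f1: "?f X = (\<lambda>p q. 1 * (u * E1 p q + v * E2 p q) + 1 * (a3 X * E' False p q + a4 X * E' True p q))"
      using circC'_delta[of X] by (simp add: fun_eq_iff h algebra_simps)
    then have "?f (?f X) = ?f (\<lambda>p q. 1 * (u * E1 p q + v * E2 p q) + 1 * (a3 X * E' False p q + a4 X * E' True p q))" by (rule arg_cong)
    also have "\<dots> = (\<lambda>p q. 1 * (u * E1 p q + v * E2 p q) + 1 * (a3 X * (?l * E' False p q) + a4 X * (?l * E' True p q)))"
      by (simp only: moment2_linear[OF circC'_moment2(1)] fx circC'_eigen)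
    finally have f2: "?f (?f X) p q = 1 * (u * E1 p q + v * E2 p q) + 1 * (a3 X * (?l * E' False p q) + a4 X * (?l * E' True p q))"
      by (rule fun_cong[OF fun_cong])
    have f1': "?f X p q = 1 * (u * E1 p q + v * E2 p q) + 1 * (a3 X * E' False p q + a4 X * E' True p q)"
      using f1 by (rule fun_cong[OF fun_cong])
    show ?thesis
      unfolding full_absorbs[OF circC'_moment2(1)] f2 unfolding f1' h by (simp add: algebra_simps)
  qed
  finally show ?case by (simp add: mult_ac)
qed simp

end

section \<open>Domination by the Haar moment operator\<close>

context qubits
begin

lemma E_sym: "E \<sigma> \<tau> \<rho> p q = E \<sigma> \<tau> \<rho> q p"
proof -
  have sym: "sw s a b a' b' \<longleftrightarrow> sw s a' b' a b" for s a b a' b' by (auto simp: sw_def)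
  show ?thesis
    unfolding E_def sym[of \<sigma> "ca (p div D)"] sym[of \<tau> "cb (p div D)"] sym[of \<rho> "cr (p div D)"]
    by (intro arg_cong[where f=of_bool]) blast
qed

lemma E_cnj [simp]: "cnj (E \<sigma> \<tau> \<rho> p q) = E \<sigma> \<tau> \<rho> p q"
  by (simp add: E_def)

lemma E_norm: "cmod (E \<sigma> \<tau> \<rho> p q) \<le> 1"
  by (simp add: E_def)

lemma E'_eq:
  "E' False = (\<lambda>p q. E3 p q - (of_real (al (2 * R)) * E1 p q + of_real (be (2 * R)) * E2 p q))"
  "E' True = (\<lambda>p q. E4 p q - (of_real (be (2 * R)) * E1 p q + of_real (al (2 * R)) * E2 p q))"
  unfolding E'_def[abs_def] full_E by (simp_all add: coef_values[OF R1(2)])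

section \<open>The Klein four-group generated by the partial swaps\<close>

definition flip :: "bool \<Rightarrow> bool \<Rightarrow> nat \<Rightarrow> nat" where
  "flip \<sigma> \<tau> q = (ca (if \<sigma> then q mod D else q div D) + 2 * sBR (if \<tau> then q mod D else q div D)) * D
     + (ca (if \<sigma> then q div D else q mod D) + 2 * sBR (if \<tau> then q div D else q mod D))"

lemma coord_less: "x < D \<Longrightarrow> y < D \<Longrightarrow> ca x + 2 * sBR y < D"
proof -
  assume "x < D" "y < D"
  then have "ca x < 2" "sBR y < 2 * R" by (auto simp: ca_def sBR_def D_eq)
  then show ?thesis unfolding D_eq by linarith
qed

lemma flip_coords:
  assumes "q < D * D"
  shows "flip \<sigma> \<tau> q < D * D"
    "flip \<sigma> \<tau> q div D = ca (if \<sigma> then q mod D else q div D) + 2 * sBR (if \<tau> then q mod D else q div D)"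
    "flip \<sigma> \<tau> q mod D = ca (if \<sigma> then q div D else q mod D) + 2 * sBR (if \<tau> then q div D else q mod D)"
proof -
  have l: "(if \<rho> then q mod D else q div D) < D" "(if \<rho> then q div D else q mod D) < D" for \<rho>
    using div_mod_less[OF assms] by auto
  note c = coord_less[OF l(1)[of \<sigma>] l(1)[of \<tau>]] coord_less[OF l(2)[of \<sigma>] l(2)[of \<tau>]]
  show "flip \<sigma> \<tau> q < D * D" unfolding flip_def by (rule mult_add_less[OF c])
  show "flip \<sigma> \<tau> q div D = ca (if \<sigma> then q mod D else q div D) + 2 * sBR (if \<tau> then q mod D else q div D)"
    unfolding flip_def using c(2) by simp
  show "flip \<sigma> \<tau> q mod D = ca (if \<sigma> then q div D else q mod D) + 2 * sBR (if \<tau> then q div D else q mod D)"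
    unfolding flip_def using c(2) by simp
qed

lemma ca_sBR_inj: "x = y \<longleftrightarrow> ca x = ca y \<and> sBR x = sBR y"
  unfolding ca_def sBR_def by (metis mult_div_mod_eq)

lemma ca_sBR_pair: "ca (ca x + 2 * y) = ca x" "sBR (ca x + 2 * y) = y"
  by (simp_all add: ca_def sBR_def)

lemma index_eq_iff: "p = q \<longleftrightarrow> p div D = q div D \<and> p mod D = q mod D"
  by (metis div_mult_mod_eq)

lemma E_sBR: "E \<sigma> \<tau> \<tau> p q = of_bool (p < D * D \<and> q < D * D \<and>
     sw \<sigma> (ca (p div D)) (ca (p mod D)) (ca (q div D)) (ca (q mod D)) \<and>
     sw \<tau> (sBR (p div D)) (sBR (p mod D)) (sBR (q div D)) (sBR (q mod D)))"
  unfolding E_def sw_mod_div[of \<tau> "sBR _"] split_coords ..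

text \<open>The four operators are permutation matrices, so their products reduce to comparing
  indices.\<close>

lemma E_flip:
  assumes "p < D * D" "q < D * D"
  shows "E \<sigma> \<tau> \<tau> p q = of_bool (p = flip \<sigma> \<tau> q)"
proof -
  have "p = flip \<sigma> \<tau> q \<longleftrightarrow> ca (p div D) = ca (if \<sigma> then q mod D else q div D) \<and> sBR (p div D) = sBR (if \<tau> then q mod D else q div D) \<and>
     ca (p mod D) = ca (if \<sigma> then q div D else q mod D) \<and> sBR (p mod D) = sBR (if \<tau> then q div D else q mod D)"
    unfolding index_eq_iff[of p "flip \<sigma> \<tau> q"] flip_coords[OF assms(2)] ca_sBR_inj[of "p div D"] ca_sBR_inj[of "p mod D"] ca_sBR_pair by blast
  then show ?thesis using assms unfolding E_sBR sw_def by (cases \<sigma>; cases \<tau>) auto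
qed

lemma flip_eq_iff:
  assumes "i < D * D" "j < D * D"
  shows "of_bool (flip \<sigma> \<tau> i = flip \<sigma>' \<tau>' j) = E (\<sigma> \<noteq> \<sigma>') (\<tau> \<noteq> \<tau>') (\<tau> \<noteq> \<tau>') i j"
proof -
  have "flip \<sigma> \<tau> i = flip \<sigma>' \<tau>' j \<longleftrightarrow>
     ca (if \<sigma> then i mod D else i div D) = ca (if \<sigma>' then j mod D else j div D) \<and> sBR (if \<tau> then i mod D else i div D) = sBR (if \<tau>' then j mod D else j div D) \<and>
     ca (if \<sigma> then i div D else i mod D) = ca (if \<sigma>' then j div D else j mod D) \<and> sBR (if \<tau> then i div D else i mod D) = sBR (if \<tau>' then j div D else j mod D)"
    unfolding index_eq_iff[of "flip \<sigma> \<tau> i"] flip_coords[OF assms(1)] flip_coords[OF assms(2)]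
      ca_sBR_inj[of "ca _ + 2 * sBR _"] ca_sBR_pair by blast
  then show ?thesis using assms unfolding E_sBR sw_def by (cases \<sigma>; cases \<tau>; cases \<sigma>'; cases \<tau>') auto
qed

text \<open>Labels add modulo 2. Both factors are summed over their first index, which gives the
  matrix product because they are symmetric.\<close>

lemma E_mult:
  assumes "i < D * D" "j < D * D"
  shows "(\<Sum>l<D * D. E \<sigma> \<tau> \<tau> l i * E \<sigma>' \<tau>' \<tau>' l j) = E (\<sigma> \<noteq> \<sigma>') (\<tau> \<noteq> \<tau>') (\<tau> \<noteq> \<tau>') i j"
proof -
  have "(\<Sum>l<D * D. E \<sigma> \<tau> \<tau> l i * E \<sigma>' \<tau>' \<tau>' l j) =
     (\<Sum>l<D * D. if l = flip \<sigma> \<tau> i then of_bool (flip \<sigma> \<tau> i = flip \<sigma>' \<tau>' j) else 0)"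
    using assms by (intro sum.cong refl) (auto simp: E_flip)
  also have "\<dots> = of_bool (flip \<sigma> \<tau> i = flip \<sigma>' \<tau>' j)" using flip_coords(1)[OF assms(1)] by simp
  finally show ?thesis unfolding flip_eq_iff[OF assms] .
qed

text \<open>For signs \<open>x\<close>, \<open>y\<close> this is four times the orthogonal projection \<open>(I + x F\<^sub>A)(I + y F\<^sub>B\<^sub>R) / 4\<close>.\<close>

definition Q :: "real \<Rightarrow> real \<Rightarrow> cmat" where
  "Q x y p q = E1 p q + of_real (x * y) * E2 p q + of_real y * E3 p q + of_real x * E4 p q"

text \<open>Half of \<open>Q\<close> is twice a projection, so its square is \<open>Q\<close>. This
  exhibits \<open>Q\<close> as a Gram matrix, as \<open>completely_positive_rank_one\<close>
  requires.\<close>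

lemma Q_square:
  assumes xy: "x * x = 1" "y * y = 1" and ij: "i < D * D" "j < D * D"
  shows "Q x y i j = (\<Sum>l<D * D. cnj (Q x y l i / 2) * (Q x y l j / 2))"
proof -
  let ?x = "complex_of_real x" and ?y = "complex_of_real y"
  have xx: "?x * ?x = 1" "?y * ?y = 1" using xy by (simp_all flip: of_real_mult)
  have q: "Q x y p q = E1 p q + ?x * ?y * E2 p q + ?y * E3 p q + ?x * E4 p q" for p q by (simp add: Q_def)
  have "(\<Sum>l<D * D. cnj (Q x y l i / 2) * (Q x y l j / 2)) =
    (\<Sum>l<D * D. (E1 l i * E1 l j + ?x * ?y * (E1 l i * E2 l j) + ?y * (E1 l i * E3 l j) + ?x * (E1 l i * E4 l j)
      + ?x * ?y * (E2 l i * E1 l j) + ?x * ?x * (?y * ?y) * (E2 l i * E2 l j) + ?x * (?y * ?y) * (E2 l i * E3 l j) + ?x * ?x * ?y * (E2 l i * E4 l j)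
      + ?y * (E3 l i * E1 l j) + ?x * (?y * ?y) * (E3 l i * E2 l j) + ?y * ?y * (E3 l i * E3 l j) + ?x * ?y * (E3 l i * E4 l j)
      + ?x * (E4 l i * E1 l j) + ?x * ?x * ?y * (E4 l i * E2 l j) + ?x * ?y * (E4 l i * E3 l j) + ?x * ?x * (E4 l i * E4 l j)) / 4)"
    unfolding q by (intro sum.cong refl) (simp add: algebra_simps)
  also have "\<dots> = Q x y i j"
    unfolding xx sum_divide_distrib[symmetric] sum.distrib sum_distrib_left[symmetric] E_mult[OF ij]
    by (simp add: q algebra_simps)
  finally show ?thesis by (rule sym)
qed

definition trQ :: "real \<Rightarrow> real \<Rightarrow> cmat \<Rightarrow> complex" where
  "trQ x y X = tr False False False X + of_real (x * y) * tr True True True X + of_real y * tr False True True X + of_real x * tr True False False X"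

lemma trQ_sum: "(\<Sum>i<D * D. \<Sum>j<D * D. Q x y i j * X i j) = trQ x y X"
  unfolding trQ_def tr_def sum_distrib_left sum.distrib[symmetric]
  by (intro sum.cong refl) (simp add: Q_def algebra_simps)

lemma cp_Q:
  assumes "x * x = 1" "y * y = 1" "x' * x' = 1" "y' * y' = 1" "0 \<le> t"
  shows "completely_positive (D * D) (\<lambda>X p q. of_real t * (Q x y p q * trQ x' y' X))"
  unfolding trQ_sum[symmetric]
  by (rule completely_positive_rank_one[where A="\<lambda>l i. Q x y l i / 2" and B="\<lambda>l i. Q x' y' l i / 2"])
     (rule Q_square[OF assms(1,2)], assumption+, rule Q_square[OF assms(3,4)], assumption+, rule assms(5))

text \<open>For fixed parity s = x y the two matrices \<open>Q\<close> are the sum and the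
  difference of E1 + s E2 and E3 + s E4, and likewise for the trace functionals. The weights
  \<open>?t\<close> are the Hadamard transform of \<open>a\<close>, \<open>b\<close>,
  \<open>c\<close>, \<open>d\<close>; \<open>le\<close> makes them nonnegative.\<close>

lemma cp_parity:
  fixes s a b c d :: real
  assumes s: "s * s = 1" and le: "\<bar>b\<bar> + \<bar>c\<bar> + \<bar>d\<bar> \<le> a"
  shows "completely_positive (D * D) (\<lambda>X p q.
      (E1 p q + of_real s * E2 p q) * (of_real a * (tr False False False X + of_real s * tr True True True X) + of_real b * (tr False True True X + of_real s * tr True False False X))
      + (E3 p q + of_real s * E4 p q) * (of_real c * (tr False False False X + of_real s * tr True True True X) + of_real d * (tr False True True X + of_real s * tr True False False X)))"
    (is "completely_positive _ ?\<Phi>")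
proof -
  let ?t = "\<lambda>y y'. (a + y' * b + y * c + y * y' * d) / 4"
  have t: "0 \<le> ?t 1 1" "0 \<le> ?t 1 (-1)" "0 \<le> ?t (-1) 1" "0 \<le> ?t (-1) (-1)" using le by auto
  have "completely_positive (D * D) (\<lambda>X p q. of_real (?t 1 1) * (Q s 1 p q * trQ s 1 X) + of_real (?t 1 (-1)) * (Q s 1 p q * trQ (- s) (-1) X)
      + (of_real (?t (-1) 1) * (Q (- s) (-1) p q * trQ s 1 X) + of_real (?t (-1) (-1)) * (Q (- s) (-1) p q * trQ (- s) (-1) X)))"
    by (intro completely_positive_add cp_Q t) (use s in auto)
  also have "(\<lambda>X p q. of_real (?t 1 1) * (Q s 1 p q * trQ s 1 X) + of_real (?t 1 (-1)) * (Q s 1 p q * trQ (- s) (-1) X)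
      + (of_real (?t (-1) 1) * (Q (- s) (-1) p q * trQ s 1 X) + of_real (?t (-1) (-1)) * (Q (- s) (-1) p q * trQ (- s) (-1) X))) = ?\<Phi>"
  proof (intro ext)
    fix X p q
    define e g t u where "e = E1 p q + of_real s * E2 p q" and "g = E3 p q + of_real s * E4 p q"
      and "t = tr False False False X + of_real s * tr True True True X" and "u = tr False True True X + of_real s * tr True False False X"
    have Qs: "Q s 1 p q = e + g" "Q (- s) (-1) p q = e - g" "trQ s 1 X = t + u" "trQ (- s) (-1) X = t - u"
      by (simp_all add: Q_def trQ_def e_def g_def t_def u_def algebra_simps)
    show "of_real (?t 1 1) * (Q s 1 p q * trQ s 1 X) + of_real (?t 1 (-1)) * (Q s 1 p q * trQ (- s) (-1) X)
      + (of_real (?t (-1) 1) * (Q (- s) (-1) p q * trQ s 1 X) + of_real (?t (-1) (-1)) * (Q (- s) (-1) p q * trQ (- s) (-1) X)) = ?\<Phi> X p q"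
      unfolding Qs unfolding e_def[symmetric] g_def[symmetric] t_def[symmetric] u_def[symmetric]
      by (simp add: field_simps)
  qed
  finally show ?thesis .
qed

lemma D_real: "1 < real D" using R2 by (simp add: D_eq)

text \<open>Splitting along the two eigenspaces \<open>s = 1\<close>, \<open>s = -1\<close> of the full swap, the Haar part has a strictly positive
  coefficient on each, which absorbs the remaining terms.\<close>

lemma circC'_dominated:
  "\<exists>K>0. \<forall>w c. \<bar>w\<bar> = 1 \<longrightarrow> 0 \<le> c \<longrightarrow> completely_positive (D * D) (\<lambda>X p q. of_real (c * K) * moment2 D (haar D) X p q +
      of_real (c * w) * (moment2 D (circC' N) X p q - moment2 D (haar D) X p q))"
proof -
  define A B n where "A = al (2 * R)" and "B = be (2 * R)" and "n = real R"
  define \<eta> where "\<eta> = 1 / (real D ^ 2 - 1)"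
  have n0: "n \<noteq> 0" using R2 by (simp add: n_def)
  have "1 < real D ^ 2" using D_real by (simp add: one_less_power)
  then have \<eta>: "0 < \<eta>" by (simp add: \<eta>_def)
  \<comment> \<open>In the notation of \<open>cp_parity\<close>, the coefficients in the eigenspace
    \<open>s\<close>: \<open>h\<close> for the Haar operator, \<open>e\<close>, \<open>b\<close>,
    \<open>c'\<close>, \<open>d\<close> for the difference between circuit and Haar.\<close>
  define h where "h s = \<eta> * (1 - s / real D) / 2" for s
  define e where "e s = g0 / 2 * (A + s * B) * (1 / (2 * n) + s / 2)" for s
  define b where "b s = - (g0 / 2 * (A + s * B) * (1 + s / (4 * n)))" for s
  define c' where "c' s = - (g0 / 2 * (1 / (2 * n) + s / 2))" for s
  define d where "d s = g0 / 2 * (1 + s / (4 * n))" for s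
  have hp: "0 < h 1" "0 < h (-1)"
  proof -
    have "0 < 1 - 1 / real D" "0 < 1 - (-1) / real D" using D_real by (simp_all add: add_pos_pos)
    then show "0 < h 1" "0 < h (-1)" unfolding h_def using \<eta> by (intro divide_pos_pos mult_pos_pos; simp)+
  qed
  define L where "L s = \<bar>e s\<bar> + \<bar>b s\<bar> + \<bar>c' s\<bar> + \<bar>d s\<bar>" for s
  \<comment> \<open>Chosen so that K h(s) dominates the sum of absolute values for both s, uniformly
    in the sign \<open>w\<close> and the scale \<open>c\<close>.\<close>
  define K where "K = L 1 / h 1 + L (-1) / h (-1) + 1"
  have L0: "0 \<le> L s" for s by (simp add: L_def)
  have K0: "0 < K" using L0 hp by (simp add: K_def add_nonneg_pos)
  have KL: "L 1 \<le> K * h 1" "L (-1) \<le> K * h (-1)"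
  proof -
    have "L 1 / h 1 * h 1 \<le> K * h 1" unfolding K_def using L0 hp by (intro mult_right_mono) auto
    then show "L 1 \<le> K * h 1" using hp by simp
    have "L (-1) / h (-1) * h (-1) \<le> K * h (-1)" unfolding K_def using L0 hp by (intro mult_right_mono) auto
    then show "L (-1) \<le> K * h (-1)" using hp by simp
  qed
  have "completely_positive (D * D) (\<lambda>X p q. of_real (c * K) * moment2 D (haar D) X p q +
      of_real (c * w) * (moment2 D (circC' N) X p q - moment2 D (haar D) X p q))" if w: "\<bar>w\<bar> = 1" and c: "0 \<le> c" for w c
  proof -
    let ?\<Psi> = "\<lambda>s X p q. (E1 p q + of_real s * E2 p q) * (of_real (c * (K * h s + w * e s)) * (tr False False False X + of_real s * tr True True True X) + of_real (c * (w * b s)) * (tr False True True X + of_real s * tr True False False X))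
      + (E3 p q + of_real s * E4 p q) * (of_real (c * (w * c' s)) * (tr False False False X + of_real s * tr True True True X) + of_real (c * (w * d s)) * (tr False True True X + of_real s * tr True False False X))"
    have cond: "\<bar>c * (w * b s)\<bar> + \<bar>c * (w * c' s)\<bar> + \<bar>c * (w * d s)\<bar> \<le> c * (K * h s + w * e s)" if "L s \<le> K * h s" for s
    proof -
      have "\<bar>w * e s\<bar> = \<bar>e s\<bar>" using w by (simp add: abs_mult)
      then have "- \<bar>e s\<bar> \<le> w * e s" by (metis abs_ge_minus_self minus_le_iff)
      then have "\<bar>b s\<bar> + \<bar>c' s\<bar> + \<bar>d s\<bar> \<le> K * h s + w * e s" using that by (simp add: L_def)
      from mult_left_mono[OF this c] show ?thesis using w c by (simp add: abs_mult algebra_simps)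
    qed
    have "completely_positive (D * D) (?\<Psi> 1)" by (rule cp_parity) (use cond[OF KL(1)] in auto)
    moreover have "completely_positive (D * D) (?\<Psi> (-1))" by (rule cp_parity) (use cond[OF KL(2)] in auto)
    ultimately have "completely_positive (D * D) (\<lambda>X p q. ?\<Psi> 1 X p q + ?\<Psi> (-1) X p q)" by (rule completely_positive_add)
    moreover have "?\<Psi> 1 X p q + ?\<Psi> (-1) X p q = of_real (c * K) * moment2 D (haar D) X p q +
      of_real (c * w) * (moment2 D (circC' N) X p q - moment2 D (haar D) X p q)" for X p q
    proof -
      define t1 t2 t3 t4 where "t1 = tr False False False X" and "t2 = tr True True True X" and "t3 = tr False True True X" and "t4 = tr True False False X"
      define x1 x2 x3 x4 where "x1 = E1 p q" and "x2 = E2 p q" and "x3 = E3 p q" and "x4 = E4 p q"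
      define H where "H = complex_of_real \<eta>" define G where "G = complex_of_real g0"
      define i where "i = complex_of_real (1 / n)" define j where "j = complex_of_real (1 / real D)"
      define A' where "A' = complex_of_real A" define B' where "B' = complex_of_real B"
      have hs: "complex_of_real (h s) = H * (1 - of_real s * j) / 2" "complex_of_real (e s) = G / 2 * (A' + of_real s * B') * (i / 2 + of_real s / 2)"
        "complex_of_real (b s) = - (G / 2 * (A' + of_real s * B') * (1 + of_real s * i / 4))" "complex_of_real (c' s) = - (G / 2 * (i / 2 + of_real s / 2))"
        "complex_of_real (d s) = G / 2 * (1 + of_real s * i / 4)" for s
        by (simp_all add: h_def e_def b_def c'_def d_def H_def G_def i_def j_def A'_def B'_def)
      have a3': "a3 X = G * (t3 + t4 * i / 4 - t1 * i / 2 - t2 / 2)" "a4 X = G * (t4 + t3 * i / 4 - t2 * i / 2 - t1 / 2)"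
        by (simp_all add: a3_def a4_def G_def i_def n_def t1_def t2_def t3_def t4_def mult.commute)
      have hX: "moment2 D (haar D) X p q = H * ((t1 - t2 * j) * x1 + (t2 - t1 * j) * x2)"
        unfolding full_formula by (simp add: H_def \<eta>_def j_def t1_def t2_def x1_def x2_def divide_inverse algebra_simps)
      have dX: "moment2 D (circC' N) X p q - moment2 D (haar D) X p q =
         a3 X * (x3 - (A' * x1 + B' * x2)) + a4 X * (x4 - (B' * x1 + A' * x2))"
        unfolding circC'_delta E'_eq by (simp add: x1_def x2_def x3_def x4_def A'_def B'_def A_def B_def)
      show ?thesis
        unfolding dX unfolding hX a3' of_real_mult of_real_add hs
          t1_def[symmetric] t2_def[symmetric] t3_def[symmetric] t4_def[symmetric] x1_def[symmetric] x2_def[symmetric] x3_def[symmetric] x4_def[symmetric]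
        by (simp add: field_simps)
    qed
    ultimately show ?thesis by simp
  qed
  then show ?thesis using K0 by blast
qed

end

section \<open>Comparison of the convergence rates\<close>

text \<open>Any constants lose against the ratio of the rates. The exponents differ by one because
  all copies of the slow circuit count, but for the fast one only those after the first.\<close>

lemma geometric_separation:
  fixes a b K c :: real
  assumes "0 < a" "a < b" "0 < K" "0 < c"
  shows "\<exists>d. K * a ^ d < c * b ^ Suc d"
proof -
  have "0 < c * b / K" using assms by simp
  moreover have "a / b < 1" using assms by simp
  ultimately obtain d where d: "(a / b) ^ d < c * b / K" using real_arch_pow_inv by blast
  have b: "0 < b ^ d" using assms by simp
  have "a ^ d = (a / b) ^ d * b ^ d" using assms by (simp add: power_divide)
  also have "\<dots> < c * b / K * b ^ d" by (rule mult_strict_right_mono[OF d b])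
  finally have "K * a ^ d < K * (c * b / K * b ^ d)" by (rule mult_strict_left_mono[OF _ assms(3)])
  also have "\<dots> = c * b ^ Suc d" using assms by simp
  finally show ?thesis by blast
qed

context qubits
begin

abbreviation "lamC \<equiv> 4 / 25 * be R ^ 2"
abbreviation "lamC' \<equiv> al R ^ 2"

lemma rates:
  assumes "5 \<le> N"
  shows "0 < lamC'" "lamC' < lamC"
proof -
  have "2 ^ 3 \<le> (2::nat) ^ (N - 2)" using assms by (intro power_increasing) auto
  then have "8 \<le> R" by (simp add: R_def)
  then have R8: "8 \<le> real R" by simp
  have sq: "8 * real R \<le> real R ^ 2" using R8 by (simp add: power2_eq_square)
  then have pos: "0 < 4 * real R ^ 2 - 1" using R8 by linarith
  have al: "0 < al R" unfolding al_def using R8 pos by (intro divide_pos_pos) auto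
  \<comment> \<open>This is \<alpha> < 2 \<beta> / 5 with denominators cleared. At R = 4 both sides
    equal 60; the next power of two, R = 8, is the first that works.\<close>
  have "15 * real R < 4 * real R ^ 2 - 4" using sq R8 by linarith
  then have "3 * real R < 2 / 5 * (2 * real R ^ 2 - 2)" by (simp add: field_simps)
  then have "al R < 2 / 5 * (2 * real R ^ 2 - 2) / (4 * real R ^ 2 - 1)"
    unfolding al_def using pos by (rule divide_strict_right_mono)
  then have "al R < 2 / 5 * be R" by (simp add: be_def)
  then have "al R ^ 2 < (2 / 5 * be R) ^ 2" using al by (intro power_strict_mono) auto
  then show "lamC' < lamC" by (simp add: power2_eq_square)
  show "0 < lamC'" using al by simp
qed

abbreviation "m \<equiv> D * D"

definition bnd :: real where "bnd = real m * real m"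

lemma m_pos: "0 < m" using R2 by (simp add: D_eq)

lemma bnd_pos: "0 < bnd" unfolding bnd_def using m_pos by (metis of_nat_0_less_iff mult_pos_pos)

lemma E'_bound: "cmod (E' \<sigma> p q) \<le> 1 + bnd"
proof -
  let ?F = "E \<sigma> (\<not> \<sigma>) (\<not> \<sigma>)"
  have "cmod (moment2 D (haar D) ?F p q) \<le> bnd * 1"
    unfolding bnd_def by (rule moment2_bound[OF FU.ens]) (auto intro: E_norm)
  then show ?thesis
    unfolding E'_def using norm_triangle_ineq4[of "?F p q" "moment2 D (haar D) ?F p q"] E_norm[of \<sigma> "\<not> \<sigma>" "\<not> \<sigma>" p q] by linarith
qed

lemma pow_ens: "unitary_ensemble D (ens_pow D (circC N) d)" "unitary_ensemble D (ens_pow D (circC' N) d)"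
  by (rule unitary_ensemble_pow[OF circC_moment2(1)], rule unitary_ensemble_pow[OF circC'_moment2(1)])

lemma powC'_delta:
  "moment2 D (ens_pow D (circC' N) (Suc d)) X p q - moment2 D (haar D) X p q =
     of_real (lamC' ^ d) * (moment2 D (circC' N) X p q - moment2 D (haar D) X p q)"
  unfolding moment2_pow_Suc[OF circC'_moment2(1)] circC'_pow by simp

lemma powC_E': "moment2 D (ens_pow D (circC N) (Suc d)) (E' False) = (\<lambda>p q. of_real (lamC ^ Suc d) * E' False p q)"
  unfolding moment2_pow_Suc[OF circC_moment2(1)] eigen_pow[OF circC_eigen circC_moment2(1)] by (simp only: of_real_power)

lemma powC_E1: "moment2 D (ens_pow D (circC N) (Suc d)) E1 = E1"
proof -
  have fx: "moment2 D (circC N) E1 = E1" by (simp only: circC_moment2(2) gate_fixed)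
  have "(moment2 D (circC N) ^^ k) E1 = E1" for k by (induction k) (simp_all add: fx)
  then show ?thesis unfolding moment2_pow_Suc[OF circC_moment2(1)] .
qed

lemma difference_bound:
  assumes "unitary_ensemble D \<nu>" "\<And>i j. i < m \<Longrightarrow> j < m \<Longrightarrow> cmod (X i j) \<le> b" "0 \<le> b"
  shows "cmod (moment2 D \<nu> X p q - moment2 D (haar D) X p q) \<le> 2 * bnd * b"
  using norm_triangle_ineq4[of "moment2 D \<nu> X p q" "moment2 D (haar D) X p q"]
    moment2_bound[where X=X and p=p and q=q, OF assms] moment2_bound[where X=X and p=p and q=q, OF FU.ens assms(2,3)] unfolding bnd_def by linarith

text \<open>The indices encode the basis pairs (0, 3) and (2, 1): the bits of A agree, those of B
  are exchanged, those of R are 0. There \<open>E3\<close> is 1 while \<open>E1\<close> and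
  \<open>E2\<close> are 0, so the Haar correction does not contribute.\<close>

lemma E'_entry: "E' False 3 (2 * D + 1) = 1"
proof -
  have D8: "8 \<le> D" using R2 by (simp add: D_eq)
  have d: "3 div D = 0" "3 mod D = 3" "(2 * D + 1) div D = 2" "(2 * D + 1) mod D = 1"
    using D8 div_mult_self1[of D 1 2] mod_mult_self1[of 1 2 D] by simp_all
  have "2 * D + 1 < D * D"
  proof -
    have "2 * D + 1 < 8 * D" using D8 by simp
    also have "\<dots> \<le> D * D" using D8 by (intro mult_le_mono1)
    finally show ?thesis .
  qed
  moreover have "3 < D * D" using D8 calculation by simp
  ultimately show ?thesis
    unfolding E'_eq E_def d sw_def ca_def cb_def cr_def by simp
qed

section \<open>Separation in the additive error\<close>

lemma additive_part:
  assumes "5 \<le> N"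
  shows "\<exists>\<epsilon> > 0. \<exists>d > 0. additive_2design D (ens_pow D (circC' N) d) \<epsilon> \<and> \<not> additive_2design D (ens_pow D (circC N) d) \<epsilon>"
proof -
  define M where "M = real (m * m) * real (m * m)"
  have M0: "0 < M" unfolding M_def using m_pos by simp
  define e0 where "e0 = 1 / (M * (1 + bnd))"
  have b0: "0 < 1 + bnd" using bnd_pos by simp
  have e0: "0 < e0" unfolding e0_def using M0 b0 by simp
  obtain d where d: "(M * (2 * bnd)) * lamC' ^ d < e0 * lamC ^ Suc d"
    using geometric_separation[OF rates[OF assms], of "M * (2 * bnd)" e0] M0 bnd_pos e0 by auto
  \<comment> \<open>The upper bound for the fast circuit itself serves as \<epsilon>; by the choice
    of \<open>d\<close> it lies strictly below the lower bound for the slow one.\<close>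
  define \<epsilon> where "\<epsilon> = M * (2 * bnd) * lamC' ^ d"
  have "0 < \<epsilon>" unfolding \<epsilon>_def
    by (rule mult_pos_pos[OF _ zero_less_power[OF rates(1)[OF assms]]]) (use M0 bnd_pos in simp)
  moreover have "additive_2design D (ens_pow D (circC' N) (Suc d)) \<epsilon>"
  proof -
    have "diamond_norm m (\<lambda>X i j. moment2 D (ens_pow D (circC' N) (Suc d)) X i j - moment2 D (haar D) X i j)
        \<le> real (m * m) * real (m * m) * (lamC' ^ d * (2 * bnd))"
    proof (rule diamond_norm_bounds(1))
      fix X :: cmat and p q and b :: real
      assume X: "\<And>i j. i < m \<Longrightarrow> j < m \<Longrightarrow> cmod (X i j) \<le> b" and b: "0 \<le> b"
      have "cmod (moment2 D (circC' N) X p q - moment2 D (haar D) X p q) \<le> 2 * bnd * b"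
        by (rule difference_bound[OF circC'_moment2(1) X b])
      moreover have "0 \<le> lamC' ^ d" by simp
      ultimately have "lamC' ^ d * cmod (moment2 D (circC' N) X p q - moment2 D (haar D) X p q) \<le> lamC' ^ d * (2 * bnd * b)"
        by (rule mult_left_mono)
      moreover have "cmod (of_real (lamC' ^ d) * z) = lamC' ^ d * cmod z" for z
        by (simp only: norm_mult norm_of_real abs_of_nonneg[OF \<open>0 \<le> lamC' ^ d\<close>])
      ultimately show "cmod (moment2 D (ens_pow D (circC' N) (Suc d)) X p q - moment2 D (haar D) X p q) \<le> lamC' ^ d * (2 * bnd) * b"
        unfolding powC'_delta by (simp only: mult.assoc)
    qed (use bnd_pos in simp)
    then show ?thesis unfolding additive_2design_def \<epsilon>_def M_def by (simp only: mult_ac)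
  qed
  moreover have "\<not> additive_2design D (ens_pow D (circC N) (Suc d)) \<epsilon>"
  proof -
    let ?\<Phi> = "\<lambda>X i j. moment2 D (ens_pow D (circC N) (Suc d)) X i j - moment2 D (haar D) X i j"
    \<comment> \<open>The eigenvector in one corner of the ancilla, scaled to trace norm at most 1.
      The Haar part kills it and the circuit multiplies it by its eigenvalue.\<close>
    define Y where "Y p q = (if p mod m = 0 \<and> q mod m = 0 then of_real e0 * E' False (p div m) (q div m) else 0)" for p q
    have "trace_norm (m * m) Y \<le> real (m * m) * real (m * m) * (e0 * (1 + bnd))"
    proof (rule trace_norm_bound)
      fix i j
      have "e0 * cmod (E' False (i div m) (j div m)) \<le> e0 * (1 + bnd)" using e0 by (intro mult_left_mono E'_bound) simp
      then show "cmod (Y i j) \<le> e0 * (1 + bnd)" using e0 b0 by (auto simp: Y_def norm_mult)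
    qed (use e0 b0 in simp)
    also have "\<dots> = 1" unfolding M_def[symmetric] e0_def using M0 b0 by simp
    finally have tY: "trace_norm (m * m) Y \<le> 1" .
    let ?p = "3 :: nat" and ?q = "2 * D + 1"
    have D8: "8 \<le> D" using R2 by (simp add: D_eq)
    have qm: "?q < m"
    proof -
      have "2 * D + 1 < 8 * D" using D8 by simp
      also have "\<dots> \<le> D * D" using D8 by (intro mult_le_mono1)
      finally show ?thesis .
    qed
    then have pm: "?p < m" using D8 by simp
    have pq: "?p * m < m * m" "?q * m < m * m" by (rule mult_less_mono1[OF pm m_pos], rule mult_less_mono1[OF qm m_pos])
    have X: "moment2 D \<nu> (\<lambda>i j. if i < m \<and> j < m then Y (i * m + ?p * m mod m) (j * m + ?q * m mod m) else 0) =
        (\<lambda>i j. of_real e0 * moment2 D \<nu> (E' False) i j)" if ens: "unitary_ensemble D \<nu>" for \<nu>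
    proof -
      have "moment2 D \<nu> (\<lambda>i j. if i < m \<and> j < m then Y (i * m + ?p * m mod m) (j * m + ?q * m mod m) else 0) =
         moment2 D \<nu> (\<lambda>i j. of_real e0 * E' False i j + 0 * E' False i j)"
        using m_pos by (intro moment2_cong[OF _ ens]) (simp add: Y_def)
      then show ?thesis by (simp only: moment2_linear[OF ens]) simp
    qed
    have te: "tensor_id m m ?\<Phi> Y (?p * m) (?q * m) = of_real (e0 * lamC ^ Suc d)"
      unfolding tensor_id_def X[OF pow_ens(1)] X[OF FU.ens] powC_E' full_E'
      using pq m_pos E'_entry by (simp del: power_Suc)
    have "e0 * lamC ^ Suc d \<le> cmod (tensor_id m m ?\<Phi> Y (?p * m) (?q * m))"
      unfolding te norm_of_real by (rule abs_ge_self)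
    also have "\<dots> \<le> trace_norm (m * m) (tensor_id m m ?\<Phi> Y)"
      by (rule entry_le_trace_norm[OF pq])
    also have "\<dots> \<le> diamond_norm m ?\<Phi>"
      by (rule diamond_norm_bounds(2)[where B="2 * bnd", OF difference_bound[OF pow_ens(1)] _ tY]) (use bnd_pos in auto)
    finally have "e0 * lamC ^ Suc d \<le> diamond_norm m ?\<Phi>" .
    then show ?thesis unfolding additive_2design_def using d unfolding \<epsilon>_def by linarith
  qed
  ultimately show ?thesis by blast
qed

section \<open>Separation in the multiplicative error\<close>

lemma idm_E1: "E1 = idm m"
proof (intro ext)
  fix p q
  have "(sw False (ca (p div D)) (ca (p mod D)) (ca (q div D)) (ca (q mod D)) \<and>
     sw False (sBR (p div D)) (sBR (p mod D)) (sBR (q div D)) (sBR (q mod D))) \<longleftrightarrow> p = q"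
    unfolding index_eq_iff[of p q] ca_sBR_inj[of "p div D"] ca_sBR_inj[of "p mod D"] sw_def by auto
  then show "E1 p q = idm m p q" unfolding E_sBR idm_def by auto
qed

lemma E'_hermitian: "E' False p q = cnj (E' False q p)"
  unfolding E'_eq E_sym[of False True True p q] E_sym[of False False False p q] E_sym[of True True True p q] by simp

lemma E'_supported: "supported m (E' False)"
  unfolding E'_eq supported_def by (auto simp: E_def)

lemma multiplicative_part:
  assumes "5 \<le> N"
  shows "\<exists>\<epsilon> > 0. \<exists>d > 0. multiplicative_2design D (ens_pow D (circC' N) d) \<epsilon> \<and> \<not> multiplicative_2design D (ens_pow D (circC N) d) \<epsilon>"
proof -
  obtain K where K: "0 < K" and cp: "\<And>w c. \<bar>w\<bar> = 1 \<Longrightarrow> 0 \<le> c \<Longrightarrow> completely_positive m (\<lambda>X p q. of_real (c * K) * moment2 D (haar D) X p q +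
      of_real (c * w) * (moment2 D (circC' N) X p q - moment2 D (haar D) X p q))"
    using circC'_dominated by blast
  \<comment> \<open>By the entry bound on \<open>E' False\<close>, adding this multiple of the
    identity makes the eigenvector positive semidefinite.\<close>
  define cc where "cc = real m * (1 + bnd)"
  have cc: "0 < cc" unfolding cc_def using m_pos bnd_pos by (intro mult_pos_pos) auto
  obtain d where d: "(2 * cc * K) * lamC' ^ d < 1 * lamC ^ Suc d"
    using geometric_separation[OF rates[OF assms], of "2 * cc * K" 1] cc K by auto
  define \<epsilon> where "\<epsilon> = lamC' ^ d * K"
  have l0: "0 < lamC' ^ d" by (rule zero_less_power[OF rates(1)[OF assms]])
  have \<epsilon>0: "0 < \<epsilon>" unfolding \<epsilon>_def by (rule mult_pos_pos[OF l0 K])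
  moreover have "multiplicative_2design D (ens_pow D (circC' N) (Suc d)) \<epsilon>"
    unfolding multiplicative_2design_def powC'_delta
    using cp[of 1 "lamC' ^ d"] cp[of "-1" "lamC' ^ d"] l0 by (simp add: \<epsilon>_def)
  moreover have "\<not> multiplicative_2design D (ens_pow D (circC N) (Suc d)) \<epsilon>"
  proof
    let ?P = "moment2 D (ens_pow D (circC N) (Suc d))" and ?h = "moment2 D (haar D)"
    assume "multiplicative_2design D (ens_pow D (circC N) (Suc d)) \<epsilon>"
    then have mult: "completely_positive m (\<lambda>X i j. of_real \<epsilon> * ?h X i j + (?P X i j - ?h X i j))"
      "completely_positive m (\<lambda>X i j. of_real \<epsilon> * ?h X i j - (?P X i j - ?h X i j))"
      by (simp_all add: multiplicative_2design_def)
    define X where "X i j = of_real cc * E1 i j + 1 * E' False i j" for i j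
    have psdX: "psd m X"
    proof -
      have "psd m (\<lambda>i j. of_real cc * idm m i j + E' False i j)"
        by (rule hermitian_add_identity_psd[OF E'_supported E'_hermitian E'_bound]) (simp add: cc_def)
      then show ?thesis unfolding X_def[abs_def] idm_E1 by (simp only: mult_1)
    qed
    have hX: "?h X = (\<lambda>i j. of_real cc * E1 i j)"
      unfolding X_def[abs_def] full_lin full_fixed full_E' by simp
    have PX: "?P X = (\<lambda>i j. of_real cc * E1 i j + of_real (lamC ^ Suc d) * E' False i j)"
      unfolding X_def[abs_def] moment2_linear[OF pow_ens(1)] powC_E1 powC_E' by simp
    \<comment> \<open>Diagonal entries of the image, with a trivial ancilla, are enough to
      contradict positivity.\<close>
    have test: "0 \<le> Re (\<Phi> X p p)" if "completely_positive m \<Phi>" "p < m" for \<Phi> p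
    proof -
      have "psd (m * 1) (tensor_id m 1 \<Phi> X)" using that(1) psdX unfolding completely_positive_def by (metis mult_1_right)
      then have "0 \<le> Re (tensor_id m 1 \<Phi> X p p)" using psd_diag[of "m * 1" _ p] that(2) by simp
      moreover have eq: "(\<lambda>i j. if i < m \<and> j < m then X (i * 1 + p mod 1) (j * 1 + p mod 1) else 0) = X"
        using psd_supported[OF psdX] by (intro ext) (auto simp: supported_def)
      have "tensor_id m 1 \<Phi> X p p = \<Phi> X p p" unfolding tensor_id_def eq using that(2) by simp
      ultimately show ?thesis by (simp only:)
    qed
    have D8: "8 \<le> D" using R2 by (simp add: D_eq)
    have m8: "8 < m" using mult_le_mono[OF D8 D8] by simp
    have dm: "1 div D = 0" "1 mod D = 1" "2 div D = 0" "2 mod D = 2" using D8 by simp_all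
    have E1v: "E1 1 1 = 1" "E1 2 2 = 1" using m8 by (simp_all add: idm_E1 idm_def)
    \<comment> \<open>The indices encode basis pairs that differ in A only and in B only. The two
      values differ by exactly 1, so adding the bounds at both entries eliminates
      \<open>al (2 * R)\<close>.\<close>
    have E'v: "E' False 1 1 = of_real (1 - al (2 * R))" "E' False 2 2 = of_real (- al (2 * R))"
    proof -
      have "1 < m" "2 < m" using m8 by simp_all
      then show "E' False 1 1 = of_real (1 - al (2 * R))" "E' False 2 2 = of_real (- al (2 * R))"
        unfolding E'_eq E1v unfolding E_def dm sw_def ca_def cb_def cr_def by simp_all
    qed
    have "0 \<le> \<epsilon> * cc + lamC ^ Suc d * Re (E' False p p)" "0 \<le> \<epsilon> * cc - lamC ^ Suc d * Re (E' False p p)"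
      if "E1 p p = 1" "p < m" for p
      using test[OF mult(1) that(2)] test[OF mult(2) that(2)] unfolding hX PX that(1) by (simp_all del: power_Suc)
    from this[OF E1v(1)] this[OF E1v(2)] have
      "0 \<le> \<epsilon> * cc + lamC ^ Suc d * (- al (2 * R))" "0 \<le> \<epsilon> * cc - lamC ^ Suc d * (- al (2 * R))"
      "0 \<le> \<epsilon> * cc + lamC ^ Suc d * (1 - al (2 * R))" "0 \<le> \<epsilon> * cc - lamC ^ Suc d * (1 - al (2 * R))"
      unfolding E'v using m8 by (simp_all del: power_Suc)
    then have "lamC ^ Suc d \<le> 2 * (\<epsilon> * cc)" by (simp only: right_diff_distrib)
    then show False using d unfolding \<epsilon>_def by (simp add: mult_ac)
  qed
  ultimately show ?thesis by blast
qed

end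

theorem theorem1:
  shows "\<exists>N0. \<forall>N \<ge> N0.
    (\<exists>\<epsilon> > 0. \<exists>d > 0. additive_2design (2 ^ N) (ens_pow (2 ^ N) (circC' N) d) \<epsilon> \<and>
                        \<not> additive_2design (2 ^ N) (ens_pow (2 ^ N) (circC N) d) \<epsilon>) \<and>
    (\<exists>\<epsilon> > 0. \<exists>d > 0. multiplicative_2design (2 ^ N) (ens_pow (2 ^ N) (circC' N) d) \<epsilon> \<and>
                        \<not> multiplicative_2design (2 ^ N) (ens_pow (2 ^ N) (circC N) d) \<epsilon>)"
proof (intro exI[of _ 5] allI impI)
  fix N :: nat assume N: "5 \<le> N"
  interpret qubits N by standard (use N in simp)
  show "(\<exists>\<epsilon> > 0. \<exists>d > 0. additive_2design (2 ^ N) (ens_pow (2 ^ N) (circC' N) d) \<epsilon> \<and>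
                        \<not> additive_2design (2 ^ N) (ens_pow (2 ^ N) (circC N) d) \<epsilon>) \<and>
    (\<exists>\<epsilon> > 0. \<exists>d > 0. multiplicative_2design (2 ^ N) (ens_pow (2 ^ N) (circC' N) d) \<epsilon> \<and>
                        \<not> multiplicative_2design (2 ^ N) (ens_pow (2 ^ N) (circC N) d) \<epsilon>)"
    unfolding D_def[symmetric] using additive_part[OF N] multiplicative_part[OF N] by blast
qed

end
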